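(* The following are equivalent over $\mathsf{RCA}_0 + \mathsf{I}\Sigma^0_2$: (i) $\mathsf{SRRT}^2_2$; (ii) any uniform family $(X_e)_{e\in\mathbb{N}}$ of $\Sigma^0_2$ finite sets whose sizes are uniformly $\Delta^0_2$ has an escaping function; (iii) any $\Delta^0_2$ function $h:\mathbb{N}\to\mathbb{N}$ has a diagonalizing function.
   Context: $\mathsf{RCA}_0$ is the usual base system of reverse mathematics, and $\mathsf{I}\Sigma^0_2$ is the induction scheme for $\Sigma^0_2$ formulas. $\Sigma^0_2$ and $\Delta^0_2$ are understood with set parameters allowed (i.e. relative to an arbitrary set). In (iii) $h$ is total. $f:[\mathbb{N}]^2\to\mathbb{N}$ (defined on pairs $x<s$) is 2-bounded if $|f^{-1}(y)|\le2$ for every $y$. It is rainbow-stable if for every $x$ one of the following holds: (a) there is $y\neq x$ with $f(x,s)=f(y,s)$ for all but finitely many $s$; or (b) for all but finitely many $s$ there is no $y\ne x$ with $f(x,s)=f(y,s)$. A set $R$ is a rainbow for $f$ if $f$ is injective on $[R]^2$. $\mathsf{SRRT}^2_2$ is the statement "every rainbow-stable 2-bounded coloring $f:[\mathbb{N}]^2\to\mathbb{N}$ has an infinite rainbow". Given a uniform family $(X_e)_{e\in\mathbb{N}}$ of finite sets, an $(X_e)$-escaping function is a function $f:\mathbb{N}^2\to\mathbb{N}$ such that $(\forall e)(\forall n)[\,|X_e|\le n \rightarrow f(e,n)\notin X_e\,]$. A family is a uniform family of $\Sigma^0_2$ finite sets if the relation $x\in X_e$ is $\Sigma^0_2$ and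 each $X_e$ is finite; its sizes are uniformly $\Delta^0_2$ if the function $e\mapsto|X_e|$ is $\Delta^0_2$. Given $h:\mathbb{N}\to\mathbb{N}$, an $h$-diagonalizing function is a function $f:\mathbb{N}\to\mathbb{N}$ such that $f(x)\neq h(x)$ for every $x$. *)

theory Defs
  imports Main
begin

text \<open>
  Structures for the language of second-order arithmetic, with Henkin semantics: the number sort
  is the whole type \<open>'a\<close>, and set variables range over \<open>sets_of M\<close>, an arbitrary nonempty family of
  subsets of \<open>'a\<close>. Since \<open>'a\<close> is arbitrary, nonstandard models and non-\<open>\<omega>\<close>-models are covered.
  ``Equivalent over a theory'' is rendered as: in every model of the theory the statements have
  the same truth value. By the completeness theorem this is provable equivalence.
\<close>

record 'a l2_struct =
  zero_of  :: 'a
  one_of   :: 'a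
  plus_of  :: "'a \<Rightarrow> 'a \<Rightarrow> 'a"
  times_of :: "'a \<Rightarrow> 'a \<Rightarrow> 'a"
  less_of  :: "'a \<Rightarrow> 'a \<Rightarrow> bool"
  sets_of  :: "'a set set"

datatype tm = NVar nat | TZero | TOne | TAdd tm tm | TMul tm tm

text \<open>
  No set quantifiers are needed for the arithmetical hierarchy; the second argument of \<open>FMem\<close> is
  a free set variable. In \<open>FBAll x t \<phi>\<close>, read ``for all \<open>x < t\<close>, \<open>\<phi>\<close>'', the bound \<open>t\<close> is evaluated
  outside the scope of \<open>x\<close>.
\<close>

datatype fm =
    FEq tm tm
  | FLt tm tm
  | FMem tm nat
  | FNeg fm
  | FAnd fm fm
  | FBAll nat tm fm
  | FAll nat fm
  | FEx nat fm

primrec tm_val :: "'a l2_struct \<Rightarrow> (nat \<Rightarrow> 'a) \<Rightarrow> tm \<Rightarrow> 'a" where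
  "tm_val M e (NVar i) = e i"
| "tm_val M e TZero = zero_of M"
| "tm_val M e TOne = one_of M"
| "tm_val M e (TAdd s t) = plus_of M (tm_val M e s) (tm_val M e t)"
| "tm_val M e (TMul s t) = times_of M (tm_val M e s) (tm_val M e t)"

primrec sat :: "'a l2_struct \<Rightarrow> (nat \<Rightarrow> 'a set) \<Rightarrow> (nat \<Rightarrow> 'a) \<Rightarrow> fm \<Rightarrow> bool" where
  "sat M V e (FEq s t) \<longleftrightarrow> tm_val M e s = tm_val M e t"
| "sat M V e (FLt s t) \<longleftrightarrow> less_of M (tm_val M e s) (tm_val M e t)"
| "sat M V e (FMem t i) \<longleftrightarrow> tm_val M e t \<in> V i"
| "sat M V e (FNeg \<phi>) \<longleftrightarrow> \<not> sat M V e \<phi>"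
| "sat M V e (FAnd \<phi> \<psi>) \<longleftrightarrow> sat M V e \<phi> \<and> sat M V e \<psi>"
| "sat M V e (FBAll x t \<phi>) \<longleftrightarrow> (\<forall>a. less_of M a (tm_val M e t) \<longrightarrow> sat M V (e(x := a)) \<phi>)"
| "sat M V e (FAll x \<phi>) \<longleftrightarrow> (\<forall>a. sat M V (e(x := a)) \<phi>)"
| "sat M V e (FEx x \<phi>) \<longleftrightarrow> (\<exists>a. sat M V (e(x := a)) \<phi>)"

primrec bounded_fm :: "fm \<Rightarrow> bool" where
  "bounded_fm (FEq s t) = True"
| "bounded_fm (FLt s t) = True"
| "bounded_fm (FMem t i) = True"
| "bounded_fm (FNeg \<phi>) = bounded_fm \<phi>"
| "bounded_fm (FAnd \<phi> \<psi>) = (bounded_fm \<phi> \<and> bounded_fm \<psi>)"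
| "bounded_fm (FBAll x t \<phi>) = bounded_fm \<phi>"
| "bounded_fm (FAll x \<phi>) = False"
| "bounded_fm (FEx x \<phi>) = False"

text \<open>As in Simpson's book, the quantifier prefix of a \<open>\<Sigma>\<^sup>0\<^sub>k\<close> formula is \<open>k\<close> alternating
  single quantifiers in front of a bounded-quantifier matrix.\<close>

fun Sigma_fm :: "nat \<Rightarrow> fm \<Rightarrow> bool" and Pi_fm :: "nat \<Rightarrow> fm \<Rightarrow> bool" where
  "Sigma_fm 0 \<phi> = bounded_fm \<phi>"
| "Sigma_fm (Suc k) \<phi> = (\<exists>x \<psi>. \<phi> = FEx x \<psi> \<and> Pi_fm k \<psi>)"
| "Pi_fm 0 \<phi> = bounded_fm \<phi>"
| "Pi_fm (Suc k) \<phi> = (\<exists>x \<psi>. \<phi> = FAll x \<psi> \<and> Sigma_fm k \<psi>)"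

text \<open>
  Subsets of \<open>'a\<close> and of \<open>'a \<times> 'a\<close> definable in \<open>M\<close>: variable 0 (variables 0 and 1) hold the
  arguments, the remaining values of \<open>e\<close> are number parameters and \<open>V\<close> gives the set parameters,
  which must belong to \<open>M\<close>. The defined sets themselves need not belong to \<open>M\<close>. Quantifying
  over all of them amounts to quantifying, inside \<open>M\<close>, over the parameters of a universal formula.
\<close>

definition definable1 :: "'a l2_struct \<Rightarrow> (fm \<Rightarrow> bool) \<Rightarrow> 'a set \<Rightarrow> bool" where
  "definable1 M \<Phi> A \<longleftrightarrow>
     (\<exists>\<phi> V e. \<Phi> \<phi> \<and> range V \<subseteq> sets_of M \<and> A = {a. sat M V (e(0 := a)) \<phi>})"

definition definable2 :: "'a l2_struct \<Rightarrow> (fm \<Rightarrow> bool) \<Rightarrow> ('a \<times> 'a) set \<Rightarrow> bool" where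
  "definable2 M \<Phi> R \<longleftrightarrow>
     (\<exists>\<phi> V e. \<Phi> \<phi> \<and> range V \<subseteq> sets_of M \<and> R = {(a, b). sat M V (e(0 := a, 1 := b)) \<phi>})"

definition Delta_set :: "'a l2_struct \<Rightarrow> nat \<Rightarrow> 'a set \<Rightarrow> bool" where
  "Delta_set M k A \<longleftrightarrow> definable1 M (Sigma_fm k) A \<and> definable1 M (Pi_fm k) A"

definition Delta_rel :: "'a l2_struct \<Rightarrow> nat \<Rightarrow> ('a \<times> 'a) set \<Rightarrow> bool" where
  "Delta_rel M k R \<longleftrightarrow> definable2 M (Sigma_fm k) R \<and> definable2 M (Pi_fm k) R"

definition Delta_fun :: "'a l2_struct \<Rightarrow> nat \<Rightarrow> ('a \<Rightarrow> 'a) \<Rightarrow> bool" where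
  "Delta_fun M k h \<longleftrightarrow> Delta_rel M k {(x, y). y = h x}"

definition basic_axioms :: "'a l2_struct \<Rightarrow> bool" where
  "basic_axioms M \<longleftrightarrow>
     (let z = zero_of M; u = one_of M; p = plus_of M; t = times_of M; l = less_of M in
       (\<forall>n. p n u \<noteq> z) \<and>
       (\<forall>m n. p m u = p n u \<longrightarrow> m = n) \<and>
       (\<forall>m. p m z = m) \<and>
       (\<forall>m n. p m (p n u) = p (p m n) u) \<and>
       (\<forall>m. t m z = z) \<and>
       (\<forall>m n. t m (p n u) = p (t m n) m) \<and>
       (\<forall>m. \<not> l m z) \<and>
       (\<forall>m n. l m (p n u) \<longleftrightarrow> l m n \<or> m = n))"

definition ISigma :: "'a l2_struct \<Rightarrow> nat \<Rightarrow> bool" where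
  "ISigma M k \<longleftrightarrow>
     (\<forall>A. definable1 M (Sigma_fm k) A \<longrightarrow>
        zero_of M \<in> A \<longrightarrow> (\<forall>n. n \<in> A \<longrightarrow> plus_of M n (one_of M) \<in> A) \<longrightarrow> (\<forall>n. n \<in> A))"

definition Delta1_CA :: "'a l2_struct \<Rightarrow> bool" where
  "Delta1_CA M \<longleftrightarrow> (\<forall>A. Delta_set M 1 A \<longrightarrow> A \<in> sets_of M)"

definition RCA0 :: "'a l2_struct \<Rightarrow> bool" where
  "RCA0 M \<longleftrightarrow> sets_of M \<noteq> {} \<and> basic_axioms M \<and> ISigma M 1 \<and> Delta1_CA M"

text \<open>Simpson's pairing \<open>(i, j) = (i + j)\<^sup>2 + i\<close>.\<close>

definition pair_of :: "'a l2_struct \<Rightarrow> 'a \<Rightarrow> 'a \<Rightarrow> 'a" where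
  "pair_of M i j = plus_of M (times_of M (plus_of M i j) (plus_of M i j)) i"

text \<open>The restriction of \<open>f\<close> to \<open>D\<close> exists in \<open>M\<close>, i.e. its coded graph is a set of \<open>M\<close>; values
  outside \<open>D\<close> play no role.\<close>

definition in_model1 :: "'a l2_struct \<Rightarrow> 'a set \<Rightarrow> ('a \<Rightarrow> 'a) \<Rightarrow> bool" where
  "in_model1 M D f \<longleftrightarrow> {pair_of M x (f x) | x. x \<in> D} \<in> sets_of M"

definition in_model2 :: "'a l2_struct \<Rightarrow> ('a \<times> 'a) set \<Rightarrow> ('a \<Rightarrow> 'a \<Rightarrow> 'a) \<Rightarrow> bool" where
  "in_model2 M D f \<longleftrightarrow>
     {pair_of M (pair_of M x y) (f x y) | x y. (x, y) \<in> D} \<in> sets_of M"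

text \<open>Finiteness is the internal one (boundedness in \<open>M\<close>), not finiteness in the metatheory.\<close>

definition finite_in :: "'a l2_struct \<Rightarrow> 'a set \<Rightarrow> bool" where
  "finite_in M A \<longleftrightarrow> (\<exists>b. \<forall>x\<in>A. less_of M x b)"

definition almost_all :: "'a l2_struct \<Rightarrow> ('a \<Rightarrow> bool) \<Rightarrow> bool" where
  "almost_all M P \<longleftrightarrow> finite_in M {s. \<not> P s}"

text \<open>\<open>|A| = n\<close> in \<open>M\<close>: a bijection between \<open>{i. i < n}\<close> and \<open>A\<close> exists in \<open>M\<close>. Here \<open>n\<close> is an
  element of \<open>M\<close>, possibly nonstandard.\<close>

definition has_card :: "'a l2_struct \<Rightarrow> 'a set \<Rightarrow> 'a \<Rightarrow> bool" where
  "has_card M A n \<longleftrightarrow>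
     (\<exists>g. in_model1 M {i. less_of M i n} g \<and> bij_betw g {i. less_of M i n} A)"

definition card_le :: "'a l2_struct \<Rightarrow> 'a set \<Rightarrow> 'a \<Rightarrow> bool" where
  "card_le M A n \<longleftrightarrow> (\<exists>m. has_card M A m \<and> (less_of M m n \<or> m = n))"

definition pairs_of :: "'a l2_struct \<Rightarrow> 'a set \<Rightarrow> ('a \<times> 'a) set" where
  "pairs_of M A = {(x, s). x \<in> A \<and> s \<in> A \<and> less_of M x s}"

text \<open>As 2 is a standard number, ``at most two elements'' may be expressed in the metatheory.\<close>

definition two_bounded :: "'a l2_struct \<Rightarrow> ('a \<Rightarrow> 'a \<Rightarrow> 'a) \<Rightarrow> bool" where
  "two_bounded M f \<longleftrightarrow>
     (\<forall>y. finite {(x, s) \<in> pairs_of M UNIV. f x s = y} \<and>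
          card {(x, s) \<in> pairs_of M UNIV. f x s = y} \<le> 2)"

text \<open>The conditions \<open>x < s\<close>, \<open>y < s\<close> only say that \<open>f x s\<close>, \<open>f y s\<close> are defined.\<close>

definition rainbow_stable :: "'a l2_struct \<Rightarrow> ('a \<Rightarrow> 'a \<Rightarrow> 'a) \<Rightarrow> bool" where
  "rainbow_stable M f \<longleftrightarrow>
     (\<forall>x.
       (\<exists>y. y \<noteq> x \<and> almost_all M (\<lambda>s. less_of M x s \<and> less_of M y s \<and> f x s = f y s)) \<or>
       almost_all M (\<lambda>s. less_of M x s \<and> \<not> (\<exists>y. y \<noteq> x \<and> less_of M y s \<and> f x s = f y s)))"

definition rainbow :: "'a l2_struct \<Rightarrow> ('a \<Rightarrow> 'a \<Rightarrow> 'a) \<Rightarrow> 'a set \<Rightarrow> bool" where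
  "rainbow M f R \<longleftrightarrow> inj_on (\<lambda>(x, s). f x s) (pairs_of M R)"

definition SRRT22 :: "'a l2_struct \<Rightarrow> bool" where
  "SRRT22 M \<longleftrightarrow>
     (\<forall>f. in_model2 M (pairs_of M UNIV) f \<and> two_bounded M f \<and> rainbow_stable M f \<longrightarrow>
        (\<exists>R\<in>sets_of M. \<not> finite_in M R \<and> rainbow M f R))"

definition uniform_Sigma2_finite_family :: "'a l2_struct \<Rightarrow> ('a \<Rightarrow> 'a set) \<Rightarrow> bool" where
  "uniform_Sigma2_finite_family M X \<longleftrightarrow>
     definable2 M (Sigma_fm 2) {(e, x). x \<in> X e} \<and> (\<forall>e. finite_in M (X e))"

definition sizes_uniformly_Delta2 :: "'a l2_struct \<Rightarrow> ('a \<Rightarrow> 'a set) \<Rightarrow> bool" where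
  "sizes_uniformly_Delta2 M X \<longleftrightarrow> (\<exists>c. Delta_fun M 2 c \<and> (\<forall>e. has_card M (X e) (c e)))"

definition escaping :: "'a l2_struct \<Rightarrow> ('a \<Rightarrow> 'a set) \<Rightarrow> ('a \<Rightarrow> 'a \<Rightarrow> 'a) \<Rightarrow> bool" where
  "escaping M X f \<longleftrightarrow> (\<forall>e n. card_le M (X e) n \<longrightarrow> f e n \<notin> X e)"

definition diagonalizing :: "('a \<Rightarrow> 'a) \<Rightarrow> ('a \<Rightarrow> 'a) \<Rightarrow> bool" where
  "diagonalizing h f \<longleftrightarrow> (\<forall>x. f x \<noteq> h x)"

definition escaping_principle :: "'a l2_struct \<Rightarrow> bool" where
  "escaping_principle M \<longleftrightarrow>
     (\<forall>X. uniform_Sigma2_finite_family M X \<and> sizes_uniformly_Delta2 M X \<longrightarrow>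
        (\<exists>f. in_model2 M UNIV f \<and> escaping M X f))"

definition diagonalizing_principle :: "'a l2_struct \<Rightarrow> bool" where
  "diagonalizing_principle M \<longleftrightarrow>
     (\<forall>h. Delta_fun M 2 h \<longrightarrow> (\<exists>f. in_model1 M UNIV f \<and> diagonalizing h f))"

end

theory Submission
  imports Defs
begin

text \<open>
  A diagonalizing function lets one avoid many \<open>\<Delta>\<^sup>0\<^sub>2\<close> values at once: to differ from
  \<open>H a 0, \<dots>, H a (n - 1)\<close>, output the code of a sequence whose \<open>i\<close>-th entry differs from the
  \<open>i\<close>-th entry of \<open>H a i\<close> (read as a sequence code). Letting \<open>H\<close> enumerate \<open>X\<^sub>e\<close> gives an escaping
  function. For a rainbow-stable colouring, letting \<open>H\<close> list the limit partners of the numbers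
  chosen so far gives arbitrarily large numbers that are partners of none of them; every sufficiently
  large one extends the rainbow.

  Conversely, given \<open>h\<close>, choose distinct numbers \<open>q 0, q 1, \<dots>\<close> with \<open>q (2 e)\<close> and
  \<open>q (2 e + 1)\<close> among the entries of the sequence coded by \<open>h e\<close>, as long as these are distinct and
  large. A colouring in which \<open>q (2 e)\<close> and \<open>q (2 e + 1)\<close> are limit partners has no infinite
  rainbow with an initial segment of suitable length coded by \<open>h e\<close>; so coding initial segments of a
  rainbow diagonalizes against \<open>h\<close>.
\<close>

section \<open>Definable predicates\<close>

text \<open>A rainbow must be a set of the model, so it has to come from a computable recursion,
  whereas being a limit partner is only a Delta_2 notion. The recursion never tests it: a candidate
  is accepted with a certificate that the diagonalizing procedure produced it, which is a Sigma_1
  condition. In the converse the chosen numbers are only Delta_2, and the colouring follows a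
  computable approximation to them. The \<open>n\<close>-th choice inspects the entries from
  \<open>n\<close> to \<open>2 n\<close> of the coded sequence: there are more of them than earlier
  choices, and an increasing enumeration of a rainbow has entries at least \<open>n\<close> there.
  Choices that are at least as large as their index keep the colouring stable. Finite means bounded
  in the model. Lists may have nonstandard length and are coded by numbers, sizes are compared by an
  internal pigeonhole principle, and Sigma_2 induction yields a common threshold for the limits
  along such a list.\<close>

definition scons :: "'a \<Rightarrow> (nat \<Rightarrow> 'a) \<Rightarrow> nat \<Rightarrow> 'a" where
  "scons a e i = (case i of 0 \<Rightarrow> a | Suc j \<Rightarrow> e j)"

lemma scons_simps [simp]: "scons a e 0 = a" "scons a e (Suc i) = e i"
  by (simp_all add: scons_def)

section \<open>Renaming of variables in formulas\<close>

primrec ren_tm :: "(nat \<Rightarrow> nat) \<Rightarrow> tm \<Rightarrow> tm" where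
  "ren_tm r (NVar i) = NVar (r i)"
| "ren_tm r TZero = TZero"
| "ren_tm r TOne = TOne"
| "ren_tm r (TAdd s t) = TAdd (ren_tm r s) (ren_tm r t)"
| "ren_tm r (TMul s t) = TMul (ren_tm r s) (ren_tm r t)"

primrec ren_fm :: "(nat \<Rightarrow> nat) \<Rightarrow> (nat \<Rightarrow> nat) \<Rightarrow> fm \<Rightarrow> fm" where
  "ren_fm r q (FEq s t) = FEq (ren_tm r s) (ren_tm r t)"
| "ren_fm r q (FLt s t) = FLt (ren_tm r s) (ren_tm r t)"
| "ren_fm r q (FMem t i) = FMem (ren_tm r t) (q i)"
| "ren_fm r q (FNeg \<phi>) = FNeg (ren_fm r q \<phi>)"
| "ren_fm r q (FAnd \<phi> \<psi>) = FAnd (ren_fm r q \<phi>) (ren_fm r q \<psi>)"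
| "ren_fm r q (FBAll x t \<phi>) = FBAll (r x) (ren_tm r t) (ren_fm r q \<phi>)"
| "ren_fm r q (FAll x \<phi>) = FAll (r x) (ren_fm r q \<phi>)"
| "ren_fm r q (FEx x \<phi>) = FEx (r x) (ren_fm r q \<phi>)"

lemma tm_val_ren: "tm_val M e (ren_tm r t) = tm_val M (\<lambda>i. e (r i)) t"
  by (induction t) auto

lemma fun_upd_inj: "inj r \<Longrightarrow> (\<lambda>i. (e(r x := a)) (r i)) = (\<lambda>i. e (r i))(x := a)"
  by (auto simp: fun_eq_iff inj_eq)

lemma sat_ren:
  assumes "inj r"
  shows "sat M V e (ren_fm r q \<phi>) \<longleftrightarrow> sat M (\<lambda>i. V (q i)) (\<lambda>i. e (r i)) \<phi>"
  by (induction \<phi> arbitrary: e) (simp_all add: tm_val_ren fun_upd_inj[OF assms] del: fun_upd_apply)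

lemma bounded_ren [simp]: "bounded_fm (ren_fm r q \<phi>) = bounded_fm \<phi>"
  by (induction \<phi>) auto

lemma Sigma_Pi_ren:
  "Sigma_fm k \<phi> \<Longrightarrow> Sigma_fm k (ren_fm r q \<phi>)"
  "Pi_fm k \<phi> \<Longrightarrow> Pi_fm k (ren_fm r q \<phi>)"
  by (induction k arbitrary: \<phi>) auto

text \<open>Even-numbered variables carry the environment, odd-numbered ones the number parameters.\<close>

definition mix :: "(nat \<Rightarrow> 'a) \<Rightarrow> (nat \<Rightarrow> 'a) \<Rightarrow> nat \<Rightarrow> 'a" where
  "mix e p i = (if even i then e (i div 2) else p (i div 2))"

lemma mix_simps [simp]: "mix e p (2 * i) = e i" "mix e p (Suc (2 * i)) = p i"
  by (simp_all add: mix_def)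

text \<open>Environment variables stay and only parameters move, so that formulas with parameter
  lists \<open>p\<close> and \<open>q\<close> can be rewritten to share the list
  \<open>mix p q\<close>.\<close>

definition split_ren :: "(nat \<Rightarrow> nat) \<Rightarrow> nat \<Rightarrow> nat" where
  "split_ren s i = (if even i then i else Suc (2 * s (i div 2)))"

lemma split_ren_simps:
  "split_ren s (2 * i) = 2 * i" "split_ren s (Suc (2 * i)) = Suc (2 * s i)"
  by (simp_all add: split_ren_def)

lemma nat_parity_cases:
  fixes i :: nat
  obtains j where "i = 2 * j" | j where "i = Suc (2 * j)"
  by (cases "even i") (auto elim!: evenE oddE)

lemma inj_split_ren: "inj s \<Longrightarrow> inj (split_ren s)"
  apply (rule injI)
  subgoal for x y
    apply (rule nat_parity_cases[of x]; rule nat_parity_cases[of y])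
       apply (auto simp: split_ren_simps inj_eq)
     apply presburger+
    done
  done

lemma mix_split_ren: "(\<lambda>i. mix e p (split_ren s i)) = mix e (\<lambda>i. p (s i))"
proof
  fix i show "mix e p (split_ren s i) = mix e (\<lambda>i. p (s i)) i"
    by (rule nat_parity_cases[of i]) (simp_all add: split_ren_simps)
qed

text \<open>Takes the innermost entry out of the environment and makes it variable 1, the first
  parameter slot, over which a formula can quantify. The other entries move down by one place and
  the parameters up by one slot, so that the old content of variable 1 is a mere
  placeholder.\<close>

definition shift_ren :: "nat \<Rightarrow> nat" where
  "shift_ren i = (if i = 0 then 1 else if even i then i - 2 else i + 2)"

lemma inj_shift_ren: "inj shift_ren"
proof (rule injI)
  fix x y assume "shift_ren x = shift_ren y"
  then show "x = y"
    apply (auto simp: shift_ren_def split: if_splits)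
    by presburger+
qed

lemma mix_shift_ren: "(\<lambda>i. ((mix e (scons b p))(Suc 0 := a)) (shift_ren i)) = mix (scons a e) p"
proof
  fix i show "((mix e (scons b p))(Suc 0 := a)) (shift_ren i) = mix (scons a e) p i"
  proof (rule nat_parity_cases[of i])
    fix j assume i: "i = 2 * j"
    then show ?thesis
      by (cases j) (auto simp: shift_ren_def mix_def)
  next
    fix j assume i: "i = Suc (2 * j)"
    have "shift_ren i = Suc (2 * Suc j)" by (simp add: i shift_ren_def)
    then show ?thesis by (simp add: i del: mult_Suc_right)
  qed
qed

locale l2 =
  fixes M :: "'a l2_struct"
  assumes sets_nonempty: "sets_of M \<noteq> {}"
begin

abbreviation zro ("\<zero>") where "\<zero> \<equiv> zero_of M"
abbreviation oneM ("\<one>") where "\<one> \<equiv> one_of M"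
abbreviation add (infixl "\<oplus>" 65) where "x \<oplus> y \<equiv> plus_of M x y"
abbreviation mult (infixl "\<otimes>" 70) where "x \<otimes> y \<equiv> times_of M x y"
abbreviation lt (infix "\<prec>" 50) where "x \<prec> y \<equiv> less_of M x y"
abbreviation "S \<equiv> sets_of M"

inductive poly :: "((nat \<Rightarrow> 'a) \<Rightarrow> 'a) \<Rightarrow> bool" where
  poly_var: "poly (\<lambda>e. e i)"
| poly_const: "poly (\<lambda>e. c)"
| poly_add: "poly F \<Longrightarrow> poly G \<Longrightarrow> poly (\<lambda>e. F e \<oplus> G e)"
| poly_mult: "poly F \<Longrightarrow> poly G \<Longrightarrow> poly (\<lambda>e. F e \<otimes> G e)"

text \<open>Definability is treated semantically, for predicates on environments whose entry 0 is the
  innermost bound variable. Parameters enter as constants, and the closure rules apply by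
  unification. In a model of \<open>RCA\<^sub>0\<close>, \<open>D0\<close> turns out to be closed under \<open>\<Delta>\<^sup>0\<^sub>1\<close> definitions
  (\<open>delta1_comprehension\<close>).\<close>

inductive D0 :: "((nat \<Rightarrow> 'a) \<Rightarrow> bool) \<Rightarrow> bool" where
  D0p_eq: "poly F \<Longrightarrow> poly G \<Longrightarrow> D0 (\<lambda>e. F e = G e)"
| D0p_lt: "poly F \<Longrightarrow> poly G \<Longrightarrow> D0 (\<lambda>e. F e \<prec> G e)"
| D0p_mem: "poly F \<Longrightarrow> A \<in> S \<Longrightarrow> D0 (\<lambda>e. F e \<in> A)"
| D0_not: "D0 P \<Longrightarrow> D0 (\<lambda>e. \<not> P e)"
| D0_and: "D0 P \<Longrightarrow> D0 Q \<Longrightarrow> D0 (\<lambda>e. P e \<and> Q e)"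
| D0p_ball': "poly F \<Longrightarrow> D0 P \<Longrightarrow> D0 (\<lambda>e. \<forall>a. a \<prec> F e \<longrightarrow> P (scons a e))"

definition lift :: "(nat \<Rightarrow> (nat \<Rightarrow> 'a) \<Rightarrow> 'a) \<Rightarrow> nat \<Rightarrow> (nat \<Rightarrow> 'a) \<Rightarrow> 'a" where
  "lift \<sigma> i = (case i of 0 \<Rightarrow> (\<lambda>e. e 0) | Suc j \<Rightarrow> (\<lambda>e. \<sigma> j (\<lambda>i. e (Suc i))))"

lemma lift_scons: "(\<lambda>i. lift \<sigma> i (scons a e)) = scons a (\<lambda>i. \<sigma> i e)"
  by (auto simp: fun_eq_iff lift_def scons_def split: nat.split)

lemma poly_subst: "poly F \<Longrightarrow> (\<And>i. poly (\<sigma> i)) \<Longrightarrow> poly (\<lambda>e. F (\<lambda>i. \<sigma> i e))"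
proof (induction rule: poly.induct)
  case (poly_const c) show ?case by (rule poly.poly_const)
next
  case (poly_add F G) then show ?case by (intro poly.poly_add) simp_all
next
  case (poly_mult F G) then show ?case by (intro poly.poly_mult) simp_all
qed simp

lemma poly_lift: "(\<And>i. poly (\<sigma> i)) \<Longrightarrow> poly (lift \<sigma> i)"
  using poly_subst[of "\<sigma> j" "\<lambda>i e. e (Suc i)" for j]
  by (simp add: lift_def poly_var split: nat.split)

lemma D0_psubst: "D0 P \<Longrightarrow> (\<And>i. poly (\<sigma> i)) \<Longrightarrow> D0 (\<lambda>e. P (\<lambda>i. \<sigma> i e))"
proof (induction arbitrary: \<sigma> rule: D0.induct)
  case (D0p_ball' F P)
  have "D0 (\<lambda>e. \<forall>a. a \<prec> F (\<lambda>i. \<sigma> i e) \<longrightarrow> P (\<lambda>i. lift \<sigma> i (scons a e)))"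
    using D0.D0p_ball'[OF poly_subst[of F \<sigma>] D0p_ball'.IH[of "lift \<sigma>"]] D0p_ball'
    by (simp add: poly_lift)
  then show ?case by (simp add: lift_scons)
next
  case (D0p_eq F G) then show ?case
    using D0.D0p_eq[OF poly_subst[of F \<sigma>] poly_subst[of G \<sigma>]] by simp
next
  case (D0p_lt F G) then show ?case
    using D0.D0p_lt[OF poly_subst[of F \<sigma>] poly_subst[of G \<sigma>]] by simp
next
  case (D0p_mem F A) then show ?case
    using D0.D0p_mem[OF poly_subst[of F \<sigma>]] by simp
next
  case (D0_not P) then show ?case by (intro D0.D0_not) simp
next
  case (D0_and P Q) then show ?case by (intro D0.D0_and) simp_all
qed

lemma D0_ren: "D0 P \<Longrightarrow> D0 (\<lambda>e. P (\<lambda>i. e (r i)))"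
  using D0_psubst[of P "\<lambda>i e. e (r i)"] by (simp add: poly_var)

text \<open>What makes a predicate accessible to unary comprehension: the standard number of entries
  on which it depends can be packed into one number.\<close>

definition supp :: "nat \<Rightarrow> ((nat \<Rightarrow> 'a) \<Rightarrow> 'b) \<Rightarrow> bool" where
  "supp n P \<longleftrightarrow> (\<forall>e e'. (\<forall>i<n. e i = e' i) \<longrightarrow> P e = P e')"

lemma supp_comb: "supp n P \<Longrightarrow> supp m Q \<Longrightarrow> supp (max n m) (\<lambda>e. h (P e) (Q e))"
  unfolding supp_def
proof (intro allI impI)
  fix e e' :: "nat \<Rightarrow> 'a"
  assume *: "\<forall>e e'. (\<forall>i<n. e i = e' i) \<longrightarrow> P e = P e'" "\<forall>e e'. (\<forall>i<m. e i = e' i) \<longrightarrow> Q e = Q e'"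
    and "\<forall>i<max n m. e i = e' i"
  then have "\<forall>i<n. e i = e' i" "\<forall>i<m. e i = e' i" by auto
  then have "P e = P e'" "Q e = Q e'" using *(1)[rule_format, of e e'] *(2)[rule_format, of e e'] by auto
  then show "h (P e) (Q e) = h (P e') (Q e')" by simp
qed

lemma supp_comb_ex:
  "\<exists>n. supp n P \<Longrightarrow> \<exists>n. supp n Q \<Longrightarrow> \<exists>n. supp n (\<lambda>e. h (P e) (Q e))"
  using supp_comb by metis

lemma poly_supp: "poly F \<Longrightarrow> \<exists>n. supp n F"
proof (induction rule: poly.induct)
  case (poly_var i) show ?case by (rule exI[of _ "Suc i"]) (simp add: supp_def)
next
  case (poly_const c) show ?case by (rule exI[of _ 0]) (simp add: supp_def)
next
  case (poly_add F G) show ?case by (rule supp_comb_ex[OF poly_add.IH])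
next
  case (poly_mult F G) show ?case by (rule supp_comb_ex[OF poly_mult.IH])
qed

lemma D0_supp: "D0 P \<Longrightarrow> \<exists>n. supp n P"
proof (induction rule: D0.induct)
  case (D0p_eq F G) show ?case by (rule supp_comb_ex[OF D0p_eq[THEN poly_supp]])
next
  case (D0p_lt F G) show ?case by (rule supp_comb_ex[OF D0p_lt[THEN poly_supp]])
next
  case (D0p_mem F A)
  show ?case by (rule supp_comb_ex[OF poly_supp[OF D0p_mem(1)] poly_supp[OF D0p_mem(1)], of "\<lambda>x y. x \<in> A"])
next
  case (D0_not P)
  show ?case by (rule supp_comb_ex[OF D0_not.IH D0_not.IH, of "\<lambda>x y. \<not> x"])
next
  case (D0_and P Q) show ?case by (rule supp_comb_ex[OF D0_and.IH])
next
  case (D0p_ball' F P)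
  obtain m where m: "supp m P" using D0p_ball'.IH by (rule exE)
  have "supp m (\<lambda>e a. P (scons a e))"
    unfolding supp_def
  proof (intro allI impI ext)
    fix e e' :: "nat \<Rightarrow> 'a" and a assume "\<forall>i<m. e i = e' i"
    then have "\<forall>i<m. scons a e i = scons a e' i" by (auto simp: scons_def split: nat.split)
    then show "P (scons a e) = P (scons a e')" using m by (simp add: supp_def)
  qed
  then have "\<exists>n. supp n (\<lambda>e a. P (scons a e))" by (rule exI)
  from supp_comb_ex[OF poly_supp[OF D0p_ball'(1)] this, of "\<lambda>x p. \<forall>a. a \<prec> x \<longrightarrow> p a"]
  show ?case by simp
qed

lemma poly_tm_val: "poly (\<lambda>e. tm_val M e t)"
  by (induction t) (simp_all add: poly_var poly_const poly_add poly_mult)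

lemma named_env: "(\<lambda>i. scons a e (if i = x then 0 else Suc i)) = e(x := a)"
  by auto

lemma D0_sat: "bounded_fm \<phi> \<Longrightarrow> range V \<subseteq> S \<Longrightarrow> D0 (\<lambda>e. sat M V e \<phi>)"
proof (induction \<phi>)
  case (FEq s t) show ?case by (simp add: D0p_eq poly_tm_val)
next
  case (FLt s t) show ?case by (simp add: D0p_lt poly_tm_val)
next
  case (FMem t i)
  then have "V i \<in> S" by blast
  then show ?case by (simp add: D0p_mem poly_tm_val)
next
  case (FNeg \<phi>) then show ?case by (simp add: D0_not)
next
  case (FAnd \<phi> \<psi>) then show ?case by (simp add: D0_and)
next
  case (FBAll x t \<phi>)
  then have "D0 (\<lambda>e. sat M V e \<phi>)" by simp
  from D0p_ball'[OF poly_tm_val[of t] D0_ren[OF this, of "\<lambda>i. if i = x then 0 else Suc i"]]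
  show ?case unfolding named_env by simp
qed simp_all

text \<open>Negating the matrix at every level gives one hierarchy instead of two: Pi_k predicates
  are the negations of the Sigma_k ones, and level 0 is closed under negation.\<close>

primrec Sg :: "nat \<Rightarrow> ((nat \<Rightarrow> 'a) \<Rightarrow> bool) \<Rightarrow> bool" where
  "Sg 0 P = D0 P"
| "Sg (Suc k) P = (\<exists>Q. Sg k Q \<and> P = (\<lambda>e. \<exists>a. \<not> Q (scons a e)))"

lemma Sg_psubst: "Sg k P \<Longrightarrow> (\<And>i. poly (\<sigma> i)) \<Longrightarrow> Sg k (\<lambda>e. P (\<lambda>i. \<sigma> i e))"
proof (induction k arbitrary: P \<sigma>)
  case 0 then show ?case by (simp add: D0_psubst)
next
  case (Suc k)
  then obtain Q where Q: "Sg k Q" "P = (\<lambda>e. \<exists>a. \<not> Q (scons a e))" by auto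
  have "Sg k (\<lambda>e. Q (\<lambda>i. lift \<sigma> i e))"
    using Suc.IH[OF Q(1), of "lift \<sigma>"] Suc.prems(2) by (simp add: poly_lift)
  then show ?case by (auto simp: Q lift_scons intro!: exI[of _ "\<lambda>e. Q (\<lambda>i. lift \<sigma> i e)"])
qed

lemma Sg_ren: "Sg k P \<Longrightarrow> Sg k (\<lambda>e. P (\<lambda>i. e (r i)))"
  using Sg_psubst[of k P "\<lambda>i e. e (r i)"] by (simp add: poly_var)

lemma Sg_sat:
  "range V \<subseteq> S \<Longrightarrow> Sigma_fm k \<phi> \<Longrightarrow> Sg k (\<lambda>e. sat M V e \<phi>)"
  "range V \<subseteq> S \<Longrightarrow> Pi_fm k \<phi> \<Longrightarrow> Sg k (\<lambda>e. \<not> sat M V e \<phi>)"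
proof (induction k arbitrary: \<phi>)
  case 0
  { case 1 then show ?case by (simp add: D0_sat) next
    case 2 then show ?case by (simp add: D0_sat D0_not) }
next
  case (Suc k)
  {
    case 1
    then obtain x \<psi> where \<phi>: "\<phi> = FEx x \<psi>" "Pi_fm k \<psi>" by auto
    note q = Sg_ren[OF Suc(2)[OF 1(1) this(2)], of "\<lambda>i. if i = x then 0 else Suc i"]
    show ?case unfolding \<phi> Sg.simps sat.simps
      by (rule exI, rule conjI, rule q) (simp add: fun_eq_iff named_env)
  next
    case 2
    then obtain x \<psi> where \<phi>: "\<phi> = FAll x \<psi>" "Sigma_fm k \<psi>" by auto
    note q = Sg_ren[OF Suc(1)[OF 2(1) this(2)], of "\<lambda>i. if i = x then 0 else Suc i"]
    show ?case unfolding \<phi> Sg.simps sat.simps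
      by (rule exI, rule conjI, rule q) (simp add: fun_eq_iff named_env)
  }
qed

section \<open>From predicates back to formulas\<close>

definition syn :: "(fm \<Rightarrow> bool) \<Rightarrow> ((nat \<Rightarrow> 'a) \<Rightarrow> bool) \<Rightarrow> bool" where
  "syn \<Phi> P \<longleftrightarrow> (\<exists>\<phi> V p. \<Phi> \<phi> \<and> range V \<subseteq> S \<and> (\<forall>e. P e \<longleftrightarrow> sat M V (mix e p) \<phi>))"

lemma poly_syn: "poly F \<Longrightarrow> \<exists>t p. \<forall>e. F e = tm_val M (mix e p) t"
proof (induction rule: poly.induct)
  case (poly_var i)
  show ?case by (rule exI[of _ "NVar (2 * i)"]) simp
next
  case (poly_const c)
  show ?case by (rule exI[of _ "NVar (Suc (2 * 0))"], rule exI[of _ "\<lambda>_. c"]) (simp add: mix_def)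
next
  case (poly_add F G)
  then obtain t p s q where *: "\<forall>e. F e = tm_val M (mix e p) t" "\<forall>e. G e = tm_val M (mix e q) s" by blast
  show ?case
    by (rule exI[of _ "TAdd (ren_tm (split_ren (\<lambda>i. 2 * i)) t) (ren_tm (split_ren (\<lambda>i. Suc (2 * i))) s)"],
        rule exI[of _ "mix p q"]) (simp add: * tm_val_ren mix_split_ren)
next
  case (poly_mult F G)
  then obtain t p s q where *: "\<forall>e. F e = tm_val M (mix e p) t" "\<forall>e. G e = tm_val M (mix e q) s" by blast
  show ?case
    by (rule exI[of _ "TMul (ren_tm (split_ren (\<lambda>i. 2 * i)) t) (ren_tm (split_ren (\<lambda>i. Suc (2 * i))) s)"],
        rule exI[of _ "mix p q"]) (simp add: * tm_val_ren mix_split_ren)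
qed

lemma poly_syn2:
  assumes "poly F" "poly G"
  shows "\<exists>t s p. \<forall>e. F e = tm_val M (mix e p) t \<and> G e = tm_val M (mix e p) s"
proof -
  obtain t p s q where *: "\<forall>e. F e = tm_val M (mix e p) t" "\<forall>e. G e = tm_val M (mix e q) s"
    using poly_syn assms by meson
  show ?thesis
    by (rule exI[of _ "ren_tm (split_ren (\<lambda>i. 2 * i)) t"], rule exI[of _ "ren_tm (split_ren (\<lambda>i. Suc (2 * i))) s"],
        rule exI[of _ "mix p q"]) (simp add: * tm_val_ren mix_split_ren)
qed

lemma range_mix: "range V \<subseteq> S \<Longrightarrow> range W \<subseteq> S \<Longrightarrow> range (mix V W) \<subseteq> S"
  by (auto simp: mix_def)

lemma inj_double: "inj (split_ren (\<lambda>i. 2 * i))" "inj (split_ren (\<lambda>i. Suc (2 * i)))"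
  by (rule inj_split_ren, simp add: inj_def)+

lemma D0_syn: "D0 P \<Longrightarrow> syn bounded_fm P"
proof (induction rule: D0.induct)
  case (D0p_eq F G)
  obtain A where A: "A \<in> S" using sets_nonempty by auto
  obtain t s p where "\<forall>e. F e = tm_val M (mix e p) t \<and> G e = tm_val M (mix e p) s"
    using poly_syn2[OF D0p_eq] by (elim exE)
  then show ?case unfolding syn_def using A
    by (intro exI[of _ "FEq t s"] exI[of _ "\<lambda>_. A"] exI[of _ p]) auto
next
  case (D0p_lt F G)
  obtain A where A: "A \<in> S" using sets_nonempty by auto
  obtain t s p where "\<forall>e. F e = tm_val M (mix e p) t \<and> G e = tm_val M (mix e p) s"
    using poly_syn2[OF D0p_lt] by (elim exE)
  then show ?case unfolding syn_def using A
    by (intro exI[of _ "FLt t s"] exI[of _ "\<lambda>_. A"] exI[of _ p]) auto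
next
  case (D0p_mem F A)
  obtain t p where "\<forall>e. F e = tm_val M (mix e p) t"
    using poly_syn[OF D0p_mem(1)] by (elim exE)
  then show ?case unfolding syn_def using D0p_mem
    by (intro exI[of _ "FMem t 0"] exI[of _ "\<lambda>_. A"] exI[of _ p]) auto
next
  case (D0_not P)
  then obtain \<phi> V p where "bounded_fm \<phi>" "range V \<subseteq> S" "\<forall>e. P e \<longleftrightarrow> sat M V (mix e p) \<phi>"
    unfolding syn_def by (elim exE conjE)
  then show ?case unfolding syn_def
    by (intro exI[of _ "FNeg \<phi>"] exI[of _ V] exI[of _ p]) auto
next
  case (D0_and P Q)
  obtain \<phi> V p where 1: "bounded_fm \<phi>" "range V \<subseteq> S" "\<forall>e. P e \<longleftrightarrow> sat M V (mix e p) \<phi>"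
    using D0_and.IH(1) unfolding syn_def by (elim exE conjE)
  obtain \<psi> W q where 2: "bounded_fm \<psi>" "range W \<subseteq> S" "\<forall>e. Q e \<longleftrightarrow> sat M W (mix e q) \<psi>"
    using D0_and.IH(2) unfolding syn_def by (elim exE conjE)
  show ?case unfolding syn_def
    by (rule exI[of _ "FAnd (ren_fm (split_ren (\<lambda>i. 2 * i)) (\<lambda>i. 2 * i) \<phi>)
                            (ren_fm (split_ren (\<lambda>i. Suc (2 * i))) (\<lambda>i. Suc (2 * i)) \<psi>)"],
        rule exI[of _ "mix V W"], rule exI[of _ "mix p q"])
      (simp add: 1 2 range_mix sat_ren[OF inj_double(1)] sat_ren[OF inj_double(2)] mix_split_ren)
next
  case (D0p_ball' F P)
  obtain \<phi> V p where 1: "bounded_fm \<phi>" "range V \<subseteq> S" "\<forall>e. P e \<longleftrightarrow> sat M V (mix e p) \<phi>"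
    using D0p_ball'.IH unfolding syn_def by (elim exE conjE)
  obtain t q where 2: "\<forall>e. F e = tm_val M (mix e q) t"
    using poly_syn[OF D0p_ball'(1)] by (elim exE)
  \<comment> \<open>Slot 0 of the new list belongs to the bound variable 1, and its value
    \<open>\<zero>\<close> is a dummy. Hence the entries of \<open>q\<close>, at the odd places of
    \<open>mix p q\<close>, sit at the places \<open>2 i + 2\<close>.\<close>
  let ?p = "scons \<zero> (mix p q)"
  let ?t = "ren_tm (split_ren (\<lambda>i. Suc (Suc (2 * i)))) t"
  let ?f = "ren_fm shift_ren id (ren_fm (split_ren (\<lambda>i. 2 * i)) id \<phi>)"
  have t: "tm_val M (mix e (scons a (mix p q))) (ren_tm (split_ren (\<lambda>i. Suc (Suc (2 * i)))) t) = F e"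
    for e a by (simp add: tm_val_ren mix_split_ren 2)
  have "sat M V ((mix e (scons \<zero> (mix p q)))(Suc 0 := a)) ?f = P (scons a e)" for e a
    by (simp add: sat_ren[OF inj_shift_ren] sat_ren[OF inj_double(1)] mix_shift_ren mix_split_ren 1
          del: fun_upd_apply)
  then show ?case unfolding syn_def using 1 t
    by (intro exI[of _ "FBAll (Suc 0) ?t ?f"] exI[of _ V] exI[of _ ?p]) simp
qed

lemma Sg_syn: "Sg k P \<Longrightarrow> syn (Sigma_fm k) P" "Sg k P \<Longrightarrow> syn (Pi_fm k) (\<lambda>e. \<not> P e)"
proof (induction k arbitrary: P)
  case 0
  { case 1 then show ?case using D0_syn[of P] by (simp add: syn_def) next
    case 2 then show ?case using D0_syn[OF D0_not, of P] by (simp add: syn_def) }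
next
  case (Suc k)
  {
    case 1
    then obtain Q where Q: "Sg k Q" "P = (\<lambda>e. \<exists>a. \<not> Q (scons a e))" by auto
    then obtain \<phi> V p where \<phi>: "Pi_fm k \<phi>" "range V \<subseteq> S" "\<And>e. (\<not> Q e) = sat M V (mix e p) \<phi>"
      using Suc(2)[OF Q(1)] unfolding syn_def by (elim exE conjE) simp
    have "P e = sat M V (mix e (scons \<zero> p)) (FEx 1 (ren_fm shift_ren id \<phi>))" for e
      by (simp add: Q sat_ren[OF inj_shift_ren] mix_shift_ren \<phi> del: fun_upd_apply)
    then show ?case unfolding syn_def
      using Sigma_Pi_ren(2)[OF \<phi>(1), of shift_ren id] \<phi>(2)
      by (intro exI[of _ "FEx 1 (ren_fm shift_ren id \<phi>)"] exI[of _ V] exI[of _ "scons \<zero> p"]) auto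
  next
    case 2
    then obtain Q where Q: "Sg k Q" "P = (\<lambda>e. \<exists>a. \<not> Q (scons a e))" by auto
    then obtain \<phi> V p where \<phi>: "Sigma_fm k \<phi>" "range V \<subseteq> S" "\<And>e. Q e = sat M V (mix e p) \<phi>"
      using Suc(1)[OF Q(1)] unfolding syn_def by (elim exE conjE) simp
    have "(\<not> P e) = sat M V (mix e (scons \<zero> p)) (FAll 1 (ren_fm shift_ren id \<phi>))" for e
      by (simp add: Q sat_ren[OF inj_shift_ren] mix_shift_ren \<phi> del: fun_upd_apply)
    then show ?case unfolding syn_def
      using Sigma_Pi_ren(1)[OF \<phi>(1), of shift_ren id] \<phi>(2)
      by (intro exI[of _ "FAll 1 (ren_fm shift_ren id \<phi>)"] exI[of _ V] exI[of _ "scons \<zero> p"]) auto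
  }
qed

lemma syn_definable1:
  assumes "syn \<Phi> (\<lambda>e. e 0 \<in> A)"
  shows "definable1 M \<Phi> A"
proof -
  obtain \<phi> V p where \<phi>: "\<Phi> \<phi>" "range V \<subseteq> S" "\<And>e. (e 0 \<in> A) = sat M V (mix e p) \<phi>"
    using assms unfolding syn_def by (elim exE conjE) simp
  have "(mix (\<lambda>_. \<zero>) p)(0 := a) = mix ((\<lambda>_. \<zero>)(0 := a)) p" for a
    by (auto simp: mix_def fun_eq_iff elim!: evenE)
  then have "a \<in> A \<longleftrightarrow> sat M V ((mix (\<lambda>_. \<zero>) p)(0 := a)) \<phi>" for a
    using \<phi>(3)[of "(\<lambda>_. \<zero>)(0 := a)"] by simp
  then show ?thesis unfolding definable1_def using \<phi>(1,2) by blast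
qed

lemma syn_definable2:
  assumes "syn \<Phi> (\<lambda>e. (e 0, e (Suc 0)) \<in> R)" "\<And>\<phi> r q. \<Phi> \<phi> \<Longrightarrow> \<Phi> (ren_fm r q \<phi>)"
  shows "definable2 M \<Phi> R"
proof -
  obtain \<phi> V p where \<phi>: "\<Phi> \<phi>" "range V \<subseteq> S" "\<And>e. ((e 0, e 1) \<in> R) = sat M V (mix e p) \<phi>"
    using assms(1) unfolding syn_def by (elim exE conjE) simp
  \<comment> \<open>The two arguments are variables 0 and 1 in \<open>definable2\<close>, but
    entries 0 and 1 of an environment are variables 0 and 2 under \<open>mix\<close>;
    \<open>r\<close> exchanges 1 and 2.\<close>
  define r :: "nat \<Rightarrow> nat" where "r i = (if i = 1 then 2 else if i = 2 then 1 else i)" for i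
  have r: "inj r" by (auto simp: inj_def r_def split: if_splits)
  define E where "E = (\<lambda>i. mix (\<lambda>_. \<zero>) p (r i))"
  have "(a, b) \<in> R \<longleftrightarrow> sat M V (E(0 := a, 1 := b)) (ren_fm r id \<phi>)" for a b
  proof -
    have "(\<lambda>i. (E(0 := a, 1 := b)) (r i)) = mix ((\<lambda>_. \<zero>)(0 := a, 1 := b)) p"
      by (auto simp: fun_eq_iff E_def r_def mix_def elim!: evenE)
    then have "sat M V (E(0 := a, 1 := b)) (ren_fm r id \<phi>) = sat M V (mix ((\<lambda>_. \<zero>)(0 := a, 1 := b)) p) \<phi>"
      by (simp only: sat_ren[OF r] id_apply)
    then show ?thesis using \<phi>(3)[of "(\<lambda>_. \<zero>)(0 := a, 1 := b)"] by simp
  qed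
  then have "R = {(a, b). sat M V (E(0 := a, 1 := b)) (ren_fm r id \<phi>)}" by auto
  then show ?thesis unfolding definable2_def using \<phi>(1,2) assms(2) by blast
qed

text \<open>The bridge between formulas and predicates: induction and comprehension of the model are
  applied through it, and all closure properties are proved for \<open>Sg\<close>.\<close>

lemma definable1_Sg:
  "definable1 M (Sigma_fm k) A \<longleftrightarrow> Sg k (\<lambda>e. e 0 \<in> A)"
  "Sg k (\<lambda>e. e 0 \<notin> A) \<Longrightarrow> definable1 M (Pi_fm k) A"
proof -
  show "definable1 M (Sigma_fm k) A \<longleftrightarrow> Sg k (\<lambda>e. e 0 \<in> A)"
  proof
    assume "definable1 M (Sigma_fm k) A"
    then obtain \<phi> V e where *: "Sigma_fm k \<phi>" "range V \<subseteq> S" "A = {a. sat M V (e(0 := a)) \<phi>}"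
      unfolding definable1_def by (elim exE conjE)
    have "Sg k (\<lambda>e'. sat M V (\<lambda>i. (if i = 0 then (\<lambda>e'. e' 0) else (\<lambda>_. e i)) e') \<phi>)"
      using Sg_psubst[OF Sg_sat(1)[OF *(2,1)], of "\<lambda>i. if i = 0 then (\<lambda>e'. e' 0) else (\<lambda>_. e i)"]
      by (simp add: poly_var poly_const)
    moreover have "(\<lambda>i. (if i = 0 then (\<lambda>e'. e' 0) else (\<lambda>_. e i)) e') = e(0 := e' 0)" for e' :: "nat \<Rightarrow> 'a"
      by auto
    ultimately show "Sg k (\<lambda>e. e 0 \<in> A)" by (simp add: *)
  qed (rule syn_definable1, rule Sg_syn)
  show "definable1 M (Pi_fm k) A" if "Sg k (\<lambda>e. e 0 \<notin> A)"
    using Sg_syn(2)[OF that] by (intro syn_definable1) simp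
qed

lemma definable2_Sg:
  "definable2 M (Sigma_fm k) R \<longleftrightarrow> Sg k (\<lambda>e. (e 0, e (Suc 0)) \<in> R)"
  "Sg k (\<lambda>e. (e 0, e (Suc 0)) \<notin> R) \<Longrightarrow> definable2 M (Pi_fm k) R"
proof -
  show "definable2 M (Sigma_fm k) R \<longleftrightarrow> Sg k (\<lambda>e. (e 0, e (Suc 0)) \<in> R)"
  proof
    assume "definable2 M (Sigma_fm k) R"
    then obtain \<phi> V e where *: "Sigma_fm k \<phi>" "range V \<subseteq> S" "R = {(a, b). sat M V (e(0 := a, 1 := b)) \<phi>}"
      unfolding definable2_def by (elim exE conjE)
    let ?s = "\<lambda>i. if i = 0 then (\<lambda>e'. e' 0) else if i = 1 then (\<lambda>e'. e' 1) else (\<lambda>_. e i)"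
    have "Sg k (\<lambda>e'. sat M V (\<lambda>i. ?s i e') \<phi>)"
      using Sg_psubst[OF Sg_sat(1)[OF *(2,1)], of ?s] by (simp add: poly_var poly_const)
    moreover have "(\<lambda>i. ?s i e') = e(0 := e' 0, 1 := e' 1)" for e' :: "nat \<Rightarrow> 'a"
      by auto
    ultimately show "Sg k (\<lambda>e. (e 0, e (Suc 0)) \<in> R)" by (simp add: *)
  qed (rule syn_definable2, rule Sg_syn, assumption, rule Sigma_Pi_ren)
  show "definable2 M (Pi_fm k) R" if "Sg k (\<lambda>e. (e 0, e (Suc 0)) \<notin> R)"
    using Sg_syn(2)[OF that] by (intro syn_definable2 Sigma_Pi_ren) simp_all
qed

lemma Sg_D0_Suc: "D0 P \<Longrightarrow> Sg (Suc 0) P"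
  using D0_ren[OF D0_not, of P Suc] by (auto intro!: exI[of _ "\<lambda>e. \<not> P (\<lambda>i. e (Suc i))"])

text \<open>Stating the body as \<open>Q a e\<close> lets goals match as they are written: after the
  rule is applied, beta reduction shifts the other entries by one.\<close>

lemma pD0_ball:
  "poly F \<Longrightarrow> D0 (\<lambda>e. Q (e 0) (\<lambda>i. e (Suc i))) \<Longrightarrow> D0 (\<lambda>e. \<forall>a. a \<prec> F e \<longrightarrow> Q a e)"
  using D0p_ball'[of F "\<lambda>e. Q (e 0) (\<lambda>i. e (Suc i))"] by simp

lemma D0_imp: "D0 P \<Longrightarrow> D0 Q \<Longrightarrow> D0 (\<lambda>e. P e \<longrightarrow> Q e)"
  using D0_not[OF D0_and[OF _ D0_not]] by simp

lemma D0_or: "D0 P \<Longrightarrow> D0 Q \<Longrightarrow> D0 (\<lambda>e. P e \<or> Q e)"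
  using D0_imp[OF D0_not, of P Q] by (simp add: imp_conv_disj)

lemma D0_iff: "D0 P \<Longrightarrow> D0 Q \<Longrightarrow> D0 (\<lambda>e. P e \<longleftrightarrow> Q e)"
  using D0_and[OF D0_imp[of P Q] D0_imp[of Q P]] by (simp add: iff_conv_conj_imp)

lemma pD0_bex:
  "poly F \<Longrightarrow> D0 (\<lambda>e. Q (e 0) (\<lambda>i. e (Suc i))) \<Longrightarrow> D0 (\<lambda>e. \<exists>a. a \<prec> F e \<and> Q a e)"
  using D0_not[OF pD0_ball[OF _ D0_not, of F Q]] by simp

end

section \<open>Arithmetic in a model\<close>

locale rca0 = l2 +
  assumes RCA0: "RCA0 M"
begin

lemmas p_rules = D0p_eq D0p_lt D0p_mem D0_not D0_imp D0_or D0_and D0_iff pD0_ball pD0_bex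
  poly_var poly_const poly_add poly_mult

lemma add_one_neq [simp]: "n \<oplus> \<one> \<noteq> \<zero>"
  and add_one_inj [simp]: "m \<oplus> \<one> = n \<oplus> \<one> \<longleftrightarrow> m = n"
  and add_zero [simp]: "m \<oplus> \<zero> = m"
  and add_Suc: "m \<oplus> (n \<oplus> \<one>) = (m \<oplus> n) \<oplus> \<one>"
  and mult_zero [simp]: "m \<otimes> \<zero> = \<zero>"
  and mult_Suc: "m \<otimes> (n \<oplus> \<one>) = (m \<otimes> n) \<oplus> m"
  and not_lt_zero [simp]: "\<not> m \<prec> \<zero>"
  and lt_Suc: "m \<prec> n \<oplus> \<one> \<longleftrightarrow> m \<prec> n \<or> m = n"
  using RCA0 by (auto simp: RCA0_def basic_axioms_def Let_def)

lemma ISigma1: "ISigma M 1"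
  using RCA0 by (simp add: RCA0_def)

lemma ISigma_induct:
  assumes "ISigma M k" "Sg k (\<lambda>e. p (e 0))" "p \<zero>" "\<And>n. p n \<Longrightarrow> p (n \<oplus> \<one>)"
  shows "p n"
proof -
  have "Sg k (\<lambda>e. e 0 \<in> {a. p a})" using assms(2) by simp
  then have "definable1 M (Sigma_fm k) {a. p a}" by (simp only: definable1_Sg)
  then show ?thesis using assms(1,3,4) unfolding ISigma_def by blast
qed

lemma D0_induct [case_names D0 zero Suc]:
  assumes "D0 (\<lambda>e. p (e 0))" "p \<zero>" "\<And>n. p n \<Longrightarrow> p (n \<oplus> \<one>)"
  shows "p n"
  using ISigma_induct[OF ISigma1, of p n] Sg_D0_Suc[OF assms(1)] assms(2,3) by simp

section \<open>Laws of the ordered semiring, by bounded induction\<close>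

lemma add_assoc: "m \<oplus> n \<oplus> k = m \<oplus> (n \<oplus> k)"
proof (induction k rule: D0_induct)
  case D0 show ?case by (rule p_rules)+
qed (simp_all add: add_Suc)

lemma zero_add [simp]: "\<zero> \<oplus> n = n"
proof (induction n rule: D0_induct)
  case D0 show ?case by (rule p_rules)+
qed (simp_all flip: add_assoc)

lemma one_neq_zero [simp]: "\<one> \<noteq> \<zero>"
  using add_one_neq[of \<zero>] by simp

lemma Suc_add: "(m \<oplus> \<one>) \<oplus> n = (m \<oplus> n) \<oplus> \<one>"
proof (induction n rule: D0_induct)
  case D0 show ?case by (rule p_rules)+
qed (simp_all add: add_Suc)

lemma add_comm: "m \<oplus> n = n \<oplus> m"
proof (induction n rule: D0_induct)
  case D0 show ?case by (rule p_rules)+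
qed (simp_all add: add_Suc Suc_add)

lemma add_left_cancel: "a \<oplus> b = a \<oplus> c \<longleftrightarrow> b = c"
proof (induction a rule: D0_induct)
  case D0 show ?case by (rule p_rules)+
qed (simp_all add: Suc_add)

lemma add_left_comm: "b \<oplus> (a \<oplus> c) = a \<oplus> (b \<oplus> c)"
  by (metis add_assoc add_comm)

lemma zero_mult [simp]: "\<zero> \<otimes> n = \<zero>"
proof (induction n rule: D0_induct)
  case D0 show ?case by (rule p_rules)+
qed (simp_all add: mult_Suc)

lemma mult_Suc_left: "(m \<oplus> \<one>) \<otimes> n = m \<otimes> n \<oplus> n"
proof (induction n rule: D0_induct)
  case D0 show ?case by (rule p_rules)+
next
  case (Suc n) then show ?case by (simp add: mult_Suc add_assoc add_comm[of m] add_left_comm add_Suc flip: add_Suc)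
qed simp

lemma mult_comm: "m \<otimes> n = n \<otimes> m"
proof (induction n rule: D0_induct)
  case D0 show ?case by (rule p_rules)+
qed (simp_all add: mult_Suc mult_Suc_left)

lemma distrib_left: "a \<otimes> (b \<oplus> c) = a \<otimes> b \<oplus> a \<otimes> c"
proof (induction a rule: D0_induct)
  case D0 show ?case by (rule p_rules)+
qed (simp_all add: mult_Suc_left add_assoc add_comm add_left_comm)

lemma mult_assoc: "a \<otimes> b \<otimes> c = a \<otimes> (b \<otimes> c)"
proof (induction c rule: D0_induct)
  case D0 show ?case by (rule p_rules)+
next
  case (Suc c)
  have "x \<otimes> \<one> = x" for x using mult_Suc[of x \<zero>] by simp
  then show ?case by (simp add: Suc distrib_left)
qed simp

lemma mult_one: "\<one> \<otimes> a = a"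
  using mult_Suc_left[of \<zero> a] by simp

lemma lt_trans: "b \<prec> c \<Longrightarrow> a \<prec> b \<Longrightarrow> a \<prec> c"
proof (induction c rule: D0_induct)
  case D0 show ?case by (rule p_rules)+
qed (auto simp: lt_Suc)

lemma lt_irrefl [simp]: "\<not> a \<prec> a"
proof (induction a rule: D0_induct)
  case D0 show ?case by (rule p_rules)+
next
  case (Suc n)
  have "n \<prec> n \<oplus> \<one>" by (simp add: lt_Suc)
  then show ?case using Suc lt_trans[of "n \<oplus> \<one>" n n] by (metis lt_Suc)
qed simp

lemma zero_le: "\<zero> \<prec> a \<or> a = \<zero>"
proof (induction a rule: D0_induct)
  case D0 show ?case by (rule p_rules)+
qed (auto simp: lt_Suc)

lemma Suc_lt: "a \<prec> b \<Longrightarrow> a \<oplus> \<one> \<prec> b \<oplus> \<one>"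
proof (induction b rule: D0_induct)
  case D0 show ?case by (rule p_rules)+
qed (auto simp: lt_Suc)

lemma lt_linear: "a \<prec> b \<or> a = b \<or> b \<prec> a"
proof (induction a rule: D0_induct)
  case D0 show ?case by (rule p_rules)+
next
  case zero show ?case using zero_le by auto
next
  case (Suc a)
  show ?case
  proof (cases "a \<prec> b")
    case True then show ?thesis using Suc_lt[OF True] by (auto simp: lt_Suc)
  qed (use Suc in \<open>auto simp: lt_Suc\<close>)
qed

definition le (infix "\<preceq>" 50) where "a \<preceq> b \<longleftrightarrow> a \<prec> b \<or> a = b"

text \<open>The bound on \<open>d\<close> keeps the claim within \<open>D0\<close>, so that
  induction for bounded predicates applies.\<close>

lemma le_exists: "a \<prec> b \<or> a = b \<Longrightarrow> \<exists>d. d \<prec> b \<oplus> \<one> \<and> a \<oplus> d = b"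
proof (induction b rule: D0_induct)
  case D0 show ?case by (rule p_rules)+
next
  case zero then show ?case using zero_le[of "\<zero> \<oplus> \<one>"] by (intro exI[of _ \<zero>]) auto
next
  case (Suc b)
  then consider "a \<prec> b \<or> a = b" | "a = b \<oplus> \<one>" by (auto simp: lt_Suc)
  then show ?case
  proof cases
    case 1
    then obtain d where "d \<prec> b \<oplus> \<one>" "a \<oplus> d = b" using Suc by blast
    then show ?thesis by (intro exI[of _ "d \<oplus> \<one>"]) (auto simp: Suc_lt add_Suc)
  next
    case 2 then show ?thesis using zero_le[of "b \<oplus> \<one> \<oplus> \<one>"] by (intro exI[of _ \<zero>]) (simp del: add_zero, simp)
  qed
qed

lemma lt_add_mono: "a \<prec> b \<Longrightarrow> c \<oplus> a \<prec> c \<oplus> b"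
proof (induction c rule: D0_induct)
  case D0 show ?case by (rule p_rules)+
qed (auto simp: Suc_add Suc_lt)

lemma le_add: "a \<prec> a \<oplus> d \<or> d = \<zero>"
  using lt_add_mono[of \<zero> d a] zero_le[of d] by auto

lemma le_iff_add: "a \<preceq> b \<longleftrightarrow> (\<exists>d. b = a \<oplus> d)"
proof
  show "a \<preceq> b \<Longrightarrow> \<exists>d. b = a \<oplus> d" using le_exists[of a b] by (auto simp: le_def)
  show "\<exists>d. b = a \<oplus> d \<Longrightarrow> a \<preceq> b" using le_add[of a] unfolding le_def by (metis add_zero)
qed

lemma Suc_exists: "\<zero> \<prec> c \<Longrightarrow> \<exists>c'. c = c' \<oplus> \<one>"
  using Suc_lt[of \<zero> c] le_iff_add[of "\<zero> \<oplus> \<one>" c] by (auto simp: lt_Suc le_def add_comm)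

lemma mult_eq_zero:
  assumes "a \<noteq> \<zero>" "b \<noteq> \<zero>" shows "a \<otimes> b \<noteq> \<zero>"
proof -
  obtain a' b' where "a = a' \<oplus> \<one>" "b = b' \<oplus> \<one>" using Suc_exists zero_le assms by meson
  then have "a \<otimes> b = (a' \<otimes> b \<oplus> b') \<oplus> \<one>" by (simp add: mult_Suc_left add_assoc)
  then show ?thesis by simp
qed

lemma lt_mult_mono:
  assumes "a \<prec> b" "\<zero> \<prec> c" shows "c \<otimes> a \<prec> c \<otimes> b"
proof -
  from assms obtain d where d: "b = a \<oplus> d" using le_iff_add[of a b] by (auto simp: le_def)
  have "d \<noteq> \<zero>" "c \<noteq> \<zero>" using assms d by auto
  then show ?thesis using le_add[of "c \<otimes> a" "c \<otimes> d"] mult_eq_zero by (auto simp: d distrib_left)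
qed

text \<open>Truncated subtraction is the minus that \<open>linordered_semidom\<close> asks for; the
  interpretation below then supplies the library facts on order and divisibility.\<close>

definition monus (infixl "\<ominus>" 65) where
  "a \<ominus> b = (if b \<preceq> a then (THE d. a = b \<oplus> d) else \<zero>)"

lemma monus_eq: "(b \<oplus> d) \<ominus> b = d"
  by (auto simp: monus_def le_iff_add add_left_cancel)

lemma monus_zero: "\<not> b \<preceq> a \<Longrightarrow> a \<ominus> b = \<zero>"
  by (simp add: monus_def)

lemma not_le: "\<not> b \<preceq> a \<longleftrightarrow> a \<prec> b"
  unfolding le_def by (metis lt_linear lt_trans lt_irrefl)

lemma le_trans: "x \<preceq> y \<Longrightarrow> y \<preceq> z \<Longrightarrow> x \<preceq> z"
  unfolding le_def using lt_trans by blast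

lemma monus_monus: "a \<ominus> b \<ominus> c = a \<ominus> (b \<oplus> c)"
proof (cases "b \<preceq> a")
  case True
  then obtain d where a: "a = b \<oplus> d" by (auto simp: le_iff_add)
  show ?thesis
  proof (cases "c \<preceq> d")
    case True
    then obtain k where "d = c \<oplus> k" by (auto simp: le_iff_add)
    then show ?thesis by (simp add: a monus_eq flip: add_assoc) (simp add: add_assoc monus_eq)
  next
    case False
    then have "\<not> b \<oplus> c \<preceq> a" by (auto simp: a le_iff_add add_assoc add_left_cancel)
    then show ?thesis using False by (simp add: a monus_eq monus_zero)
  qed
next
  case False
  then have "\<not> b \<oplus> c \<preceq> a" by (auto simp: le_iff_add add_assoc)
  moreover have "\<zero> \<ominus> c = \<zero>"
    using monus_eq[of \<zero> \<zero>] monus_zero[of c \<zero>] by (cases "c = \<zero>") (auto simp: le_def)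
  ultimately show ?thesis using False by (simp add: monus_zero)
qed

lemma mult_monus: "a \<otimes> (b \<ominus> c) = a \<otimes> b \<ominus> a \<otimes> c"
proof (cases "c \<preceq> b")
  case True
  then obtain d where "b = c \<oplus> d" by (auto simp: le_iff_add)
  then show ?thesis by (simp add: monus_eq distrib_left)
next
  case False
  show ?thesis
  proof (cases "a = \<zero>")
    case True then show ?thesis using monus_eq[of \<zero> \<zero>] by simp
  next
    case a: False
    then have "a \<otimes> b \<prec> a \<otimes> c" using lt_mult_mono[of b c a] False zero_le[of a] by (auto simp: not_le)
    then show ?thesis using False by (simp add: monus_zero not_le)
  qed
qed

lemma zero_lt_one: "\<zero> \<prec> \<one>"
  using zero_le[of \<one>] add_one_neq[of \<zero>] by auto

lemma mult_ac: "a \<otimes> b = b \<otimes> a" "(a \<otimes> b) \<otimes> c = a \<otimes> (b \<otimes> c)" "b \<otimes> (a \<otimes> c) = a \<otimes> (b \<otimes> c)"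
  using mult_comm mult_assoc by metis+

lemma add_monus: "b \<preceq> a \<Longrightarrow> b \<oplus> (a \<ominus> b) = a"
  by (auto simp: le_iff_add monus_eq)

sublocale A: linordered_semidom where plus = "plus_of M" and zero = "zero_of M" and times = "times_of M"
  and one = "one_of M" and minus = monus and less_eq = le and less = "less_of M"
proof (unfold_locales, goal_cases)
  case 1 show ?case by (rule add_assoc) next
  case 2 show ?case by (rule add_comm) next
  case 3 show ?case by (rule monus_eq) next
  case 4 show ?case by (rule monus_monus) next
  case 5 show ?case using not_le by (auto simp: le_def) next
  case 6 show ?case by (simp add: le_def) next
  case 7 then show ?case by (rule le_trans) next
  case (8 x y) then show ?case using not_le[of x y] by (auto simp: le_def) next
  case (9 a b c) then show ?case using lt_add_mono by (auto simp: le_def) next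
  case (10 x y) then show ?case using lt_linear by (auto simp: le_def)
qed (use one_neq_zero[symmetric] lt_mult_mono mult_one in \<open>auto simp: monus_eq zero_lt_one mult_ac distrib_left mult_monus
    mult_eq_zero add_comm add_monus\<close>)

lemma zero_le' [simp]: "\<zero> \<preceq> a"
  using zero_le[of a] by (auto simp: le_def)

lemma le_Suc_iff: "a \<prec> b \<oplus> \<one> \<longleftrightarrow> a \<preceq> b"
  by (simp add: lt_Suc le_def)

lemma Suc_le_iff: "a \<oplus> \<one> \<preceq> b \<longleftrightarrow> a \<prec> b"
  by (metis A.not_less le_Suc_iff)

section \<open>Simpson's pairing function\<close>

abbreviation pr where "pr x y \<equiv> pair_of M x y"

lemma pr_bounds: "x \<preceq> pr x y" "y \<preceq> pr x y" "x \<oplus> y \<preceq> pr x y"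
proof -
  have sq: "z \<preceq> z \<otimes> z" for z
  proof (cases "z = \<zero>")
    case False
    then obtain z' where z': "z = z' \<oplus> \<one>" using zero_le Suc_exists by blast
    have "z \<otimes> z = z \<oplus> z' \<otimes> z" by (subst z') (simp only: mult_Suc_left add_comm)
    then show ?thesis by (auto simp: le_iff_add)
  qed simp
  have "x \<oplus> y \<preceq> (x \<oplus> y) \<otimes> (x \<oplus> y)" by (rule sq)
  then show *: "x \<oplus> y \<preceq> pr x y" unfolding pair_of_def by (metis A.add_increasing2 zero_le')
  show "x \<preceq> pr x y" "y \<preceq> pr x y"
    using * by (metis A.order_trans le_iff_add add_comm)+
qed

lemma pr_mono: "x \<preceq> x' \<Longrightarrow> y \<preceq> y' \<Longrightarrow> pr x y \<preceq> pr x' y'"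
  unfolding pair_of_def by (intro A.add_mono A.mult_mono) simp_all

lemma sq_Suc: "(s \<oplus> \<one>) \<otimes> (s \<oplus> \<one>) = s \<otimes> s \<oplus> s \<oplus> s \<oplus> \<one>"
  by (simp add: mult_Suc mult_Suc_left add_assoc)

text \<open>A code with sum \<open>s\<close> is at least \<open>s^2\<close> and at most
  \<open>s^2 + s\<close>, hence below the square of \<open>s + 1\<close>. So codes with different
  sums are ordered like the sums.\<close>

lemma pr_lt: "x \<oplus> y \<prec> x' \<oplus> y' \<Longrightarrow> pr x y \<prec> pr x' y'"
proof -
  let ?s = "x \<oplus> y" let ?t = "x' \<oplus> y'"
  assume "?s \<prec> ?t"
  then have "?s \<oplus> \<one> \<preceq> ?t" by (simp add: Suc_le_iff)
  then have "(?s \<oplus> \<one>) \<otimes> (?s \<oplus> \<one>) \<preceq> ?t \<otimes> ?t"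
    by (intro A.mult_mono) simp_all
  moreover have "x \<preceq> ?s" by (auto simp: le_iff_add)
  then have "pr x y \<preceq> ?s \<otimes> ?s \<oplus> ?s" unfolding pair_of_def by simp
  moreover have "?s \<otimes> ?s \<oplus> ?s \<prec> (?s \<oplus> \<one>) \<otimes> (?s \<oplus> \<one>)"
  proof -
    have "(?s \<oplus> \<one>) \<otimes> (?s \<oplus> \<one>) = (?s \<otimes> ?s \<oplus> ?s \<oplus> ?s) \<oplus> \<one>"
      by (rule sq_Suc)
    moreover have "?s \<otimes> ?s \<oplus> ?s \<preceq> ?s \<otimes> ?s \<oplus> ?s \<oplus> ?s" by (auto simp: le_iff_add)
    ultimately show ?thesis by (simp add: le_Suc_iff)
  qed
  moreover have "?t \<otimes> ?t \<preceq> pr x' y'" unfolding pair_of_def by (auto simp: le_iff_add)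
  ultimately show ?thesis by (meson A.le_less_trans A.less_le_trans)
qed

lemma pr_inj [simp]: "pr x y = pr x' y' \<longleftrightarrow> x = x' \<and> y = y'"
proof
  assume eq: "pr x y = pr x' y'"
  then have s: "x \<oplus> y = x' \<oplus> y'" by (metis pr_lt A.linorder_cases lt_irrefl)
  then have "x = x'" using eq unfolding pair_of_def by (simp add: A.add_left_cancel)
  then show "x = x' \<and> y = y'" using s by (simp add: A.add_left_cancel)
qed simp

section \<open>Recursive terms and substitution\<close>

lemma p_le: "poly F \<Longrightarrow> poly G \<Longrightarrow> D0 (\<lambda>e. F e \<preceq> G e)"
  unfolding le_def by (intro D0_or D0p_lt D0p_eq)

lemma p_pr: "poly F \<Longrightarrow> poly G \<Longrightarrow> poly (\<lambda>e. pr (F e) (G e))"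
  unfolding pair_of_def by (intro poly_add poly_mult)

text \<open>The length is a standard number, the number of variables of a predicate; lists of
  nonstandard length are coded by \<open>sq\<close> instead.\<close>

primrec tup :: "nat \<Rightarrow> (nat \<Rightarrow> 'a) \<Rightarrow> 'a" where
  "tup 0 e = \<zero>"
| "tup (Suc n) e = pr (e n) (tup n e)"

lemma tup_inj: "tup n e = tup n e' \<Longrightarrow> i < n \<Longrightarrow> e i = e' i"
  by (induction n) (auto simp: less_Suc_eq)

lemma tup_cong: "(\<And>i. i < n \<Longrightarrow> e i = e' i) \<Longrightarrow> tup n e = tup n e'"
  by (induction n) auto

lemma tup_ge: "i < n \<Longrightarrow> e i \<preceq> tup n e"
proof (induction n)
  case (Suc n)
  have "tup n e \<preceq> tup (Suc n) e" by (simp add: pr_bounds)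
  then show ?case using Suc by (cases "i = n") (auto simp: pr_bounds intro: A.order_trans)
qed simp

lemma poly_tup: "(\<And>i. i < n \<Longrightarrow> poly (\<lambda>e. F i e)) \<Longrightarrow> poly (\<lambda>e. tup n (\<lambda>i. F i e))"
  by (induction n) (simp_all add: poly_const p_pr)

definition app :: "nat \<Rightarrow> (nat \<Rightarrow> 'a) \<Rightarrow> (nat \<Rightarrow> 'a) \<Rightarrow> nat \<Rightarrow> 'a" where
  "app n f e i = (if i < n then f i else e (i - n))"

lemma app_Suc: "app (Suc n) f e = scons (f 0) (app n (\<lambda>i. f (Suc i)) e)"
  by (auto simp: app_def scons_def fun_eq_iff split: nat.split)

text \<open>A block of \<open>n\<close> bounded quantifiers, written as one quantifier of the
  metatheory over \<open>f\<close>, of which only the values below \<open>n\<close> matter. Since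
  \<open>n\<close> is standard, the quantifiers can be added one at a time.\<close>

lemma D0_bounded_tuple:
  assumes "poly F"
  shows "D0 P \<Longrightarrow> D0 (\<lambda>e. \<exists>f. (\<forall>i<n. f i \<prec> F e) \<and> P (app n f e))"
proof (induction n arbitrary: P)
  case 0
  have "app 0 f e = e" for f e by (auto simp: app_def)
  then show ?case using 0 by simp
next
  case (Suc n)
  let ?G = "\<lambda>e. F (\<lambda>i. e (i + n))"
  have "poly ?G" using poly_subst[OF assms, of "\<lambda>i e. e (i + n)"] by (simp add: poly_var)
  then have "D0 (\<lambda>e. \<exists>a. a \<prec> ?G e \<and> P (scons a e))"
    using D0_not[OF D0p_ball'[OF _ D0_not[OF Suc.prems], of ?G]] by simp
  note * = Suc.IH[OF this]
  have G: "?G (app n f e) = F e" for f e by (simp add: app_def)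
  have "(\<exists>f. (\<forall>i<Suc n. f i \<prec> F e) \<and> P (app (Suc n) f e)) \<longleftrightarrow>
        (\<exists>f. (\<forall>i<n. f i \<prec> F e) \<and> (\<exists>a. a \<prec> F e \<and> P (scons a (app n f e))))" (is "?L \<longleftrightarrow> ?R") for e
  proof
    assume ?L
    then obtain f where f: "\<forall>i<Suc n. f i \<prec> F e" "P (app (Suc n) f e)" by blast
    then show ?R by (intro exI[of _ "\<lambda>i. f (Suc i)"]) (auto simp: app_Suc)
  next
    assume ?R
    then obtain f a where f: "\<forall>i<n. f i \<prec> F e" "a \<prec> F e" "P (scons a (app n f e))" by blast
    then show ?L by (intro exI[of _ "scons a f"]) (auto simp: app_Suc less_Suc_eq_0_disj)
  qed
  then show ?case using * by (simp add: G)
qed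

lemma D0_ex: "D0 (\<lambda>e. Q (e 0) (\<lambda>i. e (Suc i))) \<Longrightarrow> Sg (Suc 0) (\<lambda>e. \<exists>a. Q a e)"
  using D0_not[of "\<lambda>e. Q (e 0) (\<lambda>i. e (Suc i))"]
  by (auto intro!: exI[of _ "\<lambda>e. \<not> Q (e 0) (\<lambda>i. e (Suc i))"])

lemma Sg_supp: "Sg k P \<Longrightarrow> \<exists>n. supp n P"
proof (induction k arbitrary: P)
  case 0 then show ?case by (simp add: D0_supp)
next
  case (Suc k)
  then obtain Q where Q: "Sg k Q" "P = (\<lambda>e. \<exists>a. \<not> Q (scons a e))" by auto
  from Suc.IH[OF Q(1)] obtain m where m: "supp m Q" by blast
  have "supp m P"
    unfolding supp_def
  proof (intro allI impI)
    fix e e' :: "nat \<Rightarrow> 'a" assume "\<forall>i<m. e i = e' i"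
    then have "\<forall>i<m. scons a e i = scons a e' i" for a by (auto simp: scons_def split: nat.split)
    then have "Q (scons a e) = Q (scons a e')" for a using m by (simp add: supp_def)
    then show "P e = P e'" by (simp add: Q)
  qed
  then show ?case by blast
qed

text \<open>Tuples of variables are coded by iterated pairs, so that unary comprehension suffices.\<close>

lemma Sg1_code:
  assumes "Sg (Suc 0) P" "supp n P"
  shows "Sg (Suc 0) (\<lambda>e. \<exists>f. e 0 = tup n f \<and> P f)"
    and "Sg (Suc 0) (\<lambda>e. (\<nexists>f. e 0 = tup n f) \<or> (\<exists>f. e 0 = tup n f \<and> P f))"
proof -
  obtain Q where Q: "D0 Q" "P = (\<lambda>e. \<exists>a. \<not> Q (scons a e))" using assms(1) by auto
  let ?c = "\<lambda>f i. if i < n then f i else \<zero>"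
  have Pc: "P f = P (?c f)" for f using assms(2) by (simp add: supp_def)
  \<comment> \<open>The matrix \<open>Q\<close> expects its witness at entry 0 and the arguments
    after it; here the \<open>n\<close> components of the tuple come first and the witness is entry
    \<open>n\<close>. Entries beyond the support are set to \<open>\<zero>\<close>.\<close>
  define \<sigma> :: "nat \<Rightarrow> (nat \<Rightarrow> 'a) \<Rightarrow> 'a" where
    "\<sigma> i = (case i of 0 \<Rightarrow> (\<lambda>e. e n) | Suc j \<Rightarrow> (if j < n then (\<lambda>e. e j) else (\<lambda>e. \<zero>)))" for i
  have "D0 (\<lambda>e. Q (\<lambda>i. \<sigma> i e))"
    using D0_psubst[OF Q(1), of \<sigma>] by (simp add: \<sigma>_def poly_var poly_const split: nat.split)
  then have 1: "D0 (\<lambda>e. e (Suc n) = tup n e \<and> \<not> Q (\<lambda>i. \<sigma> i e))"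
    by (intro D0_and D0_not D0p_eq poly_var poly_tup)
  have 2: "D0 (\<lambda>e. e (Suc n) = tup n e)"
    by (intro D0p_eq poly_var poly_tup)
  have p: "poly (\<lambda>e. e (Suc 0) \<oplus> \<one>)" by (intro poly_add poly_var poly_const)
  have app: "app n f e (Suc n) = e 1" "tup n (app n f e) = tup n f"
    "(\<lambda>i. \<sigma> i (app n f e)) = scons (e 0) (?c f)" for f and e :: "nat \<Rightarrow> 'a"
    by (auto simp: app_def \<sigma>_def scons_def fun_eq_iff intro: tup_cong split: nat.split)
  have b: "(\<exists>f. (\<forall>i<n. f i \<prec> c \<oplus> \<one>) \<and> c = tup n f \<and> R f) \<longleftrightarrow> (\<exists>f. c = tup n f \<and> R f)" for c R
    using tup_ge by (auto simp: le_Suc_iff)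
  have D1: "D0 (\<lambda>e. \<exists>f. e (Suc 0) = tup n f \<and> \<not> Q (scons (e 0) (?c f)))"
    using D0_bounded_tuple[OF p 1, of n] by (simp add: app b)
  have D2: "D0 (\<lambda>e. \<exists>f. e (Suc 0) = tup n f)"
    using D0_bounded_tuple[OF p 2, of n] b[of _ "\<lambda>_. True"] by (simp add: app)
  have eq: "(\<exists>f. e 0 = tup n f \<and> P f) \<longleftrightarrow> (\<exists>a f. e 0 = tup n f \<and> \<not> Q (scons a (?c f)))" for e
    by (subst Pc) (auto simp: Q)
  show "Sg (Suc 0) (\<lambda>e. \<exists>f. e 0 = tup n f \<and> P f)"
    unfolding eq by (rule D0_ex) (rule D1)
  have eq: "((\<nexists>f. e 0 = tup n f) \<or> (\<exists>f. e 0 = tup n f \<and> P f)) \<longleftrightarrow>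
      (\<exists>a. \<not> (\<exists>f. e 0 = tup n f) \<or> (\<exists>f. e 0 = tup n f \<and> \<not> Q (scons a (?c f))))" for e
    by (subst Pc) (auto simp: Q)
  show "Sg (Suc 0) (\<lambda>e. (\<nexists>f. e 0 = tup n f) \<or> (\<exists>f. e 0 = tup n f \<and> P f))"
    unfolding eq by (rule D0_ex) (rule D0_or[OF D0_not[OF D2] D1])
qed

text \<open>The set \<open>A\<close> of codes of satisfying tuples is Delta_1, hence a set of the
  model, and \<open>P e\<close> becomes the atomic statement \<open>tup n e \<in> A\<close>.
  Unbounded quantifiers are thus traded for a set parameter.\<close>

lemma delta1_comprehension:
  assumes "Sg (Suc 0) P" "Sg (Suc 0) (\<lambda>e. \<not> P e)"
  shows "D0 P"
proof -
  obtain n where n: "supp n P" using Sg_supp assms by blast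
  then have n': "supp n (\<lambda>e. \<not> P e)" by (simp add: supp_def)
  define A where "A = {c. \<exists>f. c = tup n f \<and> P f}"
  have mem: "tup n f \<in> A \<longleftrightarrow> P f" for f
  proof
    assume "tup n f \<in> A"
    then obtain f' where "tup n f = tup n f'" "P f'" by (auto simp: A_def)
    then show "P f" using n tup_inj[of n f f'] by (auto simp: supp_def)
  qed (auto simp: A_def)
  have "(c \<notin> A) \<longleftrightarrow> (\<nexists>f. c = tup n f) \<or> (\<exists>f. c = tup n f \<and> \<not> P f)" for c
    by (cases "\<exists>f. c = tup n f") (auto simp: mem, auto simp: A_def mem[unfolded A_def])
  then have "Sg (Suc 0) (\<lambda>e. e 0 \<notin> A)"
    using Sg1_code(2)[OF assms(2) n'] by (simp del: Sg.simps)
  moreover have "Sg (Suc 0) (\<lambda>e. e 0 \<in> A)"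
    using Sg1_code(1)[OF assms(1) n] by (simp add: A_def)
  ultimately have "Delta_set M 1 A"
    unfolding Delta_set_def by (simp add: definable1_Sg)
  then have "A \<in> S" using RCA0 by (simp add: RCA0_def Delta1_CA_def)
  from D0p_mem[OF poly_tup this, of n "\<lambda>i e. e i"] show ?thesis by (simp add: poly_var mem)
qed

text \<open>In view of \<open>delta1_comprehension\<close>, these are the functions computable
  relative to sets of the model.\<close>

definition T :: "((nat \<Rightarrow> 'a) \<Rightarrow> 'a) \<Rightarrow> bool" where
  "T F \<longleftrightarrow> D0 (\<lambda>e. e 0 = F (\<lambda>i. e (Suc i)))"

lemma T_poly: "poly F \<Longrightarrow> T F"
  using poly_subst[of F "\<lambda>i e. e (Suc i)"] by (simp add: T_def D0p_eq poly_var)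

lemma T_ren: "T F \<Longrightarrow> T (\<lambda>e. F (\<lambda>i. e (r i)))"
  using D0_ren[of "\<lambda>e. e 0 = F (\<lambda>i. e (Suc i))" "\<lambda>i. case i of 0 \<Rightarrow> 0 | Suc j \<Rightarrow> Suc (r j)"]
  by (simp add: T_def)

text \<open>The value of \<open>F\<close> is unique, so \<open>Q (F e) e\<close> says that some
  number equal to \<open>F e\<close> satisfies \<open>Q\<close>, and its negation that some such
  number does not. Both are Sigma_1.\<close>

lemma D0_T1:
  assumes "D0 (\<lambda>e. Q (e 0) (\<lambda>i. e (Suc i)))" "T F"
  shows "D0 (\<lambda>e. Q (F e) e)"
proof (rule delta1_comprehension)
  have "Sg (Suc 0) (\<lambda>e. \<exists>a. a = F e \<and> Q a e)"
    using assms unfolding T_def by (intro D0_ex D0_and)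
  then show "Sg (Suc 0) (\<lambda>e. Q (F e) e)" by simp
  have "Sg (Suc 0) (\<lambda>e. \<exists>a. a = F e \<and> \<not> Q a e)"
    using assms unfolding T_def by (intro D0_ex D0_and D0_not)
  then show "Sg (Suc 0) (\<lambda>e. \<not> Q (F e) e)" by simp
qed

lemma D0_T2:
  assumes "D0 (\<lambda>e. Q (e 0) (e (Suc 0)) (\<lambda>i. e (Suc (Suc i))))" "T F" "T G"
  shows "D0 (\<lambda>e. Q (F e) (G e) e)"
proof -
  have "D0 (\<lambda>e. Q (F (\<lambda>i. e (Suc i))) (e 0) (\<lambda>i. e (Suc i)))"
    by (rule D0_T1[of "\<lambda>y e. Q y (e 0) (\<lambda>i. e (Suc i))"]) (use assms T_ren[of F Suc] in auto)
  from D0_T1[OF this assms(3)] show ?thesis by simp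
qed

lemma T_var: "T (\<lambda>e. e i)" and T_const: "T (\<lambda>e. c)"
  by (intro T_poly poly_var poly_const)+

lemma T_T2:
  assumes "T (\<lambda>e. h (e 0) (e (Suc 0)))" "T F" "T G"
  shows "T (\<lambda>e. h (F e) (G e))"
  unfolding T_def
proof (rule D0_T2[of "\<lambda>x y e. e 0 = h x y"])
  have "D0 (\<lambda>e. e 0 = h (e (Suc 0)) (e (Suc (Suc 0))))" using assms(1) by (simp add: T_def)
  from D0_ren[OF this, of "\<lambda>i. case i of 0 \<Rightarrow> 2 | Suc j \<Rightarrow> j"]
  show "D0 (\<lambda>e. e (Suc (Suc 0)) = h (e 0) (e (Suc 0)))" by (simp add: numeral_2_eq_2)
qed (use assms T_ren[of _ Suc] in auto)

lemma T_T1: "T (\<lambda>e. h (e 0)) \<Longrightarrow> T F \<Longrightarrow> T (\<lambda>e. h (F e))"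
  using T_T2[of "\<lambda>x y. h x" F F] by simp

lemma T_add: "T F \<Longrightarrow> T G \<Longrightarrow> T (\<lambda>e. F e \<oplus> G e)"
  by (rule T_T2) (intro T_poly poly_add poly_var)
lemma T_mult: "T F \<Longrightarrow> T G \<Longrightarrow> T (\<lambda>e. F e \<otimes> G e)"
  by (rule T_T2) (intro T_poly poly_mult poly_var)
lemma T_pr: "T F \<Longrightarrow> T G \<Longrightarrow> T (\<lambda>e. pr (F e) (G e))"
  by (rule T_T2) (intro T_poly p_pr poly_var)

lemma D0_eq: "T F \<Longrightarrow> T G \<Longrightarrow> D0 (\<lambda>e. F e = G e)"
  by (rule D0_T2) (rule p_rules)+
lemma D0_lt: "T F \<Longrightarrow> T G \<Longrightarrow> D0 (\<lambda>e. F e \<prec> G e)"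
  by (rule D0_T2) (rule p_rules)+
lemma D0_le: "T F \<Longrightarrow> T G \<Longrightarrow> D0 (\<lambda>e. F e \<preceq> G e)"
  by (rule D0_T2) (rule p_rules p_le)+
lemma D0_mem: "T F \<Longrightarrow> A \<in> S \<Longrightarrow> D0 (\<lambda>e. F e \<in> A)"
  by (rule D0_T1[of "\<lambda>x e. x \<in> A"]) (auto intro: D0p_mem poly_var)

lemma D0_ball:
  assumes "T F" "D0 (\<lambda>e. Q (e 0) (\<lambda>i. e (Suc i)))"
  shows "D0 (\<lambda>e. \<forall>a. a \<prec> F e \<longrightarrow> Q a e)"
proof (rule D0_T1[of "\<lambda>y e. \<forall>a. a \<prec> y \<longrightarrow> Q a e", OF _ assms(1)])
  from D0_ren[OF assms(2), of "\<lambda>i. case i of 0 \<Rightarrow> 0 | Suc j \<Rightarrow> Suc (Suc j)"]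
  show "D0 (\<lambda>e. \<forall>a. a \<prec> e 0 \<longrightarrow> Q a (\<lambda>i. e (Suc i)))"
    by (intro pD0_ball poly_var) simp
qed

lemma D0_bex: "T F \<Longrightarrow> D0 (\<lambda>e. Q (e 0) (\<lambda>i. e (Suc i))) \<Longrightarrow> D0 (\<lambda>e. \<exists>a. a \<prec> F e \<and> Q a e)"
  using D0_not[OF D0_ball[OF _ D0_not, of F Q]] by simp

lemma D0_ball_le: "T F \<Longrightarrow> D0 (\<lambda>e. Q (e 0) (\<lambda>i. e (Suc i))) \<Longrightarrow> D0 (\<lambda>e. \<forall>a. a \<preceq> F e \<longrightarrow> Q a e)"
  using D0_ball[of "\<lambda>e. F e \<oplus> \<one>" Q] by (simp add: le_Suc_iff T_add T_const)

lemma D0_bex_le: "T F \<Longrightarrow> D0 (\<lambda>e. Q (e 0) (\<lambda>i. e (Suc i))) \<Longrightarrow> D0 (\<lambda>e. \<exists>a. a \<preceq> F e \<and> Q a e)"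
  using D0_bex[of "\<lambda>e. F e \<oplus> \<one>" Q] by (simp add: le_Suc_iff T_add T_const)

lemma poly_T_subst: "poly F \<Longrightarrow> (\<And>i. T (\<sigma> i)) \<Longrightarrow> T (\<lambda>e. F (\<lambda>i. \<sigma> i e))"
proof (induction rule: poly.induct)
  case (poly_const c) show ?case by (rule T_const)
next
  case (poly_add F G) then show ?case by (intro T_add) simp_all
next
  case (poly_mult F G) then show ?case by (intro T_mult) simp_all
qed simp

lemma T_lift: "(\<And>i. T (\<sigma> i)) \<Longrightarrow> T (lift \<sigma> i)"
  using T_ren[of "\<sigma> j" Suc for j] by (simp add: lift_def T_var split: nat.split)

lemma lift_env: "(\<lambda>i. lift \<sigma> i e) = scons (e 0) (\<lambda>i. \<sigma> i (\<lambda>j. e (Suc j)))"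
  by (auto simp: fun_eq_iff lift_def scons_def split: nat.split)

lemma D0_subst: "D0 P \<Longrightarrow> (\<And>i. T (\<sigma> i)) \<Longrightarrow> D0 (\<lambda>e. P (\<lambda>i. \<sigma> i e))"
proof (induction arbitrary: \<sigma> rule: D0.induct)
  case (D0p_ball' F P)
  have "D0 (\<lambda>e. P (\<lambda>i. lift \<sigma> i e))" by (rule D0p_ball'.IH) (simp add: T_lift D0p_ball')
  then have "D0 (\<lambda>e. P (scons (e 0) (\<lambda>i. \<sigma> i (\<lambda>j. e (Suc j)))))" by (simp add: lift_env)
  from D0_ball[OF poly_T_subst[OF D0p_ball'(1), of \<sigma>] this] D0p_ball'(4)
  show ?case by simp
next
  case (D0p_eq F G) then show ?case
    using D0_eq[OF poly_T_subst[of F \<sigma>] poly_T_subst[of G \<sigma>]] by simp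
next
  case (D0p_lt F G) then show ?case
    using D0_lt[OF poly_T_subst[of F \<sigma>] poly_T_subst[of G \<sigma>]] by simp
next
  case (D0p_mem F A) then show ?case
    using D0_mem[OF poly_T_subst[of F \<sigma>]] by simp
next
  case (D0_not P) then show ?case by (intro D0.D0_not) simp
next
  case (D0_and P Q) then show ?case by (intro D0.D0_and) simp_all
qed

lemma Sg_subst: "Sg k P \<Longrightarrow> (\<And>i. T (\<sigma> i)) \<Longrightarrow> Sg k (\<lambda>e. P (\<lambda>i. \<sigma> i e))"
proof (induction k arbitrary: P \<sigma>)
  case 0 then show ?case by (simp add: D0_subst)
next
  case (Suc k)
  then obtain Q where Q: "Sg k Q" "P = (\<lambda>e. \<exists>a. \<not> Q (scons a e))" by auto
  have "Sg k (\<lambda>e. Q (\<lambda>i. lift \<sigma> i e))"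
    using Suc.IH[OF Q(1), of "lift \<sigma>"] Suc.prems(2) by (simp add: T_lift)
  then show ?case by (auto simp: Q lift_scons intro!: exI[of _ "\<lambda>e. Q (\<lambda>i. lift \<sigma> i e)"])
qed

lemma Sg_rel1: "Sg k (\<lambda>e. R (e 0)) \<Longrightarrow> T F \<Longrightarrow> Sg k (\<lambda>e. R (F e))"
  using Sg_subst[of k "\<lambda>e. R (e 0)" "\<lambda>i. F"] by simp

lemma Sg_rel2:
  "Sg k (\<lambda>e. R (e 0) (e (Suc 0))) \<Longrightarrow> T F \<Longrightarrow> T G \<Longrightarrow> Sg k (\<lambda>e. R (F e) (G e))"
  using Sg_subst[of k "\<lambda>e. R (e 0) (e (Suc 0))" "\<lambda>i. if i = 0 then F else G"] by simp

lemma Sg_rel3: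
  "Sg k (\<lambda>e. R (e 0) (e (Suc 0)) (e (Suc (Suc 0)))) \<Longrightarrow> T F \<Longrightarrow> T G \<Longrightarrow> T H \<Longrightarrow> Sg k (\<lambda>e. R (F e) (G e) (H e))"
  using Sg_subst[of k "\<lambda>e. R (e 0) (e (Suc 0)) (e (Suc (Suc 0)))"
      "\<lambda>i. if i = 0 then F else if i = Suc 0 then G else H"] by simp

definition fs :: "'a \<Rightarrow> 'a" where
  "fs c = (if \<exists>x y. c = pr x y then (THE x. \<exists>y. c = pr x y) else \<zero>)"
definition sn :: "'a \<Rightarrow> 'a" where
  "sn c = (if \<exists>x y. c = pr x y then (THE y. \<exists>x. c = pr x y) else \<zero>)"

lemma fs_pr [simp]: "fs (pr x y) = x" and sn_pr [simp]: "sn (pr x y) = y"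
  by (auto simp: fs_def sn_def)

lemma fs_sn_0: "\<nexists>x y. c = pr x y \<Longrightarrow> fs c = \<zero>" "\<nexists>x y. c = pr x y \<Longrightarrow> sn c = \<zero>"
  by (auto simp: fs_def sn_def)

lemma sn_le: "sn c \<preceq> c"
  by (cases "\<exists>x y. c = pr x y"; force simp: fs_sn_0 pr_bounds)

lemma pr_cases:
  assumes "\<And>x y. c = pr x y \<Longrightarrow> thesis" "(\<And>x y. c \<noteq> pr x y) \<Longrightarrow> thesis"
  shows thesis
  using assms by blast

lemma T_fs': "T (\<lambda>e. fs (e 0))" and T_sn': "T (\<lambda>e. sn (e 0))"
proof -
  have 0: "D0 (\<lambda>e. \<exists>x. x \<preceq> e (Suc 0) \<and> (\<exists>y. y \<preceq> e (Suc 0) \<and> e (Suc 0) = pr x y))"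
    by (rule D0_bex_le D0_eq T_pr T_var)+
  have 1: "D0 (\<lambda>e. \<exists>y. y \<preceq> e (Suc 0) \<and> e (Suc 0) = pr (e 0) y)"
    by (rule D0_bex_le D0_eq T_pr T_var)+
  have 2: "D0 (\<lambda>e. \<exists>x. x \<preceq> e (Suc 0) \<and> e (Suc 0) = pr x (e 0))"
    by (rule D0_bex_le D0_eq T_pr T_var)+
  have z: "D0 (\<lambda>e. e 0 = \<zero>)" by (rule D0_eq T_var T_const)+
  have "D0 (\<lambda>e. (\<exists>y. y \<preceq> e (Suc 0) \<and> e (Suc 0) = pr (e 0) y) \<or>
      (\<not> (\<exists>x. x \<preceq> e (Suc 0) \<and> (\<exists>y. y \<preceq> e (Suc 0) \<and> e (Suc 0) = pr x y))) \<and> e 0 = \<zero>)"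
    using 0 1 z by (intro D0_or D0_and D0_not)
  moreover have "(a = fs c) \<longleftrightarrow> (\<exists>y. y \<preceq> c \<and> c = pr a y) \<or>
      (\<not> (\<exists>x. x \<preceq> c \<and> (\<exists>y. y \<preceq> c \<and> c = pr x y))) \<and> a = \<zero>" for a c
    by (rule pr_cases[of c]) (auto simp: fs_sn_0 pr_bounds)
  ultimately show "T (\<lambda>e. fs (e 0))" by (simp add: T_def)
  have "D0 (\<lambda>e. (\<exists>x. x \<preceq> e (Suc 0) \<and> e (Suc 0) = pr x (e 0)) \<or>
      (\<not> (\<exists>x. x \<preceq> e (Suc 0) \<and> (\<exists>y. y \<preceq> e (Suc 0) \<and> e (Suc 0) = pr x y))) \<and> e 0 = \<zero>)"
    using 0 2 z by (intro D0_or D0_and D0_not)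
  moreover have "(a = sn c) \<longleftrightarrow> (\<exists>x. x \<preceq> c \<and> c = pr x a) \<or>
      (\<not> (\<exists>x. x \<preceq> c \<and> (\<exists>y. y \<preceq> c \<and> c = pr x y))) \<and> a = \<zero>" for a c
    by (rule pr_cases[of c]) (auto simp: fs_sn_0 pr_bounds)
  ultimately show "T (\<lambda>e. sn (e 0))" by (simp add: T_def)
qed

lemmas T_fs = T_T1[OF T_fs'] and T_sn = T_T1[OF T_sn']

section \<open>Codes of sequences\<close>

lemma distrib_right: "(a \<oplus> b) \<otimes> c = a \<otimes> c \<oplus> b \<otimes> c"
  by (metis distrib_left mult_comm)

lemma mult_one_right [simp]: "a \<otimes> \<one> = a"
  by (metis mult_one mult_comm)

lemmas arith = distrib_left distrib_right mult_ac add_assoc add_comm add_left_comm mult_one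

lemmas d0_rules = T_var T_const T_add T_mult T_pr T_fs T_sn
  D0_eq D0_lt D0_le D0_mem D0_not D0_ball D0_ball_le D0_bex D0_bex_le D0_imp D0_or D0_and D0_iff

lemma D0_rel1: "D0 (\<lambda>e. R (e 0)) \<Longrightarrow> T F \<Longrightarrow> D0 (\<lambda>e. R (F e))"
  using Sg_rel1[of 0 R F] by simp

lemma D0_rel2: "D0 (\<lambda>e. R (e 0) (e (Suc 0))) \<Longrightarrow> T F \<Longrightarrow> T G \<Longrightarrow> D0 (\<lambda>e. R (F e) (G e))"
  using Sg_rel2[of 0 R F G] by simp

lemma D0_rel3:
  "D0 (\<lambda>e. R (e 0) (e (Suc 0)) (e (Suc (Suc 0)))) \<Longrightarrow> T F \<Longrightarrow> T G \<Longrightarrow> T H \<Longrightarrow> D0 (\<lambda>e. R (F e) (G e) (H e))"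
  using Sg_rel3[of 0 R F G H] by simp

lemma Sigma1_induct:
  assumes "Sg (Suc 0) (\<lambda>e. p (e 0))" "p \<zero>" "\<And>n. p n \<Longrightarrow> p (n \<oplus> \<one>)"
  shows "p n"
  using ISigma_induct[OF ISigma1, of p n] assms by simp

section \<open>Coding of finite sets by divisibility\<close>

lemma common_multiple: "\<exists>b. \<zero> \<prec> b \<and> (\<forall>d. d \<preceq> N \<longrightarrow> \<zero> \<prec> d \<longrightarrow> (\<exists>q. q \<preceq> b \<and> b = d \<otimes> q))"
proof (induction N rule: Sigma1_induct)
  case 1
  show ?case
    by (rule D0_ex) (rule d0_rules)+
next
  case 2 show ?case by (rule exI[of _ \<one>]) (auto simp: zero_lt_one le_def)
next
  case (3 N)
  then obtain b where b: "\<zero> \<prec> b" "\<And>d. d \<preceq> N \<Longrightarrow> \<zero> \<prec> d \<Longrightarrow> \<exists>q. b = d \<otimes> q" by blast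
  \<comment> \<open>As for the factorial, the next factor is multiplied on. Bounding the quotients
    leaves \<open>\<exists>b\<close> as the only unbounded quantifier, as Sigma_1 induction
    requires.\<close>
  let ?b = "b \<otimes> (N \<oplus> \<one>)"
  have q: "x \<preceq> d \<otimes> x" if d: "\<zero> \<prec> d" for d x
  proof -
    obtain d' where "d = d' \<oplus> \<one>" using Suc_exists[OF d] by blast
    then have "d \<otimes> x = x \<oplus> d' \<otimes> x" by (simp add: mult_Suc_left add_comm)
    then show ?thesis by (auto simp: le_iff_add)
  qed
  have "\<exists>q. q \<preceq> ?b \<and> ?b = d \<otimes> q" if d: "d \<preceq> N \<oplus> \<one>" "\<zero> \<prec> d" for d
  proof -
    have "\<exists>q. ?b = d \<otimes> q"
    proof (cases "d = N \<oplus> \<one>")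
      case True then show ?thesis using mult_comm by blast
    next
      case False
      then have "d \<preceq> N" using d by (simp add: le_def lt_Suc)
      then show ?thesis using b(2)[of d] d mult_assoc by metis
    qed
    then obtain x where x: "?b = d \<otimes> x" by blast
    show ?thesis by (rule exI[of _ x]) (simp only: x q[OF d(2)] simp_thms)
  qed
  moreover have "\<zero> \<prec> ?b" using b(1) A.mult_pos_pos[of b "N \<oplus> \<one>"] by (simp add: le_Suc_iff)
  ultimately show ?case by blast
qed

abbreviation dvs (infix "dvdM" 50) where "dvs \<equiv> dvd.dvd (times_of M)"

text \<open>Goedel's moduli; multiplying by \<open>j \<oplus> \<one>\<close>, an inverse of \<open>-b\<close> modulo
  \<open>modu b j\<close>, replaces the use of Bezout coefficients.\<close>

definition modu :: "'a \<Rightarrow> 'a \<Rightarrow> 'a" where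
  "modu b i = \<one> \<oplus> (i \<oplus> \<one>) \<otimes> b"

text \<open>Modulo \<open>modu b j\<close> the product \<open>a \<otimes> modu b i\<close> is, up to
  sign, \<open>a \<otimes> d \<otimes> b\<close> with \<open>d\<close> the distance of
  \<open>i\<close> and \<open>j\<close>. Cancelling \<open>b\<close> leaves
  \<open>a \<otimes> d\<close>, which divides \<open>a \<otimes> b\<close>; then \<open>b\<close> is
  cancelled once more.\<close>

lemma modu_dvd_cancel:
  assumes "i \<noteq> j" "\<And>d. \<zero> \<prec> d \<Longrightarrow> i = j \<oplus> d \<or> j = i \<oplus> d \<Longrightarrow> d dvdM b"
    and "modu b j dvdM a \<otimes> modu b i"
  shows "modu b j dvdM a"
proof -
  let ?v = "modu b j"
  have cancel: "?v dvdM x" if "?v dvdM x \<otimes> b" for x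
  proof -
    have "x \<otimes> ?v = (j \<oplus> \<one>) \<otimes> (x \<otimes> b) \<oplus> x" by (simp add: modu_def arith)
    then have "?v dvdM (j \<oplus> \<one>) \<otimes> (x \<otimes> b) \<oplus> x" by (metis A.dvd_triv_right)
    then show ?thesis using that by (metis A.dvd_add_right_iff A.dvd_mult)
  qed
  obtain d where d: "\<zero> \<prec> d" "i = j \<oplus> d \<or> j = i \<oplus> d"
    using assms(1) lt_linear[of i j] le_iff_add[of i j] le_iff_add[of j i] zero_le
    by (metis add_zero le_def)
  then obtain c where c: "b = d \<otimes> c" using assms(2) by (auto elim: A.dvdE)
  have "?v dvdM (a \<otimes> d) \<otimes> b"
    using d(2)
  proof
    assume "i = j \<oplus> d"
    then have "a \<otimes> modu b i = a \<otimes> ?v \<oplus> (a \<otimes> d) \<otimes> b" by (simp add: modu_def arith)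
    then show ?thesis using assms(3) by (metis A.dvd_add_right_iff A.dvd_triv_right)
  next
    assume "j = i \<oplus> d"
    then have "a \<otimes> ?v = a \<otimes> modu b i \<oplus> (a \<otimes> d) \<otimes> b" by (simp add: modu_def arith)
    then show ?thesis using assms(3) by (metis A.dvd_add_right_iff A.dvd_triv_right)
  qed
  then have "?v dvdM a \<otimes> d" by (rule cancel)
  then have "?v dvdM a \<otimes> b" by (simp add: c A.dvd_mult2 flip: mult_assoc)
  then show ?thesis by (rule cancel)
qed

lemma modu_dvd_bounded: "modu b i dvdM a \<longleftrightarrow> (\<exists>q. q \<preceq> a \<and> a = modu b i \<otimes> q)"
proof
  assume "modu b i dvdM a"
  then obtain q where q: "a = modu b i \<otimes> q" by (auto elim: A.dvdE)
  then have "a = q \<oplus> (i \<oplus> \<one>) \<otimes> b \<otimes> q" by (simp add: modu_def arith)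
  then have "q \<preceq> a" by (auto simp: le_iff_add)
  then show "\<exists>q. q \<preceq> a \<and> a = modu b i \<otimes> q" using q by blast
qed (auto intro: A.dvdI)

text \<open>\<open>pr (pr a b) N\<close> codes the set of those \<open>i \<prec> N\<close> whose
  modulus divides \<open>a\<close>. Coding sets rather than remainders lets a code be built by
  multiplication alone, without the Chinese remainder theorem; a sequence is then a set of
  pairs.\<close>

definition elt :: "'a \<Rightarrow> 'a \<Rightarrow> bool" where
  "elt i u \<longleftrightarrow> i \<prec> sn u \<and> modu (sn (fs u)) i dvdM fs (fs u)"

lemma T_modu: "T F \<Longrightarrow> T G \<Longrightarrow> T (\<lambda>e. modu (F e) (G e))"
  unfolding modu_def by (intro T_add T_mult T_const)

lemma D0_dvd: "T F \<Longrightarrow> T G \<Longrightarrow> T H \<Longrightarrow> D0 (\<lambda>e. modu (F e) (G e) dvdM H e)"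
  unfolding modu_dvd_bounded
  by (rule D0_bex_le D0_eq T_mult T_modu T_var T_ren[of _ Suc] | assumption)+

lemma D0_elt: "T F \<Longrightarrow> T G \<Longrightarrow> D0 (\<lambda>e. elt (F e) (G e))"
  unfolding elt_def by (intro D0_and D0_lt D0_dvd T_fs T_sn)

text \<open>The code is the product of the moduli of the wanted indices, formed by Sigma_1 induction
  on \<open>m\<close>. As \<open>b\<close> is divisible by every positive number up to
  \<open>N\<close>, hence by all distances between indices, a new factor does not make any other
  modulus a divisor.\<close>

lemma code_exists:
  assumes "D0 (\<lambda>e. P (e 0))"
  shows "\<exists>u. \<forall>i. elt i u \<longleftrightarrow> i \<prec> N \<and> P i"
proof -
  obtain b where b: "\<zero> \<prec> b" "\<And>d. d \<preceq> N \<Longrightarrow> \<zero> \<prec> d \<Longrightarrow> d dvdM b"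
    using common_multiple[of N] by (metis A.dvdI)
  have "\<exists>a. \<forall>i. i \<prec> N \<longrightarrow> (modu b i dvdM a \<longleftrightarrow> i \<prec> m \<and> P i)" for m
  proof (induction m rule: Sigma1_induct)
    case 1
    note P = D0_rel1[of P, OF assms]
    show ?case
      by (rule D0_ex) (rule P D0_dvd d0_rules)+
  next
    case 2
    have "\<not> modu b i dvdM \<one>" for i
    proof
      assume "modu b i dvdM \<one>"
      then obtain q where q: "modu b i \<otimes> q = \<one>" by (auto elim: A.dvdE)
      then have "q \<noteq> \<zero>" by auto
      then obtain q' where q': "q = q' \<oplus> \<one>" using zero_le Suc_exists by blast
      have "modu b i \<otimes> (q' \<oplus> \<one>) = \<one> \<oplus> (modu b i \<otimes> q' \<oplus> (i \<oplus> \<one>) \<otimes> b)"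
        by (simp add: modu_def arith)
      then have "\<one> \<oplus> (modu b i \<otimes> q' \<oplus> (i \<oplus> \<one>) \<otimes> b) = \<one> \<oplus> \<zero>"
        using q q' by simp
      then have "modu b i \<otimes> q' \<oplus> (i \<oplus> \<one>) \<otimes> b = \<zero>" by (simp only: add_left_cancel)
      then have "i \<otimes> b \<oplus> b = \<zero>" by (simp add: arith A.add_nonneg_eq_0_iff)
      then show False using b(1) by (simp add: A.add_nonneg_eq_0_iff)
    qed
    then show ?case by (intro exI[of _ \<one>]) simp
  next
    case (3 m)
    then obtain a where a: "\<And>i. i \<prec> N \<Longrightarrow> modu b i dvdM a \<longleftrightarrow> i \<prec> m \<and> P i" by blast
    show ?case
    proof (cases "m \<prec> N \<and> P m")
      case False then show ?thesis using a by (intro exI[of _ a]) (auto simp: lt_Suc)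
    next
      case True
      have "modu b i dvdM a \<otimes> modu b m \<longleftrightarrow> i \<prec> m \<oplus> \<one> \<and> P i" if i: "i \<prec> N" for i
      proof (cases "i = m")
        case True' : True then show ?thesis using True by (simp add: lt_Suc)
      next
        case False
        have "d dvdM b" if "\<zero> \<prec> d" "m = i \<oplus> d \<or> i = m \<oplus> d" for d
        proof -
          have "d \<preceq> m \<or> d \<preceq> i" using that le_iff_add add_comm by metis
          then have "d \<preceq> N" using True i by (meson A.less_imp_le A.order_trans)
          then show ?thesis using b(2) that by simp
        qed
        then have "modu b i dvdM a \<otimes> modu b m \<longleftrightarrow> modu b i dvdM a"
          using modu_dvd_cancel[of m i b a] False by (auto intro: A.dvd_mult2)
        then show ?thesis using a[OF i] False by (auto simp: lt_Suc)
      qed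
      then show ?thesis by blast
    qed
  qed
  from this[of N] obtain a where "\<forall>i. i \<prec> N \<longrightarrow> (modu b i dvdM a \<longleftrightarrow> i \<prec> N \<and> P i)" by blast
  then show ?thesis by (intro exI[of _ "pr (pr a b) N"]) (auto simp: elt_def)
qed

section \<open>Sequences as coded sets of pairs\<close>

lemma least_D0:
  assumes "D0 (\<lambda>e. P (e 0))" "P x"
  shows "\<exists>y. P y \<and> (\<forall>z. z \<prec> y \<longrightarrow> \<not> P z)"
proof (rule ccontr)
  assume no: "\<not> ?thesis"
  have "\<forall>z. z \<prec> n \<longrightarrow> \<not> P z" for n
  proof (induction n rule: D0_induct)
    case D0
    note P = D0_rel1[of P, OF assms(1)]
    show ?case by (rule P d0_rules)+
  next
    case (Suc n) then show ?case using no by (auto simp: lt_Suc)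
  qed simp
  from this[of "x \<oplus> \<one>"] assms(2) show False using lt_Suc by blast
qed

text \<open>\<open>sq u i\<close> is the \<open>i\<close>-th entry of the sequence coded by \<open>u\<close>, and \<open>\<zero>\<close> if there is none.\<close>

definition sq :: "'a \<Rightarrow> 'a \<Rightarrow> 'a" where
  "sq u i = (if \<exists>y. elt (pr i y) u then (THE y. elt (pr i y) u \<and> (\<forall>z. z \<prec> y \<longrightarrow> \<not> elt (pr i z) u)) else \<zero>)"

lemma elt_bound: "elt (pr i y) u \<Longrightarrow> y \<preceq> u"
  unfolding elt_def by (meson A.less_imp_le A.order_trans pr_bounds(2) sn_le)

lemma sq_graph: "y = sq u i \<longleftrightarrow> elt (pr i y) u \<and> (\<forall>z. z \<prec> y \<longrightarrow> \<not> elt (pr i z) u) \<or>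
   (\<not> (\<exists>z. z \<preceq> u \<and> elt (pr i z) u)) \<and> y = \<zero>"
proof (cases "\<exists>y. elt (pr i y) u")
  case True
  have "D0 (\<lambda>e. elt (pr i (e 0)) u)" by (rule D0_elt T_pr T_var T_const)+
  from least_D0[OF this] True obtain x
    where x: "elt (pr i x) u" "\<And>z. z \<prec> x \<Longrightarrow> \<not> elt (pr i z) u" by blast
  have uniq: "y = x" if "elt (pr i y) u \<and> (\<forall>z. z \<prec> y \<longrightarrow> \<not> elt (pr i z) u)" for y
    using x that lt_linear by blast
  have "(THE y. elt (pr i y) u \<and> (\<forall>z. z \<prec> y \<longrightarrow> \<not> elt (pr i z) u)) = x"
    by (rule the_equality) (use x uniq in blast)+
  then have sq: "sq u i = x" unfolding sq_def using True by simp
  have ex: "\<exists>z. z \<preceq> u \<and> elt (pr i z) u" using x(1) elt_bound by blast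
  show ?thesis unfolding sq using x uniq ex by metis
qed (auto simp: sq_def)

lemma T_sq': "T (\<lambda>e. sq (e 0) (e (Suc 0)))"
  unfolding T_def sq_graph by (rule d0_rules D0_elt)+

lemmas T_sq = T_T2[OF T_sq']

text \<open>A code bounds its entries; later a code \<open>w\<close> of witnesses or thresholds
  serves as their common bound.\<close>

lemma sq_le: "sq u i \<preceq> u"
  using sq_graph[of "sq u i" u i] elt_bound by auto

text \<open>Codes carry no length: every number is a sequence on the whole model, and only the
  entries below the intended length are controlled. The new code collects pairs of an index up to
  \<open>n\<close> and a value up to \<open>u \<oplus> v\<close>.\<close>

lemma sq_extend: "\<exists>u'. (\<forall>i. i \<prec> n \<longrightarrow> sq u' i = sq u i) \<and> sq u' n = v"
proof -
  define P where "P x \<longleftrightarrow> (\<exists>i. i \<preceq> x \<and> (\<exists>y. y \<preceq> x \<and> x = pr i y \<and> (i \<prec> n \<and> y = sq u i \<or> i = n \<and> y = v)))" for x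
  have P: "P (pr i y) \<longleftrightarrow> (i \<prec> n \<and> y = sq u i \<or> i = n \<and> y = v)" for i y
    unfolding P_def by (auto simp: pr_bounds)
  have "D0 (\<lambda>e. P (e 0))" unfolding P_def by (rule d0_rules T_sq)+
  from code_exists[OF this, of "pr n (u \<oplus> v) \<oplus> \<one>"] obtain u' where
    u': "\<And>x. elt x u' \<longleftrightarrow> x \<preceq> pr n (u \<oplus> v) \<and> P x" by (auto simp: le_Suc_iff)
  have "u \<preceq> u \<oplus> v" "v \<preceq> u \<oplus> v" using le_iff_add add_comm by metis+
  then have "(i \<prec> n \<and> y = sq u i \<or> i = n \<and> y = v) \<Longrightarrow> pr i y \<preceq> pr n (u \<oplus> v)" for i y
    using pr_mono sq_le A.order_trans A.less_imp_le A.order_refl by metis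
  then have elt: "elt (pr i y) u' \<longleftrightarrow> (i \<prec> n \<and> y = sq u i \<or> i = n \<and> y = v)" for i y
    using u' P by metis
  have "sq u' i = sq u i" if "i \<prec> n" for i
    using sq_graph[of "sq u i" u' i] that by (auto simp: elt)
  moreover have "sq u' n = v"
    using sq_graph[of v u' n] by (auto simp: elt)
  ultimately show ?thesis by blast
qed

section \<open>Induction, choice and recursion for definable predicates\<close>

lemma ex_pr: "(\<exists>c. R (fs c) (sn c)) \<longleftrightarrow> (\<exists>a b. R a b)"
proof
  assume "\<exists>a b. R a b"
  then obtain a b where "R a b" by blast
  then show "\<exists>c. R (fs c) (sn c)" by (intro exI[of _ "pr a b"]) simp
qed blast

lemma Sg_exN: "Sg k (\<lambda>e. \<not> Q (e 0) (\<lambda>i. e (Suc i))) \<Longrightarrow> Sg (Suc k) (\<lambda>e. \<exists>a. Q a e)"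
  by (auto intro!: exI[of _ "\<lambda>e. \<not> Q (e 0) (\<lambda>i. e (Suc i))"])

lemma Sg_SucE:
  assumes "Sg (Suc k) P"
  obtains Q where "Sg k (\<lambda>e. Q (e 0) (\<lambda>i. e (Suc i)))" "P = (\<lambda>e. \<exists>a. \<not> Q a e)"
proof -
  obtain Q where Q: "Sg k Q" "P = (\<lambda>e. \<exists>a. \<not> Q (scons a e))" using assms by auto
  have "scons (e 0) (\<lambda>i. e (Suc i)) = e" for e :: "nat \<Rightarrow> 'a"
    by (auto simp: fun_eq_iff scons_def split: nat.split)
  then show ?thesis using that[of "\<lambda>a e. Q (scons a e)"] Q by simp
qed

lemma Sg_not_Suc: "Sg k P \<Longrightarrow> Sg (Suc k) (\<lambda>e. \<not> P e)"
  using Sg_exN[of k "\<lambda>a e. \<not> P e"] Sg_ren[of k P Suc] by (simp del: Sg.simps)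

lemma Sg_Suc: "Sg k P \<Longrightarrow> Sg (Suc k) P"
proof (induction k arbitrary: P)
  case 0 then show ?case using Sg_D0_Suc by simp
next
  case (Suc k)
  then obtain Q where Q: "Sg k Q" "P = (\<lambda>e. \<exists>a. \<not> Q (scons a e))" by auto
  then show ?case using Suc.IH[OF Q(1)] Sg.simps(2)[of "Suc k" P] by blast
qed

lemma Sg_D0: "D0 P \<Longrightarrow> Sg k P"
proof (induction k)
  case (Suc k) then show ?case using Sg_Suc by blast
qed simp

text \<open>Two witnesses are paired for a conjunction, while a disjunction shares one. Since
  \<open>Sg\<close> negates its matrix, each connective at level \<open>k + 1\<close> needs the
  other one at level \<open>k\<close>, so both are proved together.\<close>

lemma Sg_and_or: "Sg k P \<Longrightarrow> Sg k Q \<Longrightarrow> Sg k (\<lambda>e. P e \<and> Q e) \<and> Sg k (\<lambda>e. P e \<or> Q e)"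
proof (induction k arbitrary: P Q)
  case 0 then show ?case by (simp add: D0_and D0_or)
next
  case (Suc k)
  obtain P' where P': "Sg k (\<lambda>e. P' (e 0) (\<lambda>i. e (Suc i)))" "P = (\<lambda>e. \<exists>a. \<not> P' a e)"
    using Sg_SucE[OF Suc.prems(1)] by blast
  obtain Q' where Q': "Sg k (\<lambda>e. Q' (e 0) (\<lambda>i. e (Suc i)))" "Q = (\<lambda>e. \<exists>a. \<not> Q' a e)"
    using Sg_SucE[OF Suc.prems(2)] by blast
  have 1: "Sg k (\<lambda>e. P' (fs (e 0)) (\<lambda>i. e (Suc i)))"
    using Sg_subst[OF P'(1), of "\<lambda>i. case i of 0 \<Rightarrow> (\<lambda>e. fs (e 0)) | Suc j \<Rightarrow> (\<lambda>e. e (Suc j))"]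
    by (simp add: T_fs T_var split: nat.split)
  have 2: "Sg k (\<lambda>e. Q' (sn (e 0)) (\<lambda>i. e (Suc i)))"
    using Sg_subst[OF Q'(1), of "\<lambda>i. case i of 0 \<Rightarrow> (\<lambda>e. sn (e 0)) | Suc j \<Rightarrow> (\<lambda>e. e (Suc j))"]
    by (simp add: T_sn T_var split: nat.split)
  have "Sg (Suc k) (\<lambda>e. \<exists>c. \<not> (P' (fs c) e \<or> Q' (sn c) e))"
    by (rule Sg_exN) (use Suc.IH[OF 1 2] in simp)
  moreover have "(\<exists>c. \<not> (P' (fs c) e \<or> Q' (sn c) e)) \<longleftrightarrow> P e \<and> Q e" for e
    unfolding P' Q' using ex_pr[of "\<lambda>a b. \<not> (P' a e \<or> Q' b e)"] by simp
  ultimately have "Sg (Suc k) (\<lambda>e. P e \<and> Q e)" by (simp del: Sg.simps)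
  moreover have "Sg (Suc k) (\<lambda>e. \<exists>c. \<not> (P' c e \<and> Q' c e))"
    by (rule Sg_exN) (use Suc.IH[OF P'(1) Q'(1)] in simp)
  moreover have "(\<exists>c. \<not> (P' c e \<and> Q' c e)) \<longleftrightarrow> P e \<or> Q e" for e
    unfolding P' Q' by blast
  ultimately show ?case by (simp del: Sg.simps)
qed

lemmas Sg_and = Sg_and_or[THEN conjunct1] and Sg_or = Sg_and_or[THEN conjunct2]

lemma Sg_imp: "D0 P \<Longrightarrow> Sg k Q \<Longrightarrow> Sg k (\<lambda>e. P e \<longrightarrow> Q e)"
  unfolding imp_conv_disj by (intro Sg_or Sg_D0[of "\<lambda>e. \<not> P e"] D0_not)

lemma Sg_subst_cons:
  assumes "Sg k (\<lambda>e. R (e 0) (\<lambda>i. e (Suc i)))" "T F" "\<And>i. T (\<sigma> i)"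
  shows "Sg k (\<lambda>e. R (F e) (\<lambda>i. \<sigma> i e))"
  using Sg_subst[OF assms(1), of "\<lambda>i. case i of 0 \<Rightarrow> F | Suc j \<Rightarrow> \<sigma> j"] assms(2,3)
  by (simp split: nat.split)

lemma Sg_subst_scons:
  assumes "Sg k (\<lambda>e. R (e 0) (\<lambda>i. e (Suc i)))" "T F" "T G" "\<And>i. T (\<sigma> i)"
  shows "Sg k (\<lambda>e. R (F e) (scons (G e) (\<lambda>i. \<sigma> i e)))"
proof (rule Sg_subst_cons[OF assms(1,2)])
  show "T (\<lambda>e. scons (G e) (\<lambda>i. \<sigma> i e) i)" for i
    using assms(3,4) by (cases i) simp_all
qed

lemma Sg_ex:
  assumes "Sg (Suc k) (\<lambda>e. Q (e 0) (\<lambda>i. e (Suc i)))"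
  shows "Sg (Suc k) (\<lambda>e. \<exists>a. Q a e)"
proof -
  obtain R where R: "Sg k (\<lambda>e. R (e 0) (\<lambda>i. e (Suc i)))"
    "(\<lambda>e. Q (e 0) (\<lambda>i. e (Suc i))) = (\<lambda>e. \<exists>b. \<not> R b e)" by (rule Sg_SucE[OF assms])
  have Q: "Q a e \<longleftrightarrow> (\<exists>b. \<not> R b (scons a e))" for a e using fun_cong[OF R(2), of "scons a e"] by simp
  have "Sg k (\<lambda>e. R (sn (e 0)) (scons (fs (e 0)) (\<lambda>i. e (Suc i))))"
    by (rule Sg_subst_scons[OF R(1)]) (rule T_sn T_fs T_var)+
  then have "Sg (Suc k) (\<lambda>e. \<exists>c. \<not> R (sn c) (scons (fs c) e))" by (intro Sg_exN) simp
  moreover have "(\<exists>c. \<not> R (sn c) (scons (fs c) e)) \<longleftrightarrow> (\<exists>a. Q a e)" for e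
    unfolding Q using ex_pr[of "\<lambda>a b. \<not> R b (scons a e)"] by simp
  ultimately show ?thesis by (simp del: Sg.simps)
qed

lemma Sg_bex:
  assumes "T F" "Sg k (\<lambda>e. Q (e 0) (\<lambda>i. e (Suc i)))"
  shows "Sg k (\<lambda>e. \<exists>a. a \<prec> F e \<and> Q a e)"
proof (cases k)
  case 0
  show ?thesis using assms(2) D0_bex[OF assms(1), of Q] unfolding 0 by simp
next
  case (Suc j)
  have "Sg k (\<lambda>e. e 0 \<prec> F (\<lambda>i. e (Suc i)) \<and> Q (e 0) (\<lambda>i. e (Suc i)))"
    by (rule Sg_and[OF Sg_D0[OF D0_lt[OF T_var T_ren[OF assms(1)]]] assms(2)])
  then show ?thesis unfolding Suc by (intro Sg_ex)
qed

text \<open>All levels are collected so that a proof at one level may use bounded quantification at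
  the level below. For \<open>k = 0\<close> the condition is vacuous, as \<open>D0\<close> contains
  bounded quantifiers.\<close>

definition IS :: "nat \<Rightarrow> bool" where
  "IS k \<longleftrightarrow> (\<forall>j. 0 < j \<longrightarrow> j \<le> k \<longrightarrow> ISigma M j)"

lemma IS_Suc: "IS (Suc k) \<Longrightarrow> IS k"
  by (simp add: IS_def)

lemma IS_1: "IS (Suc 0)"
  using ISigma1 by (simp add: IS_def le_Suc_eq)

lemma Sg_induct [consumes 1, case_names Sg zero Suc]:
  assumes "IS (Suc k)" "Sg (Suc k) (\<lambda>e. p (e 0))" "p \<zero>" "\<And>n. p n \<Longrightarrow> p (n \<oplus> \<one>)"
  shows "p n"
  using ISigma_induct[of "Suc k" p n] assms by (simp add: IS_def del: Sg.simps)

text \<open>\<open>\<Sigma>\<^sub>k\<close>-collection comes with a code of the witnesses, since sequence codes can be extended.\<close>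

lemma Sg_ball:
  assumes "IS k"
  shows "T F \<Longrightarrow> Sg k (\<lambda>e. Q (e 0) (\<lambda>i. e (Suc i))) \<Longrightarrow> Sg k (\<lambda>e. \<forall>a. a \<prec> F e \<longrightarrow> Q a e)"
proof (cases k)
  case 0
  assume "T F" "Sg k (\<lambda>e. Q (e 0) (\<lambda>i. e (Suc i)))"
  then show ?thesis using D0_ball[of F Q] by (simp add: 0)
next
  case (Suc j)
  assume F: "T F" and "Sg k (\<lambda>e. Q (e 0) (\<lambda>i. e (Suc i)))"
  then have *: "Sg (Suc j) (\<lambda>e. Q (e 0) (\<lambda>i. e (Suc i)))" by (simp only: Suc)
  obtain R where R: "Sg j (\<lambda>e. R (e 0) (\<lambda>i. e (Suc i)))"
    "(\<lambda>e. Q (e 0) (\<lambda>i. e (Suc i))) = (\<lambda>e. \<exists>b. \<not> R b e)" by (rule Sg_SucE[OF *])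
  have Q: "Q a e \<longleftrightarrow> (\<exists>b. \<not> R b (scons a e))" for a e using fun_cong[OF R(2), of "scons a e"] by simp
  have m: "Sg j (\<lambda>e. \<exists>a. a \<prec> G e \<and> R (sq (e 0) a) (scons a (\<lambda>i. e (Suc i))))"
    if "T G" for G
  proof (rule Sg_bex[OF that])
    show "Sg j (\<lambda>e. R (sq (e (Suc 0)) (e 0)) (scons (e 0) (\<lambda>i. e (Suc (Suc i)))))"
      by (rule Sg_subst_scons[OF R(1)]) (rule T_sq T_var)+
  qed
  have S: "Sg (Suc j) (\<lambda>e. \<exists>w. \<not> (\<exists>a. a \<prec> G e \<and> R (sq w a) (scons a e)))" if "T G" for G
    by (rule Sg_exN) (use m[OF T_ren[OF that, of Suc]] in simp)
  have "(\<forall>a. a \<prec> n \<longrightarrow> Q a e) \<longleftrightarrow> (\<exists>w. \<not> (\<exists>a. a \<prec> n \<and> R (sq w a) (scons a e)))" for n e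
  proof
    assume all: "\<forall>a. a \<prec> n \<longrightarrow> Q a e"
    have "m \<preceq> n \<longrightarrow> (\<exists>w. \<not> (\<exists>a. a \<prec> m \<and> R (sq w a) (scons a e)))" for m
      using assms[unfolded Suc]
    proof (induction m rule: Sg_induct)
      case Sg
      have c: "Sg j (\<lambda>e'. R (sq (e' (Suc 0)) (e' 0)) (scons (e' 0) e))"
        by (rule Sg_subst_scons[OF R(1)]) (rule T_sq T_var T_const)+
      have "Sg (Suc j) (\<lambda>e'. \<exists>w. \<not> (\<exists>a. a \<prec> e' 0 \<and> R (sq w a) (scons a e)))"
        by (rule Sg_exN, unfold not_not, rule Sg_bex, rule T_var, rule c)
      then show ?case by (intro Sg_imp D0_le T_var T_const)
    next
      case zero show ?case by simp
    next
      case (Suc m)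
      show ?case
      proof
        assume le: "m \<oplus> \<one> \<preceq> n"
        then obtain w where w: "\<And>a. a \<prec> m \<Longrightarrow> \<not> R (sq w a) (scons a e)"
          using Suc by (metis Suc_le_iff A.less_imp_le)
        have "Q m e" using all le by (simp add: Suc_le_iff)
        then obtain b where b: "\<not> R b (scons m e)" unfolding Q by blast
        obtain w' where "\<And>i. i \<prec> m \<Longrightarrow> sq w' i = sq w i" "sq w' m = b" using sq_extend by blast
        then show "\<exists>w. \<not> (\<exists>a. a \<prec> m \<oplus> \<one> \<and> R (sq w a) (scons a e))"
          using w b by (intro exI[of _ w']) (auto simp: lt_Suc)
      qed
    qed
    then show "\<exists>w. \<not> (\<exists>a. a \<prec> n \<and> R (sq w a) (scons a e))" by blast
  qed (auto simp: Q)
  then show ?thesis using S[OF F] by (simp only: Suc)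
qed

lemma Sg_allD0:
  assumes "D0 (\<lambda>e. Q (e 0) (\<lambda>i. e (Suc i)))" shows "Sg (Suc (Suc k)) (\<lambda>e. \<forall>a. Q a e)"
proof -
  have "Sg (Suc k) (\<lambda>e. \<exists>a. \<not> Q a e)" by (rule Sg_exN) (simp add: Sg_D0[OF assms])
  from Sg_not_Suc[OF this] show ?thesis by (simp del: Sg.simps)
qed

section \<open>Finite choice and least number principles\<close>

lemma choice:
  assumes "IS (Suc k)" "Sg (Suc k) (\<lambda>e. Q (e 0) (e (Suc 0)))" "\<And>i. i \<prec> n \<Longrightarrow> \<exists>y. Q i y"
  shows "\<exists>w. \<forall>i. i \<prec> n \<longrightarrow> Q i (sq w i)"
proof -
  note Q = Sg_rel2[OF assms(2)]
  have "m \<preceq> n \<longrightarrow> (\<exists>w. \<forall>i. i \<prec> m \<longrightarrow> Q i (sq w i))" for m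
    using assms(1)
  proof (induction m rule: Sg_induct)
    case Sg
    show ?case
      by (rule Sg_imp, (rule d0_rules)+, rule Sg_ex, rule Sg_ball[OF assms(1)], rule T_var, rule Q) (rule T_sq T_var)+
  next
    case (Suc m)
    show ?case
    proof
      assume le: "m \<oplus> \<one> \<preceq> n"
      then obtain w where w: "\<And>i. i \<prec> m \<Longrightarrow> Q i (sq w i)"
        using Suc by (metis Suc_le_iff A.less_imp_le)
      obtain y where y: "Q m y" using assms(3) le by (auto simp: Suc_le_iff)
      obtain w' where "\<And>i. i \<prec> m \<Longrightarrow> sq w' i = sq w i" "sq w' m = y" using sq_extend by blast
      then show "\<exists>w. \<forall>i. i \<prec> m \<oplus> \<one> \<longrightarrow> Q i (sq w i)"
        using w y by (intro exI[of _ w']) (auto simp: lt_Suc)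
    qed
  qed simp
  then show ?thesis by blast
qed

lemma choice_D0:
  assumes "D0 (\<lambda>e. Q (e 0) (e (Suc 0)))" "\<And>i. i \<prec> n \<Longrightarrow> \<exists>y. Q i y"
  shows "\<exists>w. \<forall>i. i \<prec> n \<longrightarrow> Q i (sq w i)"
  by (rule choice[OF IS_1 Sg_D0[OF assms(1)] assms(2)])

text \<open>If the complement had no least element, \<open>P\<close> would hold below every
  \<open>n\<close> by Sigma induction, the bounded quantifier being absorbed by
  \<open>Sg_ball\<close>.\<close>

lemma least_neg:
  assumes "IS (Suc k)" "Sg (Suc k) (\<lambda>e. P (e 0))" "\<not> P x"
  shows "\<exists>y. \<not> P y \<and> (\<forall>z. z \<prec> y \<longrightarrow> P z)"
proof (rule ccontr)
  assume no: "\<not> ?thesis"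
  note P = Sg_rel1[OF assms(2)]
  have "\<forall>z. z \<prec> n \<longrightarrow> P z" for n
    using assms(1)
  proof (induction n rule: Sg_induct)
    case Sg show ?case by (rule Sg_ball[OF assms(1)], rule T_var, rule P, rule T_var)
  next
    case (Suc n) then show ?case using no by (auto simp: lt_Suc)
  qed simp
  from this[of "x \<oplus> \<one>"] assms(3) show False using lt_Suc by blast
qed

lemma T_monus': "T (\<lambda>e. e 0 \<ominus> e (Suc 0))"
proof -
  have "y = a \<ominus> b \<longleftrightarrow> (b \<preceq> a \<and> a = b \<oplus> y) \<or> (\<not> b \<preceq> a \<and> y = \<zero>)" for y a b
    by (cases "b \<preceq> a") (auto simp: add_monus monus_zero monus_eq)
  then have "?thesis \<longleftrightarrow> D0 (\<lambda>e. (e (Suc (Suc 0)) \<preceq> e (Suc 0) \<and> e (Suc 0) = e (Suc (Suc 0)) \<oplus> e 0) \<or>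
     (\<not> e (Suc (Suc 0)) \<preceq> e (Suc 0) \<and> e 0 = \<zero>))" by (simp only: T_def)
  also have \<dots> by (rule d0_rules)+
  finally show ?thesis .
qed

lemmas T_monus = T_T2[OF T_monus']

text \<open>From a failure at \<open>n\<close> one descends: \<open>\<not> p (n \<ominus> x)\<close>
  is a Sigma predicate of \<open>x\<close>, proved by ordinary induction, and at
  \<open>x = n\<close> it contradicts the base case.\<close>

lemma neg_induct [consumes 1, case_names Sg zero Suc]:
  assumes "IS (Suc k)" "Sg (Suc k) (\<lambda>e. \<not> p (e 0))" "p \<zero>" "\<And>n. p n \<Longrightarrow> p (n \<oplus> \<one>)"
  shows "p n"
proof (rule ccontr)
  assume np: "\<not> p n"
  have "\<not> p (n \<ominus> x)" for x
    using assms(1)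
  proof (induction x rule: Sg_induct)
    case Sg show ?case by (rule Sg_rel1[OF assms(2)]) (rule T_monus T_var T_const)+
  next
    case zero
    have "n \<ominus> \<zero> = n" using monus_eq[of \<zero> n] by simp
    then show ?case using np by simp
  next
    case (Suc x)
    then have "n \<ominus> x \<noteq> \<zero>" using assms(3) by metis
    then obtain d where d: "n \<ominus> x = d \<oplus> \<one>" using Suc_exists zero_le by metis
    then have "n \<ominus> (x \<oplus> \<one>) = d" using monus_eq[of \<one> d] by (simp add: add_comm[of d] flip: monus_monus)
    then show ?case using Suc assms(4)[of d] d by auto
  qed
  from this[of n] show False using monus_eq[of n \<zero>] assms(3) by simp
qed

section \<open>Minimization, uniformization and recursion\<close>

definition mu :: "('a \<Rightarrow> bool) \<Rightarrow> 'a" where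
  "mu P = (THE y. P y \<and> (\<forall>z. z \<prec> y \<longrightarrow> \<not> P z))"

lemma mu_unique: "P y \<Longrightarrow> (\<And>z. z \<prec> y \<Longrightarrow> \<not> P z) \<Longrightarrow> mu P = y"
  unfolding mu_def by (rule the_equality) (use lt_linear in blast)+

lemma mu_D0:
  assumes "D0 (\<lambda>e. P (e 0))" "P x"
  shows "P (mu P)" "z \<prec> mu P \<Longrightarrow> \<not> P z"
proof -
  obtain y where y: "P y" "\<And>z. z \<prec> y \<Longrightarrow> \<not> P z" using least_D0[of P x] assms by blast
  then have "mu P = y" by (rule mu_unique)
  then show "P (mu P)" "z \<prec> mu P \<Longrightarrow> \<not> P z" using y by auto
qed

lemma D0_section:
  assumes "D0 (\<lambda>e. P (e 0) (\<lambda>i. e (Suc i)))" shows "D0 (\<lambda>e'. P (e' 0) e)"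
  using Sg_subst_cons[of 0 P "\<lambda>e. e 0" "\<lambda>i _. e i"] assms by (simp add: T_var T_const)

lemma T_mu:
  assumes "D0 (\<lambda>e. P (e 0) (\<lambda>i. e (Suc i)))" "\<And>e. \<exists>c. P c e"
  shows "T (\<lambda>e. mu (\<lambda>c. P c e))" "P (mu (\<lambda>c. P c e)) e"
proof -
  note D0_section[OF assms(1)]
  from mu_D0[OF this] assms(2) have mu: "P (mu (\<lambda>c. P c e)) e" "z \<prec> mu (\<lambda>c. P c e) \<Longrightarrow> \<not> P z e" for z e
    by blast+
  show "P (mu (\<lambda>c. P c e)) e" by (rule mu)
  have "y = mu (\<lambda>c. P c e) \<longleftrightarrow> P y e \<and> (\<forall>z. z \<prec> y \<longrightarrow> \<not> P z e)" for y e
    using mu mu_unique[of "\<lambda>c. P c e" y] by metis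
  moreover have "D0 (\<lambda>e. P (e 0) (\<lambda>i. e (Suc i)) \<and> (\<forall>z. z \<prec> e 0 \<longrightarrow> \<not> P z (\<lambda>i. e (Suc i))))"
  proof (intro D0_and assms(1) D0_ball T_var D0_not)
    show "D0 (\<lambda>e. P (e 0) (\<lambda>i. e (Suc (Suc i))))"
      using Sg_subst_cons[of 0 P "\<lambda>e. e 0" "\<lambda>i e. e (Suc (Suc i))"] assms(1) by (simp add: T_var)
  qed
  ultimately show "T (\<lambda>e. mu (\<lambda>c. P c e))" by (simp add: T_def)
qed

text \<open>The Sigma_k graph of a total function is also Pi_k for positive \<open>k\<close>, since
  a wrong value is recognized by exhibiting the right one; hence the single condition.\<close>

definition Fn :: "nat \<Rightarrow> ('a \<Rightarrow> 'a) \<Rightarrow> bool" where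
  "Fn k F \<longleftrightarrow> Sg k (\<lambda>e. e 0 = F (e (Suc 0)))"

lemma Sg_Fn: "Fn k F \<Longrightarrow> T A \<Longrightarrow> T B \<Longrightarrow> Sg k (\<lambda>e. A e = F (B e))"
  unfolding Fn_def by (rule Sg_rel2[of k "\<lambda>a b. a = F b"])

lemma Fn_D0: "T (\<lambda>e. F (e 0)) \<Longrightarrow> Fn k F"
  using T_T1[of F "\<lambda>e. e (Suc 0)"] by (auto simp: Fn_def intro!: Sg_D0 D0_eq T_var)

lemma Fn_T:
  assumes "Fn (Suc 0) F" shows "T (\<lambda>e. F (e 0))"
proof -
  have "Sg (Suc 0) (\<lambda>e. \<exists>y. y = F (e (Suc 0)) \<and> e 0 \<noteq> y)"
    by (rule Sg_ex, rule Sg_and, rule Sg_Fn[OF assms]) (rule T_var Sg_D0 d0_rules)+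
  then have "Sg (Suc 0) (\<lambda>e. \<not> e 0 = F (e (Suc 0)))" by (simp del: Sg.simps)
  then show ?thesis unfolding T_def using assms delta1_comprehension by (simp add: Fn_def del: Sg.simps)
qed

text \<open>Choosing the least pair of a value and a witness stays \<open>\<Sigma>\<^sub>k\<close>, as it only
  quantifies boundedly over the matrix.\<close>

lemma uniformize:
  assumes "IS (Suc k)" "Sg (Suc k) (\<lambda>e. R (e 0) (e (Suc 0)))"
  shows "\<exists>G. Sg (Suc k) (\<lambda>e. G (e 0) (e (Suc 0))) \<and> (\<forall>x y. G x y \<longrightarrow> R x y) \<and>
    (\<forall>x y y'. G x y \<longrightarrow> G x y' \<longrightarrow> y = y') \<and> (\<forall>x. (\<exists>y. R x y) \<longrightarrow> (\<exists>y. G x y))"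
proof -
  obtain Q where Q: "Sg k (\<lambda>e. Q (e 0) (\<lambda>i. e (Suc i)))"
    "(\<lambda>e. R (e 0) (e (Suc 0))) = (\<lambda>e. \<exists>b. \<not> Q b e)" by (rule Sg_SucE[OF assms(2)])
  \<comment> \<open>\<open>c\<close> codes a value together with a witness for it, and
    \<open>\<not> N c x\<close> says that the witness is correct. As \<open>R\<close> sees only two
    arguments, the rest of the environment is filled with \<open>\<zero>\<close>.\<close>
  define N where "N c x = Q (sn c) (scons x (scons (fs c) (\<lambda>_. \<zero>)))" for c x
  have "Sg k (\<lambda>e. Q (sn (e 0)) (scons (e (Suc 0)) (\<lambda>i. scons (fs (e 0)) (\<lambda>_. \<zero>) i)))"
  proof (rule Sg_subst_scons[OF Q(1)])
    show "T (\<lambda>e. scons (fs (e 0)) (\<lambda>_. \<zero>) i)" for i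
      by (cases i) (simp_all add: T_fs T_var T_const)
  qed (rule T_sn T_var)+
  then have "Sg k (\<lambda>e. N (e 0) (e (Suc 0)))" by (simp add: N_def)
  note N = Sg_rel2[OF this]
  have R: "R x y \<longleftrightarrow> (\<exists>c. fs c = y \<and> \<not> N c x)" for x y
    using fun_cong[OF Q(2), of "scons x (scons y (\<lambda>_. \<zero>))"]
      ex_pr[of "\<lambda>a b. a = y \<and> \<not> Q b (scons x (scons a (\<lambda>_. \<zero>)))"] by (simp add: N_def)
  define G where "G x y \<longleftrightarrow> (\<exists>c. fs c = y \<and> \<not> N c x \<and> (\<forall>z. z \<prec> c \<longrightarrow> N z x))" for x y
  show ?thesis
  proof (rule exI[of _ G], intro conjI allI impI)
    show "Sg (Suc k) (\<lambda>e. G (e 0) (e (Suc 0)))" unfolding G_def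
      by (rule Sg_ex, rule Sg_and, rule Sg_D0, (rule d0_rules)+, rule Sg_and, rule Sg_not_Suc, rule N,
          rule T_var, rule T_var, rule Sg_Suc, rule Sg_ball[OF IS_Suc[OF assms(1)]], rule T_var, rule N)
        (rule T_var)+
    show "R x y" if "G x y" for x y using that unfolding G_def R by blast
    show "y = y'" if "G x y" "G x y'" for x y y' using that lt_linear unfolding G_def by blast
    show "\<exists>y. G x y" if r: "\<exists>y. R x y" for x
    proof -
      obtain c where "\<not> N c x" using r unfolding R by blast
      moreover have "Sg (Suc k) (\<lambda>e. N (e 0) x)" by (rule Sg_Suc, rule N) (rule T_var T_const)+
      ultimately show ?thesis
        using least_neg[OF assms(1), of "\<lambda>c. N c x" c] unfolding G_def by blast
    qed
  qed
qed

lemma uniformize_fun: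
  assumes "IS (Suc k)" "Sg (Suc k) (\<lambda>e. R (e 0) (e (Suc 0)))" "\<And>x. \<exists>y. R x y"
  obtains F where "Fn (Suc k) F" "\<And>x. R x (F x)"
proof -
  obtain G where G: "Sg (Suc k) (\<lambda>e. G (e 0) (e (Suc 0)))" "\<And>x y. G x y \<Longrightarrow> R x y"
    "\<And>x y y'. G x y \<Longrightarrow> G x y' \<Longrightarrow> y = y'" "\<And>x y. R x y \<Longrightarrow> \<exists>y. G x y"
    using uniformize[OF assms(1,2)] by (elim exE conjE) (rule that, assumption, blast+)
  define F where "F x = (SOME y. G x y)" for x
  have F: "G x (F x)" for x unfolding F_def using G(4) assms(3) by (metis someI)
  then have "y = F x \<longleftrightarrow> G x y" for x y using G(3) by blast
  moreover have "Sg (Suc k) (\<lambda>e. G (e (Suc 0)) (e 0))" by (rule Sg_rel2[OF G(1)]) (rule T_var)+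
  ultimately have "Fn (Suc k) F" by (simp add: Fn_def del: Sg.simps)
  then show ?thesis using that F G(2) by blast
qed

text \<open>\<open>K n u y\<close> says that \<open>y\<close> may follow the first \<open>n\<close>
  entries of \<open>u\<close>. The recursion passes from a code of one history to a code of the
  next, and \<open>uniformize\<close> makes this step deterministic. Any two computations then
  agree, and the value at \<open>n\<close> is Sigma definable through the existence of a
  computation.\<close>

lemma dependent_choice:
  assumes IS: "IS (Suc k)" and K: "Sg (Suc k) (\<lambda>e. K (e 0) (e (Suc 0)) (e (Suc (Suc 0))))"
    and ext: "\<And>n u v y. K n u y \<Longrightarrow> (\<And>j. j \<prec> n \<Longrightarrow> sq v j = sq u j) \<Longrightarrow> K n v y"
    and ex: "\<And>n u. (\<And>i. i \<prec> n \<Longrightarrow> K i u (sq u i)) \<Longrightarrow> \<exists>y. K n u y"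
  shows "\<exists>F. Fn (Suc k) F \<and> (\<forall>n u. (\<forall>j. j \<prec> n \<longrightarrow> sq u j = F j) \<longrightarrow> K n u (F n))"
proof -
  define R where "R x v \<longleftrightarrow> (\<forall>j. j \<prec> fs x \<longrightarrow> sq v j = sq (sn x) j) \<and> K (fs x) (sn x) (sq v (fs x))" for x v
  have SR: "Sg (Suc k) (\<lambda>e. R (e 0) (e (Suc 0)))" unfolding R_def
    by (rule Sg_and, rule Sg_D0, (rule T_sq d0_rules)+, rule Sg_rel3[OF K]) (rule T_sq d0_rules)+
  obtain G where G: "Sg (Suc k) (\<lambda>e. G (e 0) (e (Suc 0)))" "\<And>x y. G x y \<Longrightarrow> R x y"
    "\<And>x y y'. G x y \<Longrightarrow> G x y' \<Longrightarrow> y = y'" "\<And>x y. R x y \<Longrightarrow> \<exists>y. G x y"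
    using uniformize[OF IS SR] by (elim exE conjE) (rule that, assumption, blast+)
  \<comment> \<open>\<open>w\<close> codes a computation: its entry \<open>i\<close> is itself the
    code of the history of length \<open>i\<close>, with \<open>\<zero>\<close> as code of the empty
    one.\<close>
  define W where "W n w \<longleftrightarrow> sq w \<zero> = \<zero> \<and> (\<forall>i. i \<prec> n \<longrightarrow> G (pr i (sq w i)) (sq w (i \<oplus> \<one>)))" for n w
  have "Sg (Suc k) (\<lambda>e. W (e 0) (e (Suc 0)))" unfolding W_def
    by (rule Sg_and, rule Sg_D0, (rule T_sq d0_rules)+, rule Sg_ball[OF IS], rule T_var, rule Sg_rel2[OF G(1)])
      (rule T_sq d0_rules)+
  note SW = Sg_rel2[OF this]
  have Wmono: "W m w" if "W n w" "m \<preceq> n" for n m w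
    using that A.less_le_trans unfolding W_def by blast
  have step: "sq (sq w (n \<oplus> \<one>)) j = sq (sq w n) j" if "W N w" "n \<prec> N" "j \<prec> n" for N w n j
    using that G(2)[of "pr n (sq w n)"] unfolding W_def R_def by auto
  have stepK: "K n (sq w n) (sq (sq w (n \<oplus> \<one>)) n)" if "W N w" "n \<prec> N" for N w n
    using that G(2)[of "pr n (sq w n)"] unfolding W_def R_def by auto
  \<comment> \<open>\<open>R\<close> vouches for an entry relative to an earlier code only;
    \<open>ext\<close> transfers this to the current code, for which \<open>ex\<close> can then be
    used.\<close>
  have hist: "m \<preceq> n \<longrightarrow> (\<forall>i. i \<prec> m \<longrightarrow> K i (sq w m) (sq (sq w m) i))" if W: "W n w" for n w m
    using IS
  proof (induction m rule: Sg_induct)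
    case Sg show ?case
      by (rule Sg_imp, (rule d0_rules)+, rule Sg_ball[OF IS], rule T_var, rule Sg_rel3[OF K]) (rule T_sq d0_rules)+
  next
    case (Suc m)
    show ?case
    proof (intro impI allI)
      fix i assume le: "m \<oplus> \<one> \<preceq> n" and i: "i \<prec> m \<oplus> \<one>"
      then have m: "m \<prec> n" by (simp add: Suc_le_iff)
      have same: "sq (sq w (m \<oplus> \<one>)) j = sq (sq w m) j" if "j \<prec> m" for j
        by (rule step[OF W m that])
      show "K i (sq w (m \<oplus> \<one>)) (sq (sq w (m \<oplus> \<one>)) i)"
      proof (cases "i = m")
        case True then show ?thesis using ext[OF stepK[OF W m]] same by blast
      next
        case False
        then have im: "i \<prec> m" using i by (simp add: lt_Suc)
        then have "K i (sq w m) (sq (sq w m) i)" using Suc m by (simp add: le_def)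
        then have "K i (sq w (m \<oplus> \<one>)) (sq (sq w m) i)"
          using ext same lt_trans[OF im] by blast
        then show ?thesis using same[OF im] by simp
      qed
    qed
  qed simp
  have total: "\<exists>w. W n w" for n
    using IS
  proof (induction n rule: Sg_induct)
    case Sg show ?case by (rule Sg_ex, rule SW) (rule T_var)+
  next
    case zero
    obtain w where "sq w \<zero> = \<zero>" using sq_extend by blast
    then show ?case by (auto simp: W_def)
  next
    case (Suc n)
    then obtain w where w: "W n w" by blast
    let ?s = "sq w n"
    have "\<exists>y. K n ?s y" using hist[OF w, of n] by (intro ex) (auto simp: le_def)
    then obtain y where y: "K n ?s y" by blast
    obtain v where "\<And>j. j \<prec> n \<Longrightarrow> sq v j = sq ?s j" "sq v n = y" using sq_extend by blast
    then have "R (pr n ?s) v" using y by (simp add: R_def)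
    then obtain v' where v': "G (pr n ?s) v'" using G(4) by blast
    obtain w' where w': "\<And>j. j \<prec> n \<oplus> \<one> \<Longrightarrow> sq w' j = sq w j" "sq w' (n \<oplus> \<one>) = v'" using sq_extend by blast
    have "W (n \<oplus> \<one>) w'" unfolding W_def
    proof (intro conjI allI impI)
      show "sq w' \<zero> = \<zero>" using w w'(1)[of \<zero>] zero_le[of n] by (auto simp: W_def lt_Suc)
      fix i assume i: "i \<prec> n \<oplus> \<one>"
      show "G (pr i (sq w' i)) (sq w' (i \<oplus> \<one>))"
      proof (cases "i = n")
        case True then show ?thesis using w' v' i by simp
      next
        case False
        then have "i \<prec> n" using i by (simp add: lt_Suc)
        then show ?thesis using w w'(1)[OF i] w'(1)[of "i \<oplus> \<one>"] Suc_lt by (simp add: W_def)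
      qed
    qed
    then show ?case by blast
  qed
  have uniq: "m \<preceq> n \<longrightarrow> sq w m = sq w' m" if "W n w" "W n w'" for n w w' m
  proof (induction m rule: D0_induct)
    case D0 show ?case by (rule T_sq d0_rules)+
  next
    case zero show ?case using that by (simp add: W_def)
  next
    case (Suc m) then show ?case using that G(3) unfolding W_def Suc_le_iff by (metis A.less_imp_le)
  qed
  define F where "F n = sq (sq (SOME w. W (n \<oplus> \<one>) w) (n \<oplus> \<one>)) n" for n
  have F: "F n = sq (sq w (n \<oplus> \<one>)) n" if "W (n \<oplus> \<one>) w" for n w
  proof -
    have "W (n \<oplus> \<one>) (SOME w. W (n \<oplus> \<one>) w)" using that by (rule someI)
    from uniq[OF this that, of "n \<oplus> \<one>"] show ?thesis by (simp add: F_def)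
  qed
  show ?thesis
  proof (rule exI[of _ F], intro conjI allI impI)
    have "y = F n \<longleftrightarrow> (\<exists>w. W (n \<oplus> \<one>) w \<and> y = sq (sq w (n \<oplus> \<one>)) n)" for y n
      using total F by metis
    moreover have "Sg (Suc k) (\<lambda>e. \<exists>w. W (e (Suc 0) \<oplus> \<one>) w \<and> e 0 = sq (sq w (e (Suc 0) \<oplus> \<one>)) (e (Suc 0)))"
      by (rule Sg_ex, rule Sg_and, rule SW, (rule d0_rules)+, rule Sg_D0) (rule T_sq d0_rules)+
    ultimately show "Fn (Suc k) F" by (simp add: Fn_def del: Sg.simps)
    fix n u assume "\<forall>j. j \<prec> n \<longrightarrow> sq u j = F j"
    then have u: "\<And>j. j \<prec> n \<Longrightarrow> sq u j = F j" by blast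
    obtain w where w: "W (n \<oplus> \<one>) w" using total by blast
    have st: "m \<preceq> n \<longrightarrow> j \<prec> m \<longrightarrow> sq (sq w m) j = sq (sq w (j \<oplus> \<one>)) j" for m j
    proof (induction m rule: D0_induct)
      case D0 show ?case by (rule T_sq d0_rules)+
    next
      case (Suc m)
      then show ?case using step[OF w, of m j] A.less_imp_le[of m n] A.less_trans[of m n "n \<oplus> \<one>"]
        by (auto simp: Suc_le_iff lt_Suc)
    qed simp
    have "sq u j = sq (sq w n) j" if j: "j \<prec> n" for j
    proof -
      have "W (j \<oplus> \<one>) w" using Wmono[OF w, of "j \<oplus> \<one>"] Suc_lt[OF j] by (simp add: le_def)
      then show ?thesis using u[OF j] F st[of n j] j by (simp add: le_def)
    qed
    then show "K n u (F n)" using ext[OF stepK[OF w, of n], of u] F[OF w] by (simp add: lt_Suc)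
  qed
qed

section \<open>Internal pigeonhole principle and limits\<close>

lemma pigeonhole:
  assumes "\<And>i. i \<preceq> n \<Longrightarrow> sq u i \<prec> n"
  shows "\<exists>i j. i \<prec> j \<and> j \<preceq> n \<and> sq u i = sq u j"
proof -
  \<comment> \<open>Quantified over all codes the claim is Pi_1 in \<open>n\<close>, hence the
    induction for negated Sigma_1 predicates.\<close>
  have "\<forall>u. (\<forall>i. i \<preceq> n \<longrightarrow> sq u i \<prec> n) \<longrightarrow> (\<exists>j. j \<preceq> n \<and> (\<exists>i. i \<prec> j \<and> sq u i = sq u j))"
    using IS_1
  proof (induction n rule: neg_induct)
    case Sg show ?case unfolding not_all by (rule D0_ex) (rule T_sq d0_rules)+
  next
    case zero show ?case by (auto simp: le_def)
  next
    case (Suc n)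
    show ?case
    proof (intro allI impI, rule ccontr)
      fix u
      assume u: "\<forall>i. i \<preceq> n \<oplus> \<one> \<longrightarrow> sq u i \<prec> n \<oplus> \<one>"
        and "\<nexists>j. j \<preceq> n \<oplus> \<one> \<and> (\<exists>i. i \<prec> j \<and> sq u i = sq u j)"
      then have inj: "sq u i \<noteq> sq u j" if "i \<prec> j" "j \<preceq> n \<oplus> \<one>" for i j using that by blast
      \<comment> \<open>The value \<open>n\<close> is redirected to the value of the last entry,
        which removes the last index and the largest value together.\<close>
      have D: "D0 (\<lambda>e. (sq u (e 0) = n \<and> e (Suc 0) = sq u (n \<oplus> \<one>)) \<or> (sq u (e 0) \<noteq> n \<and> e (Suc 0) = sq u (e 0)))"
        by (rule T_sq d0_rules)+
      obtain w where "\<forall>i. i \<prec> n \<oplus> \<one> \<longrightarrow>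
          (sq u i = n \<and> sq w i = sq u (n \<oplus> \<one>)) \<or> (sq u i \<noteq> n \<and> sq w i = sq u i)"
        using choice_D0[OF D, of "n \<oplus> \<one>"] by blast
      then have w: "sq w i = (if sq u i = n then sq u (n \<oplus> \<one>) else sq u i)" if "i \<preceq> n" for i
        using that by (auto simp: le_Suc_iff)
      have lt: "i \<prec> n \<oplus> \<one>" if "i \<preceq> n" for i using that by (simp add: le_Suc_iff)
      have "sq w i \<prec> n" if i: "i \<preceq> n" for i
      proof (cases "sq u i = n")
        case True
        then have "sq u (n \<oplus> \<one>) \<noteq> n" using inj[OF lt[OF i]] by (metis A.order_refl)
        moreover have "sq u (n \<oplus> \<one>) \<prec> n \<oplus> \<one>" using u by simp
        ultimately show ?thesis using True w[OF i] by (simp add: lt_Suc)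
      next
        case False
        moreover have "sq u i \<prec> n \<oplus> \<one>" using u lt[OF i] by (simp add: le_def)
        ultimately show ?thesis using w[OF i] by (simp add: lt_Suc)
      qed
      then obtain i j where ij: "i \<prec> j" "j \<preceq> n" "sq w i = sq w j" using Suc by blast
      then have i: "i \<preceq> n" by (meson A.less_imp_le A.order_trans)
      have "sq u i \<noteq> sq u j" using inj[of i j] ij lt[of j] by (simp add: le_def)
      moreover have "sq u i \<noteq> sq u (n \<oplus> \<one>)" "sq u j \<noteq> sq u (n \<oplus> \<one>)"
        using inj lt i ij(2) by simp_all
      ultimately show False using ij(3) w[OF i] w[OF ij(2)] by (auto split: if_splits)
    qed
  qed
  then show ?thesis using assms by blast
qed

text \<open>Shoenfield's limit lemma: stage \<open>s\<close> takes the value from the least pair of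
  value and witness that has no counterexample below \<open>s\<close>.\<close>

lemma limit_lemma:
  assumes "Fn (Suc (Suc 0)) F"
  obtains A where "T (\<lambda>e. A (e 0) (e (Suc 0)))" "\<And>x. \<exists>m. \<forall>s. m \<preceq> s \<longrightarrow> A x s = F x"
proof -
  obtain Q where Q: "Sg (Suc 0) (\<lambda>e. Q (e 0) (\<lambda>i. e (Suc i)))"
    "(\<lambda>e. e 0 = F (e (Suc 0))) = (\<lambda>e. \<exists>b. \<not> Q b e)" by (rule Sg_SucE[OF assms[unfolded Fn_def]])
  obtain R where R: "Sg 0 (\<lambda>e. R (e 0) (\<lambda>i. e (Suc i)))"
    "(\<lambda>e. Q (e 0) (\<lambda>i. e (Suc i))) = (\<lambda>e. \<exists>b. \<not> R b e)" by (rule Sg_SucE[OF Q(1)])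
  define \<theta> where "\<theta> c x b = R b (scons (sn c) (scons (fs c) (scons x (\<lambda>_. \<zero>))))" for c x b
  have "Sg 0 (\<lambda>e. R (e (Suc (Suc 0))) (scons (sn (e 0)) (\<lambda>i. scons (fs (e 0)) (scons (e (Suc 0)) (\<lambda>_. \<zero>)) i)))"
  proof (rule Sg_subst_scons[OF R(1)])
    fix i
    show "T (\<lambda>e. scons (fs (e 0)) (scons (e (Suc 0)) (\<lambda>_. \<zero>)) i)"
    proof (cases i)
      case (Suc j)
      show ?thesis unfolding Suc scons_simps by (cases j) (simp_all add: T_fs T_var T_const)
    qed (simp add: T_fs T_var)
  qed (rule T_sn T_var)+
  then have "D0 (\<lambda>e. \<theta> (e 0) (e (Suc 0)) (e (Suc (Suc 0))))" by (simp add: \<theta>_def)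
  note D = D0_rel3[OF this]
  have F: "y = F x \<longleftrightarrow> (\<exists>c. fs c = y \<and> (\<forall>b. \<theta> c x b))" for x y
    using fun_cong[OF Q(2), of "scons y (scons x (\<lambda>_. \<zero>))"]
      ex_pr[of "\<lambda>a b. a = y \<and> \<not> Q b (scons a (scons x (\<lambda>_. \<zero>)))"]
      fun_cong[OF R(2), of "scons z (scons y (scons x (\<lambda>_. \<zero>)))" for z] by (auto simp: \<theta>_def)
  \<comment> \<open>The alternative \<open>c = s\<close> is a default that makes the least
    \<open>c\<close> exist at every stage; beyond the true one it is never the least.\<close>
  define P where "P c x s \<longleftrightarrow> c = s \<or> c \<preceq> s \<and> (\<forall>b. b \<prec> s \<longrightarrow> \<theta> c x b)" for c x s
  have DP: "D0 (\<lambda>e. P (e 0) (e (Suc 0)) (e (Suc (Suc 0))))" unfolding P_def by (rule D d0_rules)+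
  show ?thesis
  proof
    show "T (\<lambda>e. fs (mu (\<lambda>c. P c (e 0) (e (Suc 0)))))"
      by (rule T_fs, rule T_mu(1)[of "\<lambda>c e. P c (e 0) (e (Suc 0))", OF DP]) (auto simp: P_def)
    fix x
    obtain c0 where c0: "\<forall>b. \<theta> c0 x b" using F[of "F x" x] by blast
    have "Sg (Suc 0) (\<lambda>e. \<exists>b. \<not> \<theta> (e 0) x b)" by (rule D0_ex) (rule D d0_rules)+
    from least_neg[OF IS_1, of "\<lambda>c. \<exists>b. \<not> \<theta> c x b", OF this, of c0] c0
    obtain c where c: "\<forall>b. \<theta> c x b" "\<And>z. z \<prec> c \<Longrightarrow> \<exists>b. \<not> \<theta> z x b" by blast
    have "D0 (\<lambda>e. \<not> \<theta> (e 0) x (e (Suc 0)))" by (rule D d0_rules)+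
    \<comment> \<open>One refutation for each smaller pair, all collected in the code
      \<open>w\<close>; from stage \<open>c \<oplus> w \<oplus> \<one>\<close> on all of them have
      been seen.\<close>
    from choice_D0[OF this, of c] c(2) obtain w where w: "\<And>z. z \<prec> c \<Longrightarrow> \<not> \<theta> z x (sq w z)" by blast
    have "fs (mu (\<lambda>c. P c x s)) = F x" if s: "c \<oplus> w \<oplus> \<one> \<preceq> s" for s
    proof -
      have le: "c \<oplus> w \<prec> s" using s by (simp add: Suc_le_iff)
      then have cs: "c \<prec> s" "w \<prec> s" using le_iff_add add_comm A.le_less_trans by metis+
      have "mu (\<lambda>c. P c x s) = c"
      proof (rule mu_unique)
        show "P c x s" using c(1) cs by (simp add: P_def le_def)
        fix z assume z: "z \<prec> c"
        then have "sq w z \<prec> s" using sq_le cs A.le_less_trans by blast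
        then show "\<not> P z x s" using w[OF z] z cs lt_trans[of c s z] by (auto simp: P_def)
      qed
      then show ?thesis using F[of "fs c" x] c(1) by auto
    qed
    then show "\<exists>m. \<forall>s. m \<preceq> s \<longrightarrow> fs (mu (\<lambda>c. P c x s)) = F x" by blast
  qed
qed

text \<open>Being a threshold for \<open>i\<close> is a Pi_1 condition, so choice is applied at
  level 2. The code of the thresholds is at least each of them and serves as the common one.\<close>

lemma eventually_bounded:
  assumes "IS (Suc (Suc 0))" "D0 (\<lambda>e. P (e 0) (e (Suc 0)))"
    and "\<And>i. i \<prec> n \<Longrightarrow> \<exists>m. \<forall>s. m \<preceq> s \<longrightarrow> P i s"
  shows "\<exists>m. \<forall>s. m \<preceq> s \<longrightarrow> (\<forall>i. i \<prec> n \<longrightarrow> P i s)"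
proof -
  have "Sg (Suc (Suc 0)) (\<lambda>e. \<forall>s. e (Suc 0) \<preceq> s \<longrightarrow> P (e 0) s)"
    by (rule Sg_allD0) (rule D0_rel2[OF assms(2)] d0_rules)+
  from choice[OF assms(1) this assms(3)] obtain w where
    w: "\<And>i s. i \<prec> n \<Longrightarrow> sq w i \<preceq> s \<Longrightarrow> P i s" by blast
  then show ?thesis using sq_le A.order_trans by blast
qed

section \<open>The notions of the statement in terms of \<open>D0\<close> and
  \<open>Sg\<close>\<close>

lemma almost_all_iff: "almost_all M P \<longleftrightarrow> (\<exists>m. \<forall>s. m \<preceq> s \<longrightarrow> P s)"
  unfolding almost_all_def finite_in_def by (metis (mono_tags) A.not_less mem_Collect_eq)

lemma set_in_model: "D0 (\<lambda>e. P (e 0)) \<Longrightarrow> {x. P x} \<in> S"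
proof -
  assume *: "D0 (\<lambda>e. P (e 0))"
  have "Sg (Suc 0) (\<lambda>e. e 0 \<in> {x. P x})" "Sg (Suc 0) (\<lambda>e. e 0 \<notin> {x. P x})"
    using Sg_D0[OF *] Sg_D0[OF D0_not[OF *]] by (simp_all del: Sg.simps)
  then have "Delta_set M 1 {x. P x}"
    unfolding Delta_set_def One_nat_def using definable1_Sg by blast
  then show ?thesis using RCA0 by (simp add: RCA0_def Delta1_CA_def)
qed

lemma in_model1_iff: "in_model1 M D g \<longleftrightarrow> D0 (\<lambda>e. e 0 \<in> D \<and> e (Suc 0) = g (e 0))"
proof
  assume "in_model1 M D g"
  then have "D0 (\<lambda>e. pr (e 0) (e (Suc 0)) \<in> {pr x (g x) | x. x \<in> D})"
    unfolding in_model1_def by (intro D0_mem T_pr T_var)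
  then show "D0 (\<lambda>e. e 0 \<in> D \<and> e (Suc 0) = g (e 0))" by (auto elim!: back_subst[of D0])
next
  define R where "R x y \<longleftrightarrow> x \<in> D \<and> y = g x" for x y
  assume "D0 (\<lambda>e. e 0 \<in> D \<and> e (Suc 0) = g (e 0))"
  then have "D0 (\<lambda>e. R (e 0) (e (Suc 0)))" by (simp add: R_def)
  note D = D0_rel2[OF this]
  have "D0 (\<lambda>e. \<exists>x. x \<preceq> e 0 \<and> (\<exists>y. y \<preceq> e 0 \<and> (e 0 = pr x y \<and> R x y)))"
    by (rule D d0_rules)+
  from set_in_model[OF this] show "in_model1 M D g"
    unfolding in_model1_def R_def by (auto simp: pr_bounds elim!: back_subst[of "\<lambda>A. A \<in> S"])
qed

lemma in_model1_T: "in_model1 M UNIV g \<longleftrightarrow> T (\<lambda>e. g (e 0))"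
proof -
  have "D0 (\<lambda>e. e (Suc 0) = g (e 0)) \<longleftrightarrow> D0 (\<lambda>e. e 0 = g (e (Suc 0)))"
    using D0_rel2[of "\<lambda>x y. y = g x" "\<lambda>e. e (Suc 0)" "\<lambda>e. e 0"]
      D0_rel2[of "\<lambda>y x. y = g x" "\<lambda>e. e (Suc 0)" "\<lambda>e. e 0"] T_var by blast
  then show ?thesis by (simp add: in_model1_iff T_def)
qed

lemma in_model2_iff:
  "in_model2 M D g \<longleftrightarrow> D0 (\<lambda>e. (e 0, e (Suc 0)) \<in> D \<and> e (Suc (Suc 0)) = g (e 0) (e (Suc 0)))"
proof
  assume "in_model2 M D g"
  then have "D0 (\<lambda>e. pr (pr (e 0) (e (Suc 0))) (e (Suc (Suc 0))) \<in> {pr (pr x y) (g x y) | x y. (x, y) \<in> D})"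
    unfolding in_model2_def by (intro D0_mem T_pr T_var)
  then show "D0 (\<lambda>e. (e 0, e (Suc 0)) \<in> D \<and> e (Suc (Suc 0)) = g (e 0) (e (Suc 0)))"
    by (auto elim!: back_subst[of D0])
next
  define R where "R x y z \<longleftrightarrow> (x, y) \<in> D \<and> z = g x y" for x y z
  assume "D0 (\<lambda>e. (e 0, e (Suc 0)) \<in> D \<and> e (Suc (Suc 0)) = g (e 0) (e (Suc 0)))"
  then have "D0 (\<lambda>e. R (e 0) (e (Suc 0)) (e (Suc (Suc 0))))" by (simp add: R_def)
  note D = D0_rel3[OF this]
  have "D0 (\<lambda>e. \<exists>x. x \<preceq> e 0 \<and> (\<exists>y. y \<preceq> e 0 \<and> (\<exists>z. z \<preceq> e 0 \<and> (e 0 = pr (pr x y) z \<and> R x y z))))"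
    by (rule D d0_rules)+
  moreover have "x \<preceq> pr (pr x y) z" "y \<preceq> pr (pr x y) z" for x y z
    using pr_bounds A.order_trans by blast+
  ultimately show "in_model2 M D g" using set_in_model[of "\<lambda>c. \<exists>x. x \<preceq> c \<and> (\<exists>y. y \<preceq> c \<and> (\<exists>z. z \<preceq> c \<and> (c = pr (pr x y) z \<and> R x y z)))"]
    unfolding in_model2_def R_def by (auto simp: pr_bounds elim!: back_subst[of "\<lambda>A. A \<in> S"])
qed

lemma in_model2_T: "in_model2 M UNIV g \<longleftrightarrow> T (\<lambda>e. g (e 0) (e (Suc 0)))"
proof -
  have "D0 (\<lambda>e. e (Suc (Suc 0)) = g (e 0) (e (Suc 0))) \<longleftrightarrow> D0 (\<lambda>e. e 0 = g (e (Suc 0)) (e (Suc (Suc 0))))"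
    using D0_rel3[of "\<lambda>x y z. z = g x y" "\<lambda>e. e (Suc 0)" "\<lambda>e. e (Suc (Suc 0))" "\<lambda>e. e 0"]
      D0_rel3[of "\<lambda>z x y. z = g x y" "\<lambda>e. e (Suc (Suc 0))" "\<lambda>e. e 0" "\<lambda>e. e (Suc 0)"] T_var by blast
  then show ?thesis by (simp add: in_model2_iff T_def)
qed

lemma Delta_fun_iff: "Delta_fun M (Suc k) h \<longleftrightarrow> Fn (Suc k) h"
proof
  assume "Delta_fun M (Suc k) h"
  then have "Sg (Suc k) (\<lambda>e. e (Suc 0) = h (e 0))"
    unfolding Delta_fun_def Delta_rel_def definable2_Sg by (simp del: Sg.simps)
  from Sg_rel2[of "Suc k" "\<lambda>x y. y = h x" "\<lambda>e. e (Suc 0)" "\<lambda>e. e 0", OF this T_var T_var]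
  show "Fn (Suc k) h" by (simp add: Fn_def del: Sg.simps)
next
  assume h: "Fn (Suc k) h"
  have "Sg (Suc k) (\<lambda>e. (e 0, e (Suc 0)) \<in> {(x, y). y = h x})"
    using Sg_Fn[OF h T_var T_var] by (simp del: Sg.simps)
  moreover have "Sg (Suc k) (\<lambda>e. \<exists>y. y = h (e 0) \<and> y \<noteq> e (Suc 0))"
    by (rule Sg_ex, rule Sg_and, rule Sg_Fn[OF h]) (rule T_var Sg_D0 d0_rules)+
  then have "Sg (Suc k) (\<lambda>e. (e 0, e (Suc 0)) \<notin> {(x, y). y = h x})"
    by (auto simp del: Sg.simps elim!: back_subst[of "Sg (Suc k)"])
  ultimately show "Delta_fun M (Suc k) h"
    unfolding Delta_fun_def Delta_rel_def using definable2_Sg by blast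
qed

end

section \<open>Escaping and diagonalizing functions\<close>

locale rca0_ISigma2 = rca0 +
  assumes ISigma2: "ISigma M 2"
begin

lemma IS_2: "IS (Suc (Suc 0))"
  using ISigma1 ISigma2 by (auto simp: IS_def le_Suc_eq numeral_2_eq_2)

text \<open>A single diagonalizing function \<open>g\<close> serves all \<open>a\<close> and
  \<open>n\<close>, its argument being the pair of \<open>a\<close> and \<open>i\<close>. Were
  \<open>E a n\<close> equal to \<open>H a i\<close>, their \<open>i\<close>-th entries would be
  \<open>g (pr a i)\<close> and \<open>h (pr a i)\<close>.\<close>

lemma diagonalize_many:
  assumes "diagonalizing_principle M" "Sg (Suc (Suc 0)) (\<lambda>e. e 0 = H (e (Suc 0)) (e (Suc (Suc 0))))"
  obtains E where "T (\<lambda>e. E (e 0) (e (Suc 0)))" "\<And>a n i. i \<prec> n \<Longrightarrow> E a n \<noteq> H a i"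
proof -
  define h where "h x = sq (H (fs x) (sn x)) (sn x)" for x
  have "Sg (Suc (Suc 0)) (\<lambda>e. \<exists>y. y = H (fs (e (Suc 0))) (sn (e (Suc 0))) \<and> e 0 = sq y (sn (e (Suc 0))))"
    by (rule Sg_ex, rule Sg_and, rule Sg_rel3[of _ "\<lambda>x y z. x = H y z", OF assms(2)])
      (rule Sg_D0 T_sq d0_rules)+
  then have "Fn (Suc (Suc 0)) h" by (simp add: Fn_def h_def del: Sg.simps)
  then obtain g where g: "T (\<lambda>e. g (e 0))" "\<And>x. g x \<noteq> h x"
    using assms(1) unfolding diagonalizing_principle_def diagonalizing_def numeral_2_eq_2 Delta_fun_iff in_model1_T
    by blast
  note Tg = T_T1[of g, OF g(1)]
  define E where "E a n = mu (\<lambda>v. \<forall>i. i \<prec> n \<longrightarrow> sq v i = g (pr a i))" for a n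
  have D: "D0 (\<lambda>e. \<forall>i. i \<prec> e (Suc (Suc 0)) \<longrightarrow> sq (e 0) i = g (pr (e (Suc 0)) i))"
    by (rule T_sq Tg d0_rules)+
  have ex: "\<exists>v. \<forall>i. i \<prec> n \<longrightarrow> sq v i = g (pr a i)" for a n
  proof (rule choice_D0)
    show "D0 (\<lambda>e. e (Suc 0) = g (pr a (e 0)))" by (rule Tg d0_rules)+
  qed blast
  note mu = T_mu[of "\<lambda>v e. \<forall>i. i \<prec> e (Suc 0) \<longrightarrow> sq v i = g (pr (e 0) i)", OF D ex]
  have E: "sq (E a n) i = g (pr a i)" if "i \<prec> n" for a n i
    using mu(2)[of "scons a (scons n (\<lambda>_. \<zero>))"] that by (simp add: E_def)
  show ?thesis
  proof
    show "T (\<lambda>e. E (e 0) (e (Suc 0)))" using mu(1) by (simp add: E_def)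
    show "E a n \<noteq> H a i" if "i \<prec> n" for a n i
      using E[OF that, of a] g(2)[of "pr a i"] unfolding h_def fs_pr sn_pr by metis
  qed
qed

text \<open>If \<open>c\<close> exceeded \<open>m\<close>, preimages of the first
  \<open>m + 1\<close> entries under the counting bijection would form a coded sequence of
  \<open>m + 1\<close> numbers below \<open>m\<close>, against \<open>pigeonhole\<close>.\<close>

lemma card_bound:
  assumes "has_card M A m" "\<And>i. i \<prec> c \<Longrightarrow> sq u i \<in> A"
    and "\<And>i j. i \<prec> j \<Longrightarrow> j \<prec> c \<Longrightarrow> sq u i \<noteq> sq u j"
  shows "c \<preceq> m"
proof (rule ccontr)
  assume "\<not> c \<preceq> m"
  then have mc: "m \<prec> c" by (simp add: not_le)
  obtain g where g: "in_model1 M {i. i \<prec> m} g" "bij_betw g {i. i \<prec> m} A"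
    using assms(1) unfolding has_card_def by blast
  note Dg = D0_rel2[of "\<lambda>x y. x \<in> {i. i \<prec> m} \<and> y = g x", OF g(1)[unfolded in_model1_iff]]
  have "D0 (\<lambda>e. e (Suc 0) \<in> {i. i \<prec> m} \<and> sq u (e 0) = g (e (Suc 0)))"
    by (rule Dg) (rule T_sq d0_rules)+
  moreover have "\<exists>y. y \<in> {i. i \<prec> m} \<and> sq u i = g y" if "i \<prec> m \<oplus> \<one>" for i
  proof -
    have "sq u i \<in> A" using assms(2) that mc by (meson A.le_less_trans le_Suc_iff)
    then show ?thesis using g(2) unfolding bij_betw_def by blast
  qed
  ultimately obtain w where w: "\<And>i. i \<preceq> m \<Longrightarrow> sq w i \<prec> m \<and> sq u i = g (sq w i)"
    using choice_D0[of "\<lambda>x y. y \<in> {i. i \<prec> m} \<and> sq u x = g y" "m \<oplus> \<one>"] by (auto simp: le_Suc_iff)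
  then obtain i j where ij: "i \<prec> j" "j \<preceq> m" "sq w i = sq w j" using pigeonhole[of m w] by blast
  then have "sq u i = sq u j" using w[of i] w[of j] by (metis A.less_imp_le A.order_trans)
  then show False using assms(3)[of i j] ij mc by (meson A.le_less_trans)
qed

lemma diagonalizing_imp_escaping:
  assumes dp: "diagonalizing_principle M"
  shows "escaping_principle M"
  unfolding escaping_principle_def
proof (intro allI impI)
  fix X assume "uniform_Sigma2_finite_family M X \<and> sizes_uniformly_Delta2 M X"
  then obtain c where X: "Sg (Suc (Suc 0)) (\<lambda>e. e (Suc 0) \<in> X (e 0))" and c: "Fn (Suc (Suc 0)) c"
    and card: "\<And>a. has_card M (X a) (c a)"
    unfolding uniform_Sigma2_finite_family_def sizes_uniformly_Delta2_def numeral_2_eq_2 Delta_fun_iff definable2_Sg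
    by auto
  note SX = Sg_rel2[of _ "\<lambda>a x. x \<in> X a", OF X]
  \<comment> \<open>To demand that the list exhausts \<open>X a\<close> would be a Pi_2 condition;
    an injective list of \<open>c a\<close> members is Sigma_2. Counting makes up for the difference
    afterwards.\<close>
  define U where "U a u \<longleftrightarrow> (\<exists>m. m = c a \<and> (\<forall>i. i \<prec> m \<longrightarrow> sq u i \<in> X a) \<and>
      (\<forall>i. i \<prec> m \<longrightarrow> (\<forall>j. j \<prec> m \<longrightarrow> sq u i = sq u j \<longrightarrow> i = j)))" for a u
  have "Sg (Suc (Suc 0)) (\<lambda>e. U (e 0) (e (Suc 0)))" unfolding U_def
    by (rule Sg_ex, rule Sg_and, rule Sg_Fn[OF c], rule T_var, rule T_var, rule Sg_and, rule Sg_ball[OF IS_2],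
        rule T_var, rule SX) (rule Sg_D0 T_sq d0_rules)+
  moreover have "\<exists>u. U a u" for a
  proof -
    obtain g where g: "in_model1 M {i. i \<prec> c a} g" "bij_betw g {i. i \<prec> c a} (X a)"
      using card[of a] unfolding has_card_def by blast
    obtain u where u: "\<And>i. i \<prec> c a \<Longrightarrow> sq u i = g i"
      using choice_D0[of "\<lambda>x y. x \<in> {i. i \<prec> c a} \<and> y = g x" "c a"] g(1)[unfolded in_model1_iff] by auto
    have "U a u" using g(2) unfolding U_def bij_betw_def inj_on_def
      by (intro exI[of _ "c a"]) (auto simp: u)
    then show ?thesis by blast
  qed
  ultimately obtain u where u: "Fn (Suc (Suc 0)) u" "\<And>a. U a (u a)"
    using uniformize_fun[OF IS_2] by metis
  have "Sg (Suc (Suc 0)) (\<lambda>e. \<exists>y. y = u (e (Suc 0)) \<and> e 0 = sq y (e (Suc (Suc 0))))"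
    by (rule Sg_ex, rule Sg_and, rule Sg_Fn[OF u(1)]) (rule Sg_D0 T_sq d0_rules)+
  then have "Sg (Suc (Suc 0)) (\<lambda>e. e 0 = sq (u (e (Suc 0))) (e (Suc (Suc 0))))" by (simp del: Sg.simps)
  then obtain E where E: "T (\<lambda>e. E (e 0) (e (Suc 0)))" "\<And>a n i. i \<prec> n \<Longrightarrow> E a n \<noteq> sq (u a) i"
    using diagonalize_many[OF dp, of "\<lambda>a. sq (u a)"] by blast
  have "E a n \<notin> X a" if le: "card_le M (X a) n" for a n
  proof
    assume EX: "E a n \<in> X a"
    obtain m where m: "has_card M (X a) m" "m \<preceq> n" using le unfolding card_le_def le_def by blast
    have in_X: "\<And>i. i \<prec> c a \<Longrightarrow> sq (u a) i \<in> X a"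
      and inj: "\<And>i j. i \<prec> j \<Longrightarrow> j \<prec> c a \<Longrightarrow> sq (u a) i \<noteq> sq (u a) j"
      using u(2)[of a] lt_trans unfolding U_def by (blast, metis lt_irrefl)
    have "c a \<preceq> m" by (rule card_bound[OF m(1) in_X inj])
    then have new: "sq (u a) i \<noteq> E a n" if "i \<prec> c a" for i
      using E(2)[of i n a] that m(2) by (metis A.less_le_trans)
    obtain v where v: "\<And>i. i \<prec> c a \<Longrightarrow> sq v i = sq (u a) i" "sq v (c a) = E a n" using sq_extend by blast
    \<comment> \<open>The value in \<open>X a\<close> missed by the list would extend it to one more
      distinct member than \<open>X a\<close> has.\<close>
    have "c a \<oplus> \<one> \<preceq> c a"
    proof (rule card_bound[OF card])
      show "sq v i \<in> X a" if "i \<prec> c a \<oplus> \<one>" for i using that v in_X EX by (auto simp: lt_Suc)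
      show "sq v i \<noteq> sq v j" if "i \<prec> j" "j \<prec> c a \<oplus> \<one>" for i j
        using that v inj new lt_trans[of j "c a" i] by (auto simp: lt_Suc)
    qed
    then show False by (simp add: Suc_le_iff)
  qed
  then show "\<exists>f. in_model2 M UNIV f \<and> escaping M X f"
    using E(1) unfolding escaping_def in_model2_T by blast
qed

text \<open>The singletons \<open>{h a}\<close> have size \<open>\<one>\<close>, so escaping at
  \<open>n = \<one>\<close> is diagonalizing.\<close>

lemma escaping_imp_diagonalizing:
  assumes "escaping_principle M"
  shows "diagonalizing_principle M"
  unfolding diagonalizing_principle_def
proof (intro allI impI)
  fix h assume h: "Delta_fun M 2 h"
  define X where "X a = {h a}" for a
  have one: "has_card M (X a) \<one>" for a
    unfolding has_card_def
  proof (intro exI conjI)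
    have lt1: "i \<prec> \<one> \<longleftrightarrow> i = \<zero>" for i using lt_Suc[of i \<zero>] by simp
    show "in_model1 M {i. i \<prec> \<one>} (\<lambda>_. h a)" unfolding in_model1_iff mem_Collect_eq
      by (rule d0_rules)+
    show "bij_betw (\<lambda>_. h a) {i. i \<prec> \<one>} (X a)" by (auto simp: X_def lt1 bij_betw_def)
  qed
  have "uniform_Sigma2_finite_family M X"
    unfolding uniform_Sigma2_finite_family_def
  proof
    have "{(e, x). x \<in> X e} = {(x, y). y = h x}" by (auto simp: X_def)
    then show "definable2 M (Sigma_fm 2) {(e, x). x \<in> X e}"
      using h unfolding Delta_fun_def Delta_rel_def by simp
    have "\<forall>x\<in>X a. x \<prec> h a \<oplus> \<one>" for a by (simp add: X_def lt_Suc)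
    then show "\<forall>e. finite_in M (X e)" unfolding finite_in_def by blast
  qed
  moreover have "Fn (Suc (Suc 0)) (\<lambda>_. \<one>)" by (rule Fn_D0[OF T_const])
  then have "sizes_uniformly_Delta2 M X"
    unfolding sizes_uniformly_Delta2_def numeral_2_eq_2 Delta_fun_iff using one by blast
  ultimately obtain f where f: "in_model2 M UNIV f" "escaping M X f"
    using assms unfolding escaping_principle_def by blast
  have "T (\<lambda>e. f (e 0) \<one>)" by (rule T_T2[of f, OF f(1)[unfolded in_model2_T]]) (rule T_var T_const)+
  moreover have "f a \<one> \<noteq> h a" for a
    using f(2) one unfolding escaping_def card_le_def X_def by blast
  ultimately show "\<exists>f. in_model1 M UNIV f \<and> diagonalizing h f"
    unfolding in_model1_T diagonalizing_def by (intro exI[of _ "\<lambda>a. f a \<one>"]) blast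
qed

section \<open>Rainbows from diagonalizing functions\<close>

lemma finite_bounded: "finite B \<Longrightarrow> \<exists>b. \<forall>x\<in>B. x \<prec> b"
proof (induction rule: finite_induct)
  case (insert x B)
  then obtain b where b: "\<forall>y\<in>B. y \<prec> b" by blast
  have "b \<preceq> b \<oplus> x" "x \<preceq> b \<oplus> x" using le_iff_add add_comm by metis+
  then have "\<forall>y\<in>insert x B. y \<prec> b \<oplus> x \<oplus> \<one>"
    unfolding le_Suc_iff using b A.order_trans A.less_imp_le by blast
  then show ?case by blast
qed simp

lemma two_bounded_three:
  assumes "two_bounded M f" "x \<prec> s" "y \<prec> s" "z \<prec> s" "f x s = f y s" "f x s = f z s"
  shows "x = y \<or> x = z \<or> y = z"
proof (rule ccontr)
  assume *: "\<not> ?thesis"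
  let ?F = "{(x', s') \<in> pairs_of M UNIV. f x' s' = f x s}"
  have sub: "{(x, s), (y, s), (z, s)} \<subseteq> ?F" using assms by (auto simp: pairs_of_def)
  have fin: "finite ?F" "card ?F \<le> 2" using assms(1) unfolding two_bounded_def by blast+
  have "card {(x, s), (y, s), (z, s)} \<le> 2" using card_mono[OF fin(1) sub] fin(2) by simp
  then show False using * by simp
qed

lemma two_bounded_eventually:
  assumes "two_bounded M f"
  shows "\<exists>m. \<forall>s. m \<preceq> s \<longrightarrow> (\<forall>x. x \<prec> s \<longrightarrow> f x s \<noteq> y)"
proof -
  let ?F = "{(x', s') \<in> pairs_of M UNIV. f x' s' = y}"
  have "finite ?F" using assms unfolding two_bounded_def by simp
  then have "finite (snd ` ?F)" by (rule finite_imageI)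
  from finite_bounded[OF this] obtain b where b: "\<forall>s\<in>snd ` ?F. s \<prec> b" by (rule exE)
  have "f x s \<noteq> y" if "b \<preceq> s" "x \<prec> s" for x s
  proof
    assume "f x s = y"
    then have "(x, s) \<in> ?F" using that by (simp add: pairs_of_def)
    from b[rule_format, OF imageI[OF this]] have "s \<prec> b" by simp
    then show False using that(1) A.less_le_trans lt_irrefl by blast
  qed
  then show ?thesis by blast
qed

lemma T_coloring:
  assumes "in_model2 M (pairs_of M UNIV) f"
  shows "T (\<lambda>e. if e 0 \<prec> e (Suc 0) then f (e 0) (e (Suc 0)) else \<zero>)"
proof -
  have "D0 (\<lambda>e. e 0 \<prec> e (Suc 0) \<and> e (Suc (Suc 0)) = f (e 0) (e (Suc 0)))"
    using assms unfolding in_model2_iff by (simp add: pairs_of_def)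
  from D0_rel3[of "\<lambda>x s y. x \<prec> s \<and> y = f x s", OF this]
  have f: "T X \<Longrightarrow> T Y \<Longrightarrow> T Z \<Longrightarrow> D0 (\<lambda>e. X e \<prec> Y e \<and> Z e = f (X e) (Y e))" for X Y Z .
  have "D0 (\<lambda>e. (e (Suc 0) \<prec> e (Suc (Suc 0)) \<and> e 0 = f (e (Suc 0)) (e (Suc (Suc 0)))) \<or>
      (\<not> e (Suc 0) \<prec> e (Suc (Suc 0)) \<and> e 0 = \<zero>))"
    by (rule f d0_rules)+
  then show ?thesis by (auto simp: T_def elim!: back_subst[of D0])
qed

text \<open>The limit partner of \<open>x\<close>, or \<open>x\<close> itself if there is none, is a \<open>\<Delta>\<^sup>0\<^sub>2\<close> function of \<open>x\<close>.\<close>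

lemma partner_function:
  assumes f: "in_model2 M (pairs_of M UNIV) f" and tb: "two_bounded M f" and rs: "rainbow_stable M f"
  obtains \<pi> where "Fn (Suc (Suc 0)) \<pi>"
    "\<And>x y. y \<noteq> x \<Longrightarrow> y \<noteq> \<pi> x \<Longrightarrow> \<exists>m. \<forall>s. m \<preceq> s \<longrightarrow> x \<prec> s \<and> y \<prec> s \<and> f x s \<noteq> f y s"
proof -
  define ff where "ff x s = (if x \<prec> s then f x s else \<zero>)" for x s
  have "T (\<lambda>e. ff (e 0) (e (Suc 0)))" using T_coloring[OF f] by (simp add: ff_def)
  note Tff = T_T2[OF this]
  define R where "R x y \<longleftrightarrow>
      (\<exists>m. y \<noteq> x \<and> (\<forall>s. m \<preceq> s \<longrightarrow> x \<prec> s \<and> y \<prec> s \<and> ff x s = ff y s)) \<or>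
      (\<exists>m. y = x \<and> (\<forall>s. m \<preceq> s \<longrightarrow> x \<prec> s \<and> (\<forall>y. y \<prec> s \<longrightarrow> y \<noteq> x \<longrightarrow> ff x s \<noteq> ff y s)))" for x y
  have R: "Sg (Suc (Suc 0)) (\<lambda>e. R (e 0) (e (Suc 0)))" unfolding R_def
    by (rule Sg_or; rule Sg_ex; rule Sg_and; (rule Sg_allD0 | rule Sg_D0)) (rule Tff d0_rules)+
  have "\<exists>y. R x y" for x
  proof -
    have "(\<exists>y. y \<noteq> x \<and> (\<exists>m. \<forall>s. m \<preceq> s \<longrightarrow> x \<prec> s \<and> y \<prec> s \<and> f x s = f y s)) \<or>
       (\<exists>m. \<forall>s. m \<preceq> s \<longrightarrow> x \<prec> s \<and> \<not> (\<exists>y. y \<noteq> x \<and> y \<prec> s \<and> f x s = f y s))"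
      using rs unfolding rainbow_stable_def almost_all_iff by blast
    then show ?thesis
    proof (elim disjE exE conjE)
      fix y m assume "y \<noteq> x" "\<forall>s. m \<preceq> s \<longrightarrow> x \<prec> s \<and> y \<prec> s \<and> f x s = f y s"
      then have "R x y" unfolding R_def ff_def by auto
      then show ?thesis by blast
    next
      fix m assume "\<forall>s. m \<preceq> s \<longrightarrow> x \<prec> s \<and> \<not> (\<exists>y. y \<noteq> x \<and> y \<prec> s \<and> f x s = f y s)"
      then have "R x x" unfolding R_def ff_def by auto
      then show ?thesis by blast
    qed
  qed
  then obtain \<pi> where \<pi>: "Fn (Suc (Suc 0)) \<pi>" "\<And>x. R x (\<pi> x)"
    using uniformize_fun[OF IS_2 R] by blast
  show ?thesis
  proof
    fix x y assume y: "y \<noteq> x" "y \<noteq> \<pi> x"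
    from \<pi>(2)[of x] obtain m where m: "\<forall>s. m \<preceq> s \<longrightarrow> x \<prec> s \<and> (y \<prec> s \<longrightarrow> f x s \<noteq> f y s)"
      unfolding R_def
    proof (elim disjE exE conjE)
      fix m assume ne: "\<pi> x \<noteq> x" and m: "\<forall>s. m \<preceq> s \<longrightarrow> x \<prec> s \<and> \<pi> x \<prec> s \<and> ff x s = ff (\<pi> x) s"
      have "x \<prec> s \<and> (y \<prec> s \<longrightarrow> f x s \<noteq> f y s)" if "m \<preceq> s" for s
      proof -
        have "x \<prec> s" "\<pi> x \<prec> s" "f x s = f (\<pi> x) s" using m that unfolding ff_def by metis+
        then show ?thesis using two_bounded_three[OF tb, of x s "\<pi> x" y] ne y by metis
      qed
      then show ?thesis using that by blast
    next
      fix m assume "\<forall>s. m \<preceq> s \<longrightarrow> x \<prec> s \<and> (\<forall>y. y \<prec> s \<longrightarrow> y \<noteq> x \<longrightarrow> ff x s \<noteq> ff y s)"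
      then have "\<forall>s. m \<preceq> s \<longrightarrow> x \<prec> s \<and> (y \<prec> s \<longrightarrow> f x s \<noteq> f y s)" using y(1) unfolding ff_def by metis
      then show ?thesis using that by blast
    qed
    have "m \<preceq> m \<oplus> y" "y \<preceq> m \<oplus> y" using le_iff_add add_comm by metis+
    then have "x \<prec> s \<and> y \<prec> s \<and> f x s \<noteq> f y s" if "m \<oplus> y \<oplus> \<one> \<preceq> s" for s
      using that m unfolding Suc_le_iff by (metis A.le_less_trans A.less_imp_le)
    then show "\<exists>m. \<forall>s. m \<preceq> s \<longrightarrow> x \<prec> s \<and> y \<prec> s \<and> f x s \<noteq> f y s" by blast
  qed (rule \<pi>)
qed

lemma add_le3: "a \<preceq> a \<oplus> b \<oplus> c" "b \<preceq> a \<oplus> b \<oplus> c" "c \<preceq> a \<oplus> b \<oplus> c"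
  unfolding le_iff_add by (metis add_assoc add_comm)+

lemma diagonalizing_imp_SRRT22:
  assumes dp: "diagonalizing_principle M"
  shows "SRRT22 M"
  unfolding SRRT22_def
proof (intro allI impI)
  fix f assume "in_model2 M (pairs_of M UNIV) f \<and> two_bounded M f \<and> rainbow_stable M f"
  then have f: "in_model2 M (pairs_of M UNIV) f" and tb: "two_bounded M f" and rs: "rainbow_stable M f" by auto
  obtain \<pi> where \<pi>: "Fn (Suc (Suc 0)) \<pi>"
    "\<And>x y. y \<noteq> x \<Longrightarrow> y \<noteq> \<pi> x \<Longrightarrow> \<exists>m. \<forall>s. m \<preceq> s \<longrightarrow> x \<prec> s \<and> y \<prec> s \<and> f x s \<noteq> f y s"
    using partner_function[OF f tb rs] by blast
  define ff where "ff x s = (if x \<prec> s then f x s else \<zero>)" for x s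
  have "T (\<lambda>e. ff (e 0) (e (Suc 0)))" using T_coloring[OF f] by (simp add: ff_def)
  note Tff = T_T2[OF this]
  \<comment> \<open>The parameter is the pair of a list and a threshold \<open>t\<close>. Avoiding
    the partners minus \<open>t\<close> and adding \<open>t\<close> gives a number that is at least
    \<open>t\<close> and no partner: a partner below \<open>t\<close> is avoided anyway.\<close>
  have "Sg (Suc (Suc 0)) (\<lambda>e. \<exists>y. y = \<pi> (sq (fs (e (Suc 0))) (e (Suc (Suc 0)))) \<and> e 0 = y \<ominus> sn (e (Suc 0)))"
    by (rule Sg_ex, rule Sg_and, rule Sg_Fn[OF \<pi>(1)]) (rule Sg_D0 T_sq T_monus d0_rules)+
  then have "Sg (Suc (Suc 0)) (\<lambda>e. e 0 = \<pi> (sq (fs (e (Suc 0))) (e (Suc (Suc 0)))) \<ominus> sn (e (Suc 0)))"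
    by (simp del: Sg.simps)
  then obtain E where E0: "T (\<lambda>e. E (e 0) (e (Suc 0)))"
    and E1: "\<And>a n i. i \<prec> n \<Longrightarrow> E a n \<noteq> \<pi> (sq (fs a) i) \<ominus> sn a"
    using diagonalize_many[OF dp, of "\<lambda>a i. \<pi> (sq (fs a) i) \<ominus> sn a"] by blast
  note TE = T_T2[OF E0]
  have E: "t \<oplus> E (pr u t) n \<noteq> \<pi> (sq u i)" if "i \<prec> n" for t u n i
    using E1[OF that, of "pr u t"] monus_eq[of t] by (metis fs_pr sn_pr)
  define K where "K n u y \<longleftrightarrow>
     (\<exists>v. \<exists>t. (\<forall>j. j \<prec> n \<longrightarrow> sq v j = sq u j) \<and> y = t \<oplus> E (pr v t) n) \<and>
     (\<forall>j. j \<prec> n \<longrightarrow> sq u j \<prec> y) \<and>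
     (\<forall>i. i \<prec> n \<longrightarrow> (\<forall>j. j \<prec> n \<longrightarrow> i \<prec> j \<longrightarrow> ff (sq u i) y \<noteq> ff (sq u j) y)) \<and>
     (\<forall>i. i \<prec> n \<longrightarrow> (\<forall>j. j \<prec> n \<longrightarrow> (\<forall>l. l \<prec> n \<longrightarrow> sq u i \<prec> sq u j \<longrightarrow> ff (sq u l) y \<noteq> ff (sq u i) (sq u j))))"
    for n u y
  have K: "Sg (Suc 0) (\<lambda>e. K (e 0) (e (Suc 0)) (e (Suc (Suc 0))))" unfolding K_def
    by (rule Sg_and, rule Sg_ex, rule Sg_ex, rule Sg_D0, (rule Tff TE T_sq d0_rules)+, rule Sg_D0)
      (rule Tff TE T_sq d0_rules)+
  have ext: "K n v y" if "K n u y" and eq: "\<And>j. j \<prec> n \<Longrightarrow> sq v j = sq u j" for n u v y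
    using that(1) unfolding K_def by (simp add: eq cong: conj_cong imp_cong)
  have ex: "\<exists>y. K n u y" if hist: "\<And>i. i \<prec> n \<Longrightarrow> K i u (sq u i)" for n u
  proof -
    \<comment> \<open>The certificate of the later entry was made for a history containing
      \<open>sq u i\<close>, so the later entry is not its partner.\<close>
    have ev: "\<exists>m. \<forall>s. m \<preceq> s \<longrightarrow> ff (sq u i) s \<noteq> ff (sq u j) s" if "i \<prec> j" "j \<prec> n" for i j
    proof -
      have "K j u (sq u j)" using hist that by blast
      then have "sq u i \<prec> sq u j" "sq u j \<noteq> \<pi> (sq u i)"
        using that(1) E unfolding K_def by (blast, metis)
      then have "sq u j \<noteq> sq u i" "sq u j \<noteq> \<pi> (sq u i)" by auto
      from \<pi>(2)[OF this] show ?thesis unfolding ff_def by auto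
    qed
    have D: "D0 (\<lambda>e. e 0 \<prec> e (Suc 0) \<longrightarrow> ff (sq u (e 0)) (e (Suc (Suc 0))) \<noteq> ff (sq u (e (Suc 0))) (e (Suc (Suc 0))))"
      by (rule Tff T_sq d0_rules)+
    note Dr = D0_rel3[of "\<lambda>i j s. i \<prec> j \<longrightarrow> ff (sq u i) s \<noteq> ff (sq u j) s", OF D]
    have "\<exists>m. \<forall>s. m \<preceq> s \<longrightarrow> (\<forall>i. i \<prec> n \<longrightarrow> (\<forall>j. j \<prec> n \<longrightarrow> i \<prec> j \<longrightarrow> ff (sq u i) s \<noteq> ff (sq u j) s))"
    proof (rule eventually_bounded[OF IS_2])
      show "D0 (\<lambda>e. \<forall>j. j \<prec> n \<longrightarrow> e 0 \<prec> j \<longrightarrow> ff (sq u (e 0)) (e (Suc 0)) \<noteq> ff (sq u j) (e (Suc 0)))"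
        by (rule Tff T_sq d0_rules)+
      show "\<exists>m. \<forall>s. m \<preceq> s \<longrightarrow> (\<forall>j. j \<prec> n \<longrightarrow> i \<prec> j \<longrightarrow> ff (sq u i) s \<noteq> ff (sq u j) s)" if "i \<prec> n" for i
      proof (rule eventually_bounded[OF IS_2])
        show "D0 (\<lambda>e. i \<prec> e 0 \<longrightarrow> ff (sq u i) (e (Suc 0)) \<noteq> ff (sq u (e 0)) (e (Suc 0)))"
          by (rule Tff T_sq d0_rules)+
      qed (use ev in blast)
    qed
    then obtain m1 where m1: "\<And>s i j. m1 \<preceq> s \<Longrightarrow> i \<prec> j \<Longrightarrow> i \<prec> n \<Longrightarrow> j \<prec> n \<Longrightarrow> ff (sq u i) s \<noteq> ff (sq u j) s"
      by blast
    have le_u: "sq u l \<prec> s" if "u \<oplus> \<one> \<preceq> s" for l s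
      using sq_le[of u l] that A.le_less_trans unfolding Suc_le_iff by blast
    have col: "\<exists>m. \<forall>s. m \<preceq> s \<longrightarrow> (\<forall>l. l \<prec> n \<longrightarrow> ff (sq u l) s \<noteq> y)" for y
    proof -
      obtain m where m: "\<And>s x. m \<preceq> s \<Longrightarrow> x \<prec> s \<Longrightarrow> f x s \<noteq> y" using two_bounded_eventually[OF tb] by blast
      have "ff (sq u l) s \<noteq> y" if s: "m \<oplus> (u \<oplus> \<one>) \<preceq> s" for s l
      proof -
        have "m \<preceq> s" "u \<oplus> \<one> \<preceq> s"
          using s le_iff_add[of m "m \<oplus> (u \<oplus> \<one>)"] le_iff_add[of "u \<oplus> \<one>" "m \<oplus> (u \<oplus> \<one>)"] add_comm A.order_trans by metis+
        then show ?thesis using m[of s "sq u l"] le_u[of s l] by (simp add: ff_def)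
      qed
      then show ?thesis by blast
    qed
    have "\<exists>m. \<forall>s. m \<preceq> s \<longrightarrow> (\<forall>i. i \<prec> n \<longrightarrow> (\<forall>j. j \<prec> n \<longrightarrow> (\<forall>l. l \<prec> n \<longrightarrow> sq u i \<prec> sq u j \<longrightarrow>
        ff (sq u l) s \<noteq> ff (sq u i) (sq u j))))"
    proof (rule eventually_bounded[OF IS_2])
      show "D0 (\<lambda>e. \<forall>j. j \<prec> n \<longrightarrow> (\<forall>l. l \<prec> n \<longrightarrow> sq u (e 0) \<prec> sq u j \<longrightarrow>
          ff (sq u l) (e (Suc 0)) \<noteq> ff (sq u (e 0)) (sq u j)))"
        by (rule Tff T_sq d0_rules)+
      show "\<exists>m. \<forall>s. m \<preceq> s \<longrightarrow> (\<forall>j. j \<prec> n \<longrightarrow> (\<forall>l. l \<prec> n \<longrightarrow> sq u i \<prec> sq u j \<longrightarrow>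
          ff (sq u l) s \<noteq> ff (sq u i) (sq u j)))" for i
      proof (rule eventually_bounded[OF IS_2])
        show "D0 (\<lambda>e. \<forall>l. l \<prec> n \<longrightarrow> sq u i \<prec> sq u (e 0) \<longrightarrow> ff (sq u l) (e (Suc 0)) \<noteq> ff (sq u i) (sq u (e 0)))"
          by (rule Tff T_sq d0_rules)+
      qed (use col in blast)
    qed
    then obtain m2 where m2: "\<And>s i j l. m2 \<preceq> s \<Longrightarrow> i \<prec> n \<Longrightarrow> j \<prec> n \<Longrightarrow> l \<prec> n \<Longrightarrow> sq u i \<prec> sq u j \<Longrightarrow>
        ff (sq u l) s \<noteq> ff (sq u i) (sq u j)" by blast
    \<comment> \<open>Beyond the thresholds of both colour clauses and, as \<open>u\<close> bounds
      its entries, beyond the list itself.\<close>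
    define t where "t = m1 \<oplus> m2 \<oplus> (u \<oplus> \<one>)"
    define y where "y = t \<oplus> E (pr u t) n"
    have "t \<preceq> y" unfolding y_def le_iff_add by blast
    then have y: "m1 \<preceq> y" "m2 \<preceq> y" "u \<oplus> \<one> \<preceq> y" unfolding t_def using add_le3 A.order_trans by blast+
    have "K n u y" unfolding K_def
    proof (intro conjI)
      show "\<exists>v t. (\<forall>j. j \<prec> n \<longrightarrow> sq v j = sq u j) \<and> y = t \<oplus> E (pr v t) n"
        by (rule exI[of _ u], rule exI[of _ t]) (simp add: y_def)
    qed (use le_u[OF y(3)] m1[OF y(1)] m2[OF y(2)] in blast)+
    then show ?thesis by blast
  qed
  have "\<exists>F. Fn (Suc 0) F \<and> (\<forall>n u. (\<forall>j. j \<prec> n \<longrightarrow> sq u j = F j) \<longrightarrow> K n u (F n))"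
    by (rule dependent_choice[OF IS_1 K]) (erule ext, assumption, rule ex, assumption)
  then obtain F where F: "Fn (Suc 0) F" "\<And>n u. (\<And>j. j \<prec> n \<Longrightarrow> sq u j = F j) \<Longrightarrow> K n u (F n)"
    by blast
  note TF = T_T1[OF Fn_T[OF F(1)]]
  have codeF: "\<exists>u. \<forall>j. j \<prec> n \<longrightarrow> sq u j = F j" for n
    by (rule choice_D0[of "\<lambda>j y. y = F j"], (rule TF d0_rules)+, blast)
  have F_lt: "F i \<prec> F n" if "i \<prec> n" for i n
  proof -
    obtain u where u: "\<And>j. j \<prec> n \<Longrightarrow> sq u j = F j" using codeF by blast
    show ?thesis using F(2)[OF u] that u unfolding K_def by metis
  qed
  have F_ge: "n \<preceq> F n" for n
  proof (induction n rule: D0_induct)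
    case D0 show ?case by (rule TF d0_rules)+
  next
    case (Suc n) then show ?case using F_lt[of n "n \<oplus> \<one>"] unfolding Suc_le_iff
      by (metis A.le_less_trans lt_Suc)
  qed simp
  have F_less: "i \<prec> j" if "F i \<prec> F j" for i j
    using that F_lt[of j i] lt_trans[of "F j" "F i" "F i"] lt_linear[of i j] by auto
  have colA: "ff (F i) (F n) \<noteq> ff (F j) (F n)" if "i \<prec> j" "j \<prec> n" for i j n
  proof -
    obtain u where u: "\<And>j. j \<prec> n \<Longrightarrow> sq u j = F j" using codeF by blast
    have "ff (sq u i) (F n) \<noteq> ff (sq u j) (F n)"
      using F(2)[OF u] that lt_trans[OF that(2,1)] unfolding K_def by blast
    then show ?thesis using u[OF that(2)] u[OF lt_trans[OF that(2,1)]] by simp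
  qed
  have colB: "ff (F l) (F n) \<noteq> ff (F i) (F j)" if "i \<prec> j" "j \<prec> n" "l \<prec> n" for i j l n
  proof -
    obtain u where u: "\<And>j. j \<prec> n \<Longrightarrow> sq u j = F j" using codeF by blast
    note i = lt_trans[OF that(2,1)]
    have "sq u i \<prec> sq u j" using F_lt[OF that(1)] u[OF that(2)] u[OF i] by simp
    then have "ff (sq u l) (F n) \<noteq> ff (sq u i) (sq u j)"
      using F(2)[OF u] that i unfolding K_def by blast
    then show ?thesis using u[OF that(2)] u[OF that(3)] u[OF i] by simp
  qed
  \<comment> \<open>Since \<open>i \<preceq> F i\<close>, membership in the range is decided by a
    bounded search.\<close>
  have "D0 (\<lambda>e. \<exists>i. i \<preceq> e 0 \<and> e 0 = F i)" by (rule TF d0_rules)+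
  from set_in_model[of "\<lambda>x. \<exists>i. i \<preceq> x \<and> x = F i", OF this]
  have "range F \<in> S" using F_ge by (auto elim!: back_subst[of "\<lambda>A. A \<in> S"])
  moreover have "\<not> finite_in M (range F)"
    unfolding finite_in_def using F_ge by (metis A.not_less rangeI)
  moreover have "rainbow M f (range F)"
    unfolding rainbow_def inj_on_def
  proof (clarify)
    fix a s b t assume "(a, s) \<in> pairs_of M (range F)" "(b, t) \<in> pairs_of M (range F)" and eq: "f a s = f b t"
    then obtain i j k l where F: "a = F i" "s = F j" "b = F k" "t = F l" and "F i \<prec> F j" "F k \<prec> F l"
      by (auto simp: pairs_of_def)
    then have lt: "i \<prec> j" "k \<prec> l" using F_less by auto
    have eq': "ff (F i) (F j) = ff (F k) (F l)" using eq F F_lt[OF lt(1)] F_lt[OF lt(2)] by (simp add: ff_def)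
    \<comment> \<open>For different columns, \<open>colB\<close> at the larger one separates the
      colours; within one column \<open>colA\<close> does.\<close>
    have "j = l" using lt_linear[of j l] colB[OF lt(1), of l k] colB[OF lt(2), of j i] lt eq' by auto
    moreover have "i = k" using lt_linear[of i k] colA[of i k j] colA[of k i j] lt eq' calculation by auto
    ultimately show "a = b \<and> s = t" using F by simp
  qed
  ultimately show "\<exists>R\<in>S. \<not> finite_in M R \<and> rainbow M f R" by blast
qed

section \<open>Diagonalizing functions from rainbows\<close>

lemma double_less: "d \<prec> e \<Longrightarrow> d \<oplus> d \<oplus> \<one> \<prec> e \<oplus> e"
proof -
  assume "d \<prec> e"
  then have "(d \<oplus> \<one>) \<oplus> (d \<oplus> \<one>) \<preceq> e \<oplus> e" by (intro A.add_mono) (simp_all add: Suc_le_iff)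
  moreover have "(d \<oplus> \<one>) \<oplus> (d \<oplus> \<one>) = d \<oplus> d \<oplus> \<one> \<oplus> \<one>" by (simp only: add_assoc add_comm add_left_comm)
  ultimately show ?thesis by (simp add: Suc_le_iff)
qed

lemma double_less': "d \<prec> e \<Longrightarrow> d \<oplus> d \<prec> e \<oplus> e"
  using double_less[of d e] lt_trans[of "d \<oplus> d \<oplus> \<one>" "e \<oplus> e" "d \<oplus> d"] by (simp add: lt_Suc)

lemma parity_unique: "d \<oplus> d \<noteq> e \<oplus> e \<oplus> \<one>" "d \<oplus> d = e \<oplus> e \<longleftrightarrow> d = e"
proof -
  show "d \<oplus> d \<noteq> e \<oplus> e \<oplus> \<one>"
  proof
    assume eq: "d \<oplus> d = e \<oplus> e \<oplus> \<one>"
    consider "d \<prec> e" | "d = e" | "e \<prec> d" using lt_linear by blast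
    then show False
    proof cases
      case 1
      then have "d \<oplus> d \<prec> e \<oplus> e \<oplus> \<one>" using double_less' by (simp add: lt_Suc)
      then show False using eq by simp
    next
      case 2
      then have "e \<oplus> e \<prec> e \<oplus> e" using eq lt_Suc[of "e \<oplus> e" "e \<oplus> e"] by simp
      then show False by simp
    next
      case 3 then show False using double_less[of e d] eq by simp
    qed
  qed
  show "d \<oplus> d = e \<oplus> e \<longleftrightarrow> d = e"
    using lt_linear[of d e] double_less'[of d e] double_less'[of e d] by auto
qed

lemma parity: "\<exists>e. e \<preceq> n \<and> (n = e \<oplus> e \<or> n = e \<oplus> e \<oplus> \<one>)"
proof (induction n rule: D0_induct)
  case D0 show ?case by (rule d0_rules)+
next
  case zero show ?case by (rule exI[of _ \<zero>]) simp
next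
  case (Suc n)
  then obtain e where e: "e \<preceq> n" "n = e \<oplus> e \<or> n = e \<oplus> e \<oplus> \<one>" by blast
  from e(2) show ?case
  proof
    assume "n = e \<oplus> e" then show ?thesis using e(1) by (intro exI[of _ e]) (auto simp: le_def lt_Suc)
  next
    assume "n = e \<oplus> e \<oplus> \<one>"
    then have "n \<oplus> \<one> = (e \<oplus> \<one>) \<oplus> (e \<oplus> \<one>)" by (simp only: add_assoc add_comm add_left_comm)
    then show ?thesis using e(1) by (intro exI[of _ "e \<oplus> \<one>"]) simp
  qed
qed

text \<open>The indices start at \<open>n\<close> because the \<open>i\<close>-th entry of an
  increasing enumeration is at least \<open>i\<close>, so that a coded initial segment of a rainbow
  passes the test. They end at \<open>2 n\<close> to offer more entries than there are earlier
  choices.\<close>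

definition good_window :: "'a \<Rightarrow> 'a \<Rightarrow> bool" where
  "good_window d n \<longleftrightarrow> (\<forall>i. i \<preceq> n \<oplus> n \<longrightarrow> n \<preceq> i \<longrightarrow> n \<preceq> sq d i) \<and>
     (\<forall>j. j \<preceq> n \<oplus> n \<longrightarrow> (\<forall>i. i \<prec> j \<longrightarrow> n \<preceq> i \<longrightarrow> sq d i \<noteq> sq d j))"

lemma D0_good_window: "T F \<Longrightarrow> T G \<Longrightarrow> D0 (\<lambda>e. good_window (F e) (G e))"
proof -
  have "D0 (\<lambda>e. good_window (e 0) (e (Suc 0)))" unfolding good_window_def by (rule T_sq d0_rules)+
  then show "T F \<Longrightarrow> T G \<Longrightarrow> D0 (\<lambda>e. good_window (F e) (G e))" by (rule D0_rel2)
qed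

text \<open>The window has \<open>n \<oplus> \<one>\<close> entries, so one of them avoids the \<open>n\<close> earlier choices.\<close>

lemma window_fresh:
  assumes "good_window d n"
  shows "\<exists>i. i \<preceq> n \<oplus> n \<and> n \<preceq> i \<and> (\<forall>j. j \<prec> n \<longrightarrow> sq u j \<noteq> sq d i)"
proof (rule ccontr)
  assume no: "\<not> ?thesis"
  have "\<exists>j. j \<prec> n \<and> sq u j = sq d (n \<oplus> i)" if "i \<prec> n \<oplus> \<one>" for i
    using no that le_iff_add[of n "n \<oplus> i"] unfolding le_Suc_iff by (metis A.add_left_mono)
  moreover have "D0 (\<lambda>e. e (Suc 0) \<prec> n \<and> sq u (e (Suc 0)) = sq d (n \<oplus> e 0))" by (rule T_sq d0_rules)+
  ultimately obtain w where w: "\<And>i. i \<preceq> n \<Longrightarrow> sq w i \<prec> n \<and> sq u (sq w i) = sq d (n \<oplus> i)"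
    using choice_D0[of "\<lambda>i j. j \<prec> n \<and> sq u j = sq d (n \<oplus> i)" "n \<oplus> \<one>"] unfolding le_Suc_iff by blast
  then obtain i j where ij: "i \<prec> j" "j \<preceq> n" "sq w i = sq w j" using pigeonhole[of n w] by blast
  then have "i \<preceq> n" by (meson A.less_imp_le A.order_trans)
  then have "sq d (n \<oplus> i) = sq d (n \<oplus> j)" using w ij by metis
  moreover have "n \<oplus> i \<prec> n \<oplus> j" "n \<oplus> j \<preceq> n \<oplus> n" "n \<preceq> n \<oplus> i"
    using ij lt_add_mono A.add_left_mono le_iff_add[of n "n \<oplus> i"] by auto
  ultimately show False using assms unfolding good_window_def by blast
qed

text \<open>A good window has room for a fresh entry whatever the earlier choices were, so no choice
  is ever revised. The step relation is Sigma_2 through \<open>d = h e\<close>; its other clauses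
  are in \<open>D0\<close>.\<close>

lemma fresh_sequence:
  assumes h: "Fn (Suc (Suc 0)) h"
  obtains q where "Fn (Suc (Suc 0)) q" "\<And>n. n \<preceq> q n" "\<And>i n. i \<prec> n \<Longrightarrow> q i \<noteq> q n"
    "\<And>e n. n = e \<oplus> e \<or> n = e \<oplus> e \<oplus> \<one> \<Longrightarrow> good_window (h e) n \<Longrightarrow> \<exists>i. i \<preceq> n \<oplus> n \<and> q n = sq (h e) i"
proof -
  define K where "K n u y \<longleftrightarrow> (\<exists>e d. d = h e \<and> (n = e \<oplus> e \<or> n = e \<oplus> e \<oplus> \<one>) \<and> n \<preceq> y \<and>
      (\<forall>j. j \<prec> n \<longrightarrow> sq u j \<noteq> y) \<and> (good_window d n \<longrightarrow> (\<exists>i. i \<preceq> n \<oplus> n \<and> y = sq d i)))" for n u y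
  have K: "Sg (Suc (Suc 0)) (\<lambda>e. K (e 0) (e (Suc 0)) (e (Suc (Suc 0))))" unfolding K_def
    by (rule Sg_ex, rule Sg_ex, rule Sg_and, rule Sg_Fn[OF h], rule T_var, rule T_var, rule Sg_D0)
      (rule D0_good_window T_sq d0_rules)+
  have ext: "K n v y" if "K n u y" and eq: "\<And>j. j \<prec> n \<Longrightarrow> sq v j = sq u j" for n u v y
    using that(1) unfolding K_def by (simp add: eq cong: conj_cong imp_cong)
  have ex: "\<exists>y. K n u y" for n u
  proof -
    obtain e where e: "n = e \<oplus> e \<or> n = e \<oplus> e \<oplus> \<one>" using parity by blast
    show ?thesis
    proof (cases "good_window (h e) n")
      case True
      then obtain i where i: "i \<preceq> n \<oplus> n" "n \<preceq> i" "\<forall>j. j \<prec> n \<longrightarrow> sq u j \<noteq> sq (h e) i"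
        using window_fresh by blast
      then have "n \<preceq> sq (h e) i" using True unfolding good_window_def by blast
      then have "K n u (sq (h e) i)" using e i unfolding K_def by blast
      then show ?thesis by blast
    next
      case False
      \<comment> \<open>Above \<open>n\<close> and above every entry of \<open>u\<close>, this is a
        fresh value when the window is bad.\<close>
      have "n \<preceq> n \<oplus> (u \<oplus> \<one>)" "u \<oplus> \<one> \<preceq> n \<oplus> (u \<oplus> \<one>)" unfolding le_iff_add using add_comm by blast+
      moreover have "sq u j \<noteq> n \<oplus> (u \<oplus> \<one>)" for j
        using calculation(2) sq_le[of u j] unfolding Suc_le_iff by (metis A.le_less_trans lt_irrefl)
      ultimately have "K n u (n \<oplus> (u \<oplus> \<one>))" using e False unfolding K_def by blast
      then show ?thesis by blast
    qed
  qed
  have "\<exists>F. Fn (Suc (Suc 0)) F \<and> (\<forall>n u. (\<forall>j. j \<prec> n \<longrightarrow> sq u j = F j) \<longrightarrow> K n u (F n))"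
    by (rule dependent_choice[OF IS_2 K]) (erule ext, assumption, rule ex)
  then obtain q where q: "Fn (Suc (Suc 0)) q" "\<And>n u. (\<And>j. j \<prec> n \<Longrightarrow> sq u j = q j) \<Longrightarrow> K n u (q n)"
    by blast
  have Sq: "Sg (Suc (Suc 0)) (\<lambda>e. e (Suc 0) = q (e 0))" by (rule Sg_Fn[OF q(1)]) (rule T_var)+
  have Kq: "\<exists>u. (\<forall>j. j \<prec> n \<longrightarrow> sq u j = q j) \<and> K n u (q n)" for n
    using choice[OF IS_2, of "\<lambda>j y. y = q j" n, OF Sq] q(2) by blast
  show ?thesis
  proof
    show "n \<preceq> q n" for n using Kq[of n] unfolding K_def by blast
    show "q i \<noteq> q n" if "i \<prec> n" for i n using Kq[of n] that unfolding K_def by metis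
    show "\<exists>i. i \<preceq> n \<oplus> n \<and> q n = sq (h e) i" if n: "n = e \<oplus> e \<or> n = e \<oplus> e \<oplus> \<one>" and gw: "good_window (h e) n" for e n
    proof -
      obtain u e' where *: "n = e' \<oplus> e' \<or> n = e' \<oplus> e' \<oplus> \<one>"
        "good_window (h e') n \<longrightarrow> (\<exists>i. i \<preceq> n \<oplus> n \<and> q n = sq (h e') i)"
        using Kq[of n] unfolding K_def by blast
      have "e' = e" using n *(1) parity_unique add_one_inj by metis
      then show ?thesis using gw *(2) by blast
    qed
  qed (rule q(1))
qed

text \<open>Some increasing sequence of members is enough. A next member exists since
  \<open>u\<close> bounds its entries and \<open>R\<close> is unbounded.\<close>

lemma enumerate_infinite:
  assumes "R \<in> S" "\<not> finite_in M R"
  obtains F where "T (\<lambda>e. F (e 0))" "\<And>i. F i \<in> R" "\<And>i j. i \<prec> j \<Longrightarrow> F i \<prec> F j" "\<And>i. i \<preceq> F i"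
proof -
  define K where "K n u y \<longleftrightarrow> y \<in> R \<and> (\<forall>j. j \<prec> n \<longrightarrow> sq u j \<prec> y)" for n u y
  have K: "Sg (Suc 0) (\<lambda>e. K (e 0) (e (Suc 0)) (e (Suc (Suc 0))))" unfolding K_def
    by (rule Sg_D0) (rule T_sq d0_rules assms(1))+
  have ext: "K n v y" if "K n u y" and eq: "\<And>j. j \<prec> n \<Longrightarrow> sq v j = sq u j" for n u v y
    using that(1) unfolding K_def by (simp add: eq)
  have ex: "\<exists>y. K n u y" for n u
  proof -
    obtain y where "y \<in> R" "\<not> y \<prec> u \<oplus> \<one>" using assms(2) unfolding finite_in_def by blast
    then have "K n u y" using sq_le[of u] unfolding K_def le_Suc_iff not_le by (metis A.le_less_trans)
    then show ?thesis by blast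
  qed
  have "\<exists>F. Fn (Suc 0) F \<and> (\<forall>n u. (\<forall>j. j \<prec> n \<longrightarrow> sq u j = F j) \<longrightarrow> K n u (F n))"
    by (rule dependent_choice[OF IS_1 K]) (erule ext, assumption, rule ex)
  then obtain F where F: "Fn (Suc 0) F" "\<And>n u. (\<And>j. j \<prec> n \<Longrightarrow> sq u j = F j) \<Longrightarrow> K n u (F n)"
    by blast
  note TF = T_T1[OF Fn_T[OF F(1)]]
  have codeF: "\<exists>u. \<forall>j. j \<prec> n \<longrightarrow> sq u j = F j" for n
    by (rule choice_D0[of "\<lambda>j y. y = F j"], (rule TF d0_rules)+, blast)
  have mono: "F i \<prec> F n" if "i \<prec> n" for i n
    using F(2) codeF[of n] that unfolding K_def by metis
  show ?thesis
  proof
    show "F i \<in> R" for i using F(2) codeF[of i] unfolding K_def by blast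
    show "n \<preceq> F n" for n
    proof (induction n rule: D0_induct)
      case D0 show ?case by (rule TF d0_rules)+
    next
      case (Suc n) then show ?case using mono[of n "n \<oplus> \<one>"] unfolding Suc_le_iff
        by (metis A.le_less_trans lt_Suc)
    qed simp
  qed (rule Fn_T[OF F(1)], rule mono)
qed

text \<open>At stage \<open>s\<close> the pair \<open>(A (2 e) s, A (2 e + 1) s)\<close> is matched unless it meets an earlier pair;
  the conditions \<open>e \<preceq> x\<close>, \<open>e \<preceq> y\<close> let only finitely many \<open>e\<close> act on a given number.\<close>

definition matched :: "('a \<Rightarrow> 'a \<Rightarrow> 'a) \<Rightarrow> 'a \<Rightarrow> 'a \<Rightarrow> 'a \<Rightarrow> 'a \<Rightarrow> bool" where
  "matched A e s x y \<longleftrightarrow> x = A (e \<oplus> e) s \<and> y = A (e \<oplus> e \<oplus> \<one>) s \<and> x \<noteq> y \<and> e \<preceq> x \<and> e \<preceq> y \<and>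
     (\<forall>d. d \<prec> e \<longrightarrow> A (d \<oplus> d) s \<noteq> x \<and> A (d \<oplus> d) s \<noteq> y \<and> A (d \<oplus> d \<oplus> \<one>) s \<noteq> x \<and> A (d \<oplus> d \<oplus> \<one>) s \<noteq> y)"

lemma matched_disjoint:
  assumes "matched A e s x y" "matched A e' s x' y'" "x = x' \<or> x = y' \<or> y = x' \<or> y = y'"
  shows "e = e'"
  using assms lt_linear[of e e'] unfolding matched_def by metis

text \<open>The colour of \<open>x\<close> at stage \<open>s\<close> will be the pair of this
  representative and \<open>s\<close>: a matched pair is represented by its first member, any other
  number by itself.\<close>

definition rep :: "('a \<Rightarrow> 'a \<Rightarrow> 'a) \<Rightarrow> 'a \<Rightarrow> 'a \<Rightarrow> 'a" where
  "rep A s x = (if \<exists>e w. matched A e s w x then (THE w. \<exists>e. matched A e s w x) else x)"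

lemma rep_matched: "matched A e s w x \<Longrightarrow> rep A s x = w"
proof -
  assume m: "matched A e s w x"
  have "(THE w. \<exists>e. matched A e s w x) = w"
  proof (rule the_equality)
    fix w' assume "\<exists>e. matched A e s w' x"
    then obtain e' where m': "matched A e' s w' x" by blast
    then have "e = e'" using matched_disjoint[OF m m'] by simp
    then show "w' = w" using m m' unfolding matched_def by simp
  qed (use m in blast)
  then show ?thesis using m unfolding rep_def by auto
qed

lemma rep_unmatched: "(\<And>e w. \<not> matched A e s w x) \<Longrightarrow> rep A s x = x"
  by (simp add: rep_def)

text \<open>The search is bounded, since a pair matched at \<open>x\<close> has index at most
  \<open>x\<close> and its first member is \<open>A (e \<oplus> e) s\<close>. So the colouring is
  computable.\<close>

lemma rep_graph: "y = rep A s x \<longleftrightarrow> (\<exists>e. e \<preceq> x \<and> matched A e s y x) \<or>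
    (\<not> (\<exists>e. e \<preceq> x \<and> matched A e s (A (e \<oplus> e) s) x)) \<and> y = x"
proof (cases "\<exists>e w. matched A e s w x")
  case True
  then obtain e w where m: "matched A e s w x" by blast
  have "e \<preceq> x" "w = A (e \<oplus> e) s" using m unfolding matched_def by auto
  then show ?thesis using m rep_matched by metis
next
  case False then show ?thesis using rep_unmatched[of A s x] by auto
qed

text \<open>A colour determines the stage and the representative \<open>z\<close>; only
  \<open>z\<close> itself and the number matched with it can have that colour.\<close>

lemma rep_two_bounded: "two_bounded M (\<lambda>x s. pr (rep A s x) s)"
  unfolding two_bounded_def
proof
  fix y
  let ?F = "{(x, s) \<in> pairs_of M UNIV. pr (rep A s x) s = y}"
  define z where "z = fs y"
  define s0 where "s0 = sn y"
  define b where "b = (SOME b. \<exists>e. matched A e s0 z b)"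
  have b: "x = b" if m: "matched A e s0 z x" for e x
  proof -
    have "\<exists>e. matched A e s0 z b" unfolding b_def using m by (metis (mono_tags) someI)
    then obtain e' where m': "matched A e' s0 z b" by blast
    then have "e = e'" using matched_disjoint[OF m m'] by simp
    then show ?thesis using m m' unfolding matched_def by simp
  qed
  have sub: "?F \<subseteq> {(z, s0), (b, s0)}"
  proof
    fix p assume "p \<in> ?F"
    then obtain x s where p: "p = (x, s)" and y: "y = pr (rep A s x) s" by auto
    then have s: "s = s0" and r: "rep A s0 x = z" by (auto simp: z_def s0_def)
    show "p \<in> {(z, s0), (b, s0)}"
    proof (cases "\<exists>e w. matched A e s0 w x")
      case True
      then obtain e w where "matched A e s0 w x" by blast
      then have "matched A e s0 z x" using rep_matched r by metis
      then have "x = b" by (rule b)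
      then show ?thesis using p s by simp
    next
      case False then show ?thesis using rep_unmatched[of A s0 x] p r s by auto
    qed
  qed
  have "card {(z, s0), (b, s0)} \<le> 2" by (simp add: card_insert_if)
  moreover have "card ?F \<le> card {(z, s0), (b, s0)}" by (rule card_mono[OF _ sub]) simp
  moreover have "finite ?F" by (rule finite_subset[OF sub]) simp
  ultimately show "finite ?F \<and> card ?F \<le> 2" by simp
qed

lemma in_model_rep:
  assumes "T (\<lambda>e. A (e 0) (e (Suc 0)))"
  shows "in_model2 M (pairs_of M UNIV) (\<lambda>x s. pr (rep A s x) s)"
proof -
  note TA = T_T2[of A, OF assms]
  have "D0 (\<lambda>e. e 0 = rep A (e (Suc 0)) (e (Suc (Suc 0))))"
    unfolding rep_graph matched_def by (rule TA d0_rules)+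
  then have "T (\<lambda>e. rep A (e 0) (e (Suc 0)))" by (simp add: T_def)
  note Tr = T_T2[of "rep A", OF this]
  show ?thesis unfolding in_model2_iff pairs_of_def mem_Collect_eq prod.case
    by (simp only: UNIV_I simp_thms, (rule Tr d0_rules)+)
qed

section \<open>The colouring obtained from a Delta_2 sequence\<close>

context
  fixes q :: "'a \<Rightarrow> 'a" and A :: "'a \<Rightarrow> 'a \<Rightarrow> 'a"
  assumes q: "Fn (Suc (Suc 0)) q" "\<And>n. n \<preceq> q n" "\<And>i n. i \<prec> n \<Longrightarrow> q i \<noteq> q n"
    and A: "T (\<lambda>e. A (e 0) (e (Suc 0)))" "\<And>x. \<exists>m. \<forall>s. m \<preceq> s \<longrightarrow> A x s = q x"
begin

lemma stage_agrees: "\<exists>m. \<forall>s. m \<preceq> s \<longrightarrow> (\<forall>k. k \<prec> n \<longrightarrow> A k s = q k)"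
proof -
  have "Sg (Suc (Suc 0)) (\<lambda>e. e (Suc 0) = q (e 0))" by (rule Sg_Fn[OF q(1)]) (rule T_var)+
  \<comment> \<open>\<open>eventually_bounded\<close> works with a \<open>D0\<close> predicate, so
    the Delta_2 values \<open>q k\<close> are first replaced by the entries of a code.\<close>
  then obtain c where c: "\<And>k. k \<prec> n \<Longrightarrow> sq c k = q k"
    using choice[OF IS_2, of "\<lambda>j y. y = q j" n] by blast
  have D: "D0 (\<lambda>e. A (e 0) (e (Suc 0)) = sq c (e 0))" by (rule T_T2[of A, OF A(1)] T_sq d0_rules)+
  have "\<exists>m. \<forall>s. m \<preceq> s \<longrightarrow> A k s = sq c k" if "k \<prec> n" for k using A(2)[of k] c[OF that] by simp
  from eventually_bounded[OF IS_2, of "\<lambda>k s. A k s = sq c k", OF D this]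
  obtain m where "\<And>s k. m \<preceq> s \<Longrightarrow> k \<prec> n \<Longrightarrow> A k s = sq c k" by blast
  then show ?thesis using c by (intro exI[of _ m]) auto
qed

text \<open>Once the approximation has settled on \<open>q\<close> at all places up to
  \<open>2 x + 1\<close>, the side conditions of a matched pair of index at most \<open>x\<close>
  hold automatically, as \<open>q\<close> is injective and \<open>n \<preceq> q n\<close>.\<close>

lemma matched_limit: "\<exists>m. \<forall>s. m \<preceq> s \<longrightarrow> (\<forall>e. e \<preceq> x \<longrightarrow> (\<forall>a b. matched A e s a b \<longleftrightarrow>
    a = q (e \<oplus> e) \<and> b = q (e \<oplus> e \<oplus> \<one>)))"
proof -
  obtain m where m: "\<And>s k. m \<preceq> s \<Longrightarrow> k \<prec> x \<oplus> x \<oplus> \<one> \<oplus> \<one> \<Longrightarrow> A k s = q k" using stage_agrees by blast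
  have "matched A e s a b \<longleftrightarrow> a = q (e \<oplus> e) \<and> b = q (e \<oplus> e \<oplus> \<one>)" if s: "m \<preceq> s" and e: "e \<preceq> x" for s e a b
  proof -
    have "e \<oplus> e \<preceq> x \<oplus> x" using e by (rule A.add_mono[OF _ e])
    then have k: "k \<prec> x \<oplus> x \<oplus> \<one> \<oplus> \<one>" if "k \<preceq> e \<oplus> e \<oplus> \<one>" for k
      using that unfolding le_Suc_iff by (meson A.add_right_mono A.order_trans)
    have le: "e \<oplus> e \<preceq> e \<oplus> e \<oplus> \<one>" by (simp add: le_iff_add)
    have A1: "A (e \<oplus> e) s = q (e \<oplus> e)" "A (e \<oplus> e \<oplus> \<one>) s = q (e \<oplus> e \<oplus> \<one>)"
      using m[OF s k] le by simp_all
    have d: "d \<oplus> d \<prec> e \<oplus> e" "d \<oplus> d \<oplus> \<one> \<prec> e \<oplus> e" "d \<oplus> d \<prec> e \<oplus> e \<oplus> \<one>" "d \<oplus> d \<oplus> \<one> \<prec> e \<oplus> e \<oplus> \<one>"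
      if "d \<prec> e" for d using double_less[OF that] double_less'[OF that] by (simp_all add: lt_Suc)
    have A2: "A (d \<oplus> d) s = q (d \<oplus> d)" "A (d \<oplus> d \<oplus> \<one>) s = q (d \<oplus> d \<oplus> \<one>)" if "d \<prec> e" for d
      using m[OF s k] d[OF that] by (simp_all add: le_def)
    have "e \<preceq> e \<oplus> e" "e \<preceq> e \<oplus> e \<oplus> \<one>" using le_iff_add add_assoc by metis+
    then have e: "e \<preceq> q (e \<oplus> e)" "e \<preceq> q (e \<oplus> e \<oplus> \<one>)" using q(2) A.order_trans by blast+
    have "q (e \<oplus> e) \<noteq> q (e \<oplus> e \<oplus> \<one>)" using q(3) by (simp add: lt_Suc)
    then show ?thesis unfolding matched_def A1 using A2 q(3) d e by auto
  qed
  then show ?thesis by blast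
qed

lemma matched_pair:
  "\<exists>m. \<forall>s. m \<preceq> s \<longrightarrow> q (e \<oplus> e) \<prec> s \<and> q (e \<oplus> e \<oplus> \<one>) \<prec> s \<and>
     rep A s (q (e \<oplus> e)) = rep A s (q (e \<oplus> e \<oplus> \<one>))"
proof -
  let ?x = "q (e \<oplus> e)" and ?y = "q (e \<oplus> e \<oplus> \<one>)"
  obtain m where m0: "\<And>s e' a b. m \<preceq> s \<Longrightarrow> e' \<preceq> e \<Longrightarrow> matched A e' s a b \<longleftrightarrow>
      a = q (e' \<oplus> e') \<and> b = q (e' \<oplus> e' \<oplus> \<one>)" using matched_limit[of e] by blast
  have m: "matched A e s ?x ?y" if "m \<preceq> s" for s using m0[OF that, of e] by simp
  let ?m = "m \<oplus> (?x \<oplus> \<one>) \<oplus> (?y \<oplus> \<one>)"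
  have "?x \<prec> s \<and> ?y \<prec> s \<and> rep A s ?x = rep A s ?y" if s: "?m \<preceq> s" for s
  proof -
    have le: "m \<preceq> s" "?x \<oplus> \<one> \<preceq> s" "?y \<oplus> \<one> \<preceq> s" using add_le3 s A.order_trans by blast+
    note mt = m[OF le(1)]
    \<comment> \<open>The first member of a matched pair is not the second member of any, as the
      pairs of a stage are disjoint.\<close>
    have "rep A s ?x = ?x"
    proof (rule rep_unmatched, rule notI)
      fix e' w assume mt': "matched A e' s w ?x"
      then have "e = e'" using matched_disjoint[OF mt mt'] by simp
      then show False using mt mt' unfolding matched_def by auto
    qed
    then show ?thesis using rep_matched[OF mt] le by (simp add: Suc_le_iff)
  qed
  then show ?thesis by blast
qed

text \<open>A number \<open>x\<close> outside the limit pairs can only be touched by indices up to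
  \<open>x\<close>; these settle on pairs not containing it, so \<open>x\<close> is eventually alone
  in its colour.\<close>

lemma rep_stable: "rainbow_stable M (\<lambda>x s. pr (rep A s x) s)"
  unfolding rainbow_stable_def almost_all_iff
proof
  fix x
  show "(\<exists>y. y \<noteq> x \<and> (\<exists>m. \<forall>s. m \<preceq> s \<longrightarrow> x \<prec> s \<and> y \<prec> s \<and> pr (rep A s x) s = pr (rep A s y) s)) \<or>
    (\<exists>m. \<forall>s. m \<preceq> s \<longrightarrow> x \<prec> s \<and> \<not> (\<exists>y. y \<noteq> x \<and> y \<prec> s \<and> pr (rep A s x) s = pr (rep A s y) s))"
  proof (cases "\<exists>e. x = q (e \<oplus> e) \<or> x = q (e \<oplus> e \<oplus> \<one>)")
    case True
    then obtain e where e: "x = q (e \<oplus> e) \<or> x = q (e \<oplus> e \<oplus> \<one>)" by blast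
    have "q (e \<oplus> e) \<noteq> q (e \<oplus> e \<oplus> \<one>)" using q(3) by (simp add: lt_Suc)
    then show ?thesis using e matched_pair[of e] by auto metis+
  next
    case False
    obtain m where m: "\<And>s e a b. m \<preceq> s \<Longrightarrow> e \<preceq> x \<Longrightarrow> matched A e s a b \<Longrightarrow>
        a = q (e \<oplus> e) \<and> b = q (e \<oplus> e \<oplus> \<one>)" using matched_limit[of x] by blast
    have none: "\<not> matched A e s x b" "\<not> matched A e s b x" if "m \<preceq> s" for s e b
    proof -
      have "e \<preceq> x" if "matched A e s x b \<or> matched A e s b x" using that unfolding matched_def by blast
      then show "\<not> matched A e s x b" "\<not> matched A e s b x" using m[OF \<open>m \<preceq> s\<close>] False by blast+
    qed
    have "x \<prec> s \<and> \<not> (\<exists>y. y \<noteq> x \<and> y \<prec> s \<and> pr (rep A s x) s = pr (rep A s y) s)" if s: "m \<oplus> (x \<oplus> \<one>) \<preceq> s" for s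
    proof -
      have "m \<preceq> m \<oplus> (x \<oplus> \<one>)" "x \<oplus> \<one> \<preceq> m \<oplus> (x \<oplus> \<one>)" unfolding le_iff_add using add_comm by blast+
      then have ms: "m \<preceq> s" "x \<prec> s" using s A.order_trans unfolding Suc_le_iff[symmetric] by blast+
      have "rep A s x = x" using rep_unmatched none[OF ms(1)] by blast
      moreover have "rep A s y \<noteq> x" if "y \<noteq> x" for y
        using that none[OF ms(1)] rep_matched[of A _ s _ y] rep_unmatched[of A s y] by metis
      ultimately show ?thesis using ms(2) by (metis pr_inj)
    qed
    then show ?thesis by blast
  qed
qed

end

lemma SRRT22_imp_diagonalizing:
  assumes "SRRT22 M"
  shows "diagonalizing_principle M"
  unfolding diagonalizing_principle_def
proof (intro allI impI)
  fix h assume "Delta_fun M 2 h"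
  then have h: "Fn (Suc (Suc 0)) h" by (simp only: numeral_2_eq_2 Delta_fun_iff)
  obtain q where q: "Fn (Suc (Suc 0)) q" "\<And>n. n \<preceq> q n" "\<And>i n. i \<prec> n \<Longrightarrow> q i \<noteq> q n"
    and win: "\<And>e n. n = e \<oplus> e \<or> n = e \<oplus> e \<oplus> \<one> \<Longrightarrow> good_window (h e) n \<Longrightarrow> \<exists>i. i \<preceq> n \<oplus> n \<and> q n = sq (h e) i"
    using fresh_sequence[OF h] by metis
  obtain A where A: "T (\<lambda>e. A (e 0) (e (Suc 0)))" "\<And>x. \<exists>m. \<forall>s. m \<preceq> s \<longrightarrow> A x s = q x"
    using limit_lemma[OF q(1)] by metis
  let ?f = "\<lambda>x s. pr (rep A s x) s"
  obtain R where R: "R \<in> S" "\<not> finite_in M R" "rainbow M ?f R"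
    using assms in_model_rep[OF A(1)] rep_two_bounded[of A] rep_stable[of q A, OF q A] unfolding SRRT22_def by blast
  obtain F where F: "T (\<lambda>e. F (e 0))" "\<And>i. F i \<in> R" "\<And>i j. i \<prec> j \<Longrightarrow> F i \<prec> F j" "\<And>i. i \<preceq> F i"
    using enumerate_infinite[OF R(1,2)] by metis
  note TF = T_T1[of F, OF F(1)]
  \<comment> \<open>The window of \<open>n = 2 e + 1\<close> ends at index \<open>2 n\<close>, so
    this length covers the windows of both members of pair \<open>e\<close>.\<close>
  define b where "b e = (e \<oplus> e \<oplus> \<one>) \<oplus> (e \<oplus> e \<oplus> \<one>) \<oplus> \<one>" for e
  define g where "g e = mu (\<lambda>v. \<forall>i. i \<prec> b e \<longrightarrow> sq v i = F i)" for e
  have D: "D0 (\<lambda>e. \<forall>i. i \<prec> b (e (Suc 0)) \<longrightarrow> sq (e 0) i = F i)" unfolding b_def by (rule T_sq TF d0_rules)+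
  have ex: "\<exists>v. \<forall>i. i \<prec> n \<longrightarrow> sq v i = F i" for n
    by (rule choice_D0[of "\<lambda>j y. y = F j"], (rule TF d0_rules)+, blast)
  note mu = T_mu[of "\<lambda>v e. \<forall>i. i \<prec> b (e 0) \<longrightarrow> sq v i = F i", OF D ex]
  have Tg: "T (\<lambda>e. g (e 0))" using mu(1) by (simp add: g_def)
  have g: "sq (g e) i = F i" if "i \<prec> b e" for e i using mu(2)[of "\<lambda>_. e"] that by (simp add: g_def)
  have "g e \<noteq> h e" for e
  proof
    assume eq: "g e = h e"
    \<comment> \<open>As \<open>h e\<close> codes this initial segment of the rainbow, both windows
      are good, and the choices made from them are members of \<open>R\<close>.\<close>
    have in_R: "q n \<in> R" if n: "n = e \<oplus> e \<or> n = e \<oplus> e \<oplus> \<one>" for n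
    proof -
      have "n \<preceq> e \<oplus> e \<oplus> \<one>" using n by (auto simp: le_iff_add)
      then have "n \<oplus> n \<preceq> (e \<oplus> e \<oplus> \<one>) \<oplus> (e \<oplus> e \<oplus> \<one>)" by (intro A.add_mono)
      then have sq: "sq (h e) i = F i" if "i \<preceq> n \<oplus> n" for i
        using g[of i e] that eq A.order_trans unfolding b_def le_Suc_iff by metis
      have "good_window (h e) n" unfolding good_window_def
      proof (intro conjI allI impI)
        show "n \<preceq> sq (h e) i" if "i \<preceq> n \<oplus> n" "n \<preceq> i" for i
          using sq[OF that(1)] F(4)[of i] that(2) A.order_trans by metis
        show "sq (h e) i \<noteq> sq (h e) j" if "j \<preceq> n \<oplus> n" "i \<prec> j" for i j
        proof -
          have "i \<preceq> n \<oplus> n" using that by (meson A.less_imp_le A.order_trans)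
          then show ?thesis using sq that(1) F(3)[OF that(2)] by (metis lt_irrefl)
        qed
      qed
      from win[OF n this] show ?thesis using sq F(2) by auto
    qed
    let ?x = "q (e \<oplus> e)" and ?y = "q (e \<oplus> e \<oplus> \<one>)"
    obtain m where m: "\<And>s. m \<preceq> s \<Longrightarrow> ?x \<prec> s \<and> ?y \<prec> s \<and> rep A s ?x = rep A s ?y"
      using matched_pair[of q A, OF q A] by blast
    \<comment> \<open>A member of the rainbow beyond the stage from which the two numbers share
      their colours yields two pairs of one colour.\<close>
    obtain s where s: "s \<in> R" "m \<preceq> s" using R(2) unfolding finite_in_def by (metis A.not_less)
    have "(?x, s) \<in> pairs_of M R" "(?y, s) \<in> pairs_of M R"
      using in_R s(1) m[OF s(2)] by (simp_all add: pairs_of_def)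
    then have "(?x, s) = (?y, s)" using R(3) m[OF s(2)] unfolding rainbow_def inj_on_def by fastforce
    then show False using q(3)[of "e \<oplus> e" "e \<oplus> e \<oplus> \<one>"] by (simp add: lt_Suc)
  qed
  then show "\<exists>f. in_model1 M UNIV f \<and> diagonalizing h f"
    using Tg unfolding in_model1_T diagonalizing_def by blast
qed

end

theorem theorem5p9:
  fixes M :: "'a l2_struct"
  assumes "RCA0 M" and "ISigma M 2"
  shows "(SRRT22 M \<longleftrightarrow> escaping_principle M) \<and>
         (escaping_principle M \<longleftrightarrow> diagonalizing_principle M) \<and>
         (SRRT22 M \<longleftrightarrow> diagonalizing_principle M)"
proof -
  interpret rca0_ISigma2 M
    using assms by unfold_locales (simp_all add: RCA0_def)
  show ?thesis
    using diagonalizing_imp_escaping escaping_imp_diagonalizing diagonalizing_imp_SRRT22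
      SRRT22_imp_diagonalizing by blast
qed

end
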